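(* Let $d\ge1$ and let $p(x_1,\dots,x_d,z)\in\mathbb{C}[x_1,\dots,x_d,z]$ have no zeros in $\mathbb{H}^{d+1}$, with $p(0)=0$ and $\frac{\partial p}{\partial z}(0)\neq0$, and assume that the zero $0$ of $p$ is isolated with respect to $\mathbb{R}^{d+1}$ (i.e. $0$ is the only zero of $p$ in some neighborhood of $0$ in $\mathbb{R}^{d+1}$). Then there exist $g(x)\in\mathbb{R}[x_1,\dots,x_d]$ and $H(x)\in\mathbb{R}[x_1,\dots,x_d]$ such that the ideal of admissible numerators for $p(x,z)$ is given by $$\mathcal{I}^\infty_p=\big(z+H(x),\,\mathrm{IC}(g(x))\big),$$ where $$\mathrm{IC}(g(x))=\{q(x)\in\mathbb{C}\{x_1,\dots,x_d\}:|q(x)|\lesssim g(x)\text{ for }x\in\mathbb{R}^d\text{ near }0\}.$$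
   Context: $\mathbb{H}=\{z\in\mathbb{C}:\operatorname{Im}z>0\}$ and $\mathbb{D}_\epsilon=\{z\in\mathbb{C}:|z|<\epsilon\}$. $\mathbb{C}\{\cdot\}$ denotes the ring of power series in the given variables convergent in a neighborhood of $0$. The ideal of admissible numerators is $$\mathcal{I}^\infty_p=\{q(x,z)\in\mathbb{C}\{x_1,\dots,x_d,z\}:q/p\text{ is bounded on }\mathbb{H}^{d+1}\cap\mathbb{D}_\epsilon^{d+1}\text{ for some }\epsilon>0\}.$$ The notation $f\lesssim g$ means $f(x)\le Cg(x)$ in some neighborhood of $0$ for some constant $C>0$. $(z+H(x),\mathrm{IC}(g(x)))$ is the ideal of $\mathbb{C}\{x_1,\dots,x_d,z\}$ generated by $z+H(x)$ and all elements of $\mathrm{IC}(g(x))$. *)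

theory Defs
  imports "HOL-Analysis.Analysis" "HOL-Library.Poly_Mapping"
begin

section \<open>Polynomials in several variables\<close>

text \<open>
  The variables are indexed by a finite type \<open>'n\<close>, multi-indices are elements of \<open>nat ^ 'n\<close>.
  The type below is a commutative ring by the instances of \<^theory>\<open>HOL-Library.Poly_Mapping\<close>.
\<close>

type_synonym ('a, 'n) mpoly = "(nat ^ 'n) \<Rightarrow>\<^sub>0 'a"

definition monom_eval :: "'a::comm_semiring_1 ^ 'n \<Rightarrow> nat ^ 'n \<Rightarrow> 'a"
  where "monom_eval w m = (\<Prod>i\<in>UNIV. (w $ i) ^ (m $ i))"

definition mpoly_eval :: "('a::comm_semiring_1, 'n) mpoly \<Rightarrow> 'a ^ 'n \<Rightarrow> 'a"
  where "mpoly_eval p w = (\<Sum>m\<in>Poly_Mapping.keys p. Poly_Mapping.lookup p m * monom_eval w m)"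

definition cvec :: "real ^ 'n \<Rightarrow> complex ^ 'n"
  where "cvec x = (\<chi> i. complex_of_real (x $ i))"


section \<open>Convergent power series\<close>

definition conv_near_0 :: "(nat ^ 'n \<Rightarrow> complex) \<Rightarrow> bool"
  where "conv_near_0 c \<longleftrightarrow>
    (\<forall>\<^sub>F w in nhds 0. (\<lambda>m. c m * monom_eval w m) summable_on UNIV)"

lemma monom_eval_add: "monom_eval w (a + b) = monom_eval w a * monom_eval w b"
  by (simp add: monom_eval_def power_add prod.distrib)

lemma finite_antidiag: "finite {(a, b). a + b = (m :: nat ^ 'n)}"
proof -
  have "finite {a :: nat ^ 'n. \<forall>i. a $ i \<in> {..m $ i}}"
  proof -
    have "{a :: nat ^ 'n. \<forall>i. a $ i \<in> {..m $ i}} \<subseteq> vec_lambda ` PiE UNIV (\<lambda>i. {..m $ i})"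
    proof
      fix a :: "nat ^ 'n"
      assume "a \<in> {a. \<forall>i. a $ i \<in> {..m $ i}}"
      then have "vec_nth a \<in> PiE UNIV (\<lambda>i. {..m $ i})" by auto
      then show "a \<in> vec_lambda ` PiE UNIV (\<lambda>i. {..m $ i})"
        by (metis image_eqI vec_nth_inverse)
    qed
    then show ?thesis
      by (rule finite_subset) (auto intro!: finite_imageI finite_PiE)
  qed
  moreover have "{(a, b). a + b = m} \<subseteq> {a. \<forall>i. a $ i \<in> {..m $ i}} \<times> {a. \<forall>i. a $ i \<in> {..m $ i}}"
    by auto
  ultimately show ?thesis
    by (meson finite_SigmaI finite_subset)
qed

lemma conv_near_0_finite:
  assumes "finite {m. c m \<noteq> 0}"
  shows "conv_near_0 c"
proof -
  have "(\<lambda>m. c m * monom_eval w m) summable_on UNIV" for w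
  proof -
    have "(\<lambda>m. c m * monom_eval w m) summable_on {m. c m \<noteq> 0}"
      using assms by (rule summable_on_finite)
    then show ?thesis
      by (rule summable_on_cong_neutral[THEN iffD1, rotated -1]) auto
  qed
  then show ?thesis by (simp add: conv_near_0_def)
qed

lemma conv_near_0_add:
  assumes "conv_near_0 c" "conv_near_0 d"
  shows "conv_near_0 (\<lambda>m. c m + d m)"
  using assms unfolding conv_near_0_def
  by eventually_elim (simp add: distrib_right summable_on_add)

lemma conv_near_0_uminus:
  assumes "conv_near_0 c"
  shows "conv_near_0 (\<lambda>m. - c m)"
  using assms unfolding conv_near_0_def
  by eventually_elim (simp add: summable_on_uminus)

lemma summable_on_pairs:
  fixes f :: "'a \<Rightarrow> complex" and g :: "'b \<Rightarrow> complex"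
  assumes "f summable_on A" "g summable_on B"
  shows "(\<lambda>p. f (fst p) * g (snd p)) summable_on A \<times> B"
proof -
  have f: "(\<lambda>x. norm (f x)) summable_on A" and g: "(\<lambda>x. norm (g x)) summable_on B"
    using assms summable_on_iff_abs_summable_on_complex by blast+
  have "(\<lambda>p. norm (f (fst p) * g (snd p))) summable_on A \<times> B"
  proof (rule summable_on_SigmaI)
    fix x assume "x \<in> A"
    show "((\<lambda>y. norm (f (fst (x, y)) * g (snd (x, y)))) has_sum norm (f x) * (\<Sum>\<^sub>\<infinity>y\<in>B. norm (g y))) B"
      using has_sum_cmult_right[OF has_sum_infsum[OF g], of "norm (f x)"] by (simp add: norm_mult)
  next
    show "(\<lambda>x. norm (f x) * (\<Sum>\<^sub>\<infinity>y\<in>B. norm (g y))) summable_on A"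
      by (rule summable_on_cmult_left[OF f])
  qed auto
  then show ?thesis
    by (rule abs_summable_summable)
qed

lemma conv_near_0_times:
  fixes c d :: "nat ^ 'n \<Rightarrow> complex"
  assumes "conv_near_0 c" "conv_near_0 d"
  shows "conv_near_0 (\<lambda>m. \<Sum>(a, b) | a + b = m. c a * d b)"
  using assms unfolding conv_near_0_def
proof eventually_elim
  case (elim w)
  let ?F = "\<lambda>(a, b). (c a * monom_eval w a) * (d b * monom_eval w b)"
  let ?S = "\<lambda>m. {(a, b). a + b = (m :: nat ^ 'n)}"
  have "?F summable_on UNIV \<times> UNIV"
    using summable_on_pairs[OF elim] by (simp add: case_prod_unfold)
  then have "(\<lambda>(m, p). ?F p) summable_on Sigma UNIV ?S"
    by (subst summable_on_reindex_bij_witness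
        [where i = "\<lambda>p. (fst p + snd p, p)" and j = snd and T = "UNIV \<times> UNIV" and h = ?F]) auto
  then have "(\<lambda>m. infsum ?F (?S m)) summable_on UNIV"
    by (rule summable_on_Sigma_banach)
  moreover have "infsum ?F (?S m) = (\<Sum>(a, b) | a + b = m. c a * d b) * monom_eval w m" for m
    by (auto simp: finite_antidiag sum_distrib_right monom_eval_add intro!: sum.cong)
  ultimately show ?case by simp
qed

typedef 'n conv_ps = "{c :: nat ^ 'n \<Rightarrow> complex. conv_near_0 c}"
  morphisms cps_coeff Abs_conv_ps
  by (rule exI[of _ "\<lambda>_. 0"]) (simp add: conv_near_0_finite)

setup_lifting type_definition_conv_ps

instantiation conv_ps :: (finite) comm_ring_1
begin

lift_definition zero_conv_ps :: "'a conv_ps" is "\<lambda>_. 0"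
  by (simp add: conv_near_0_finite)

lift_definition one_conv_ps :: "'a conv_ps" is "\<lambda>m. if m = 0 then 1 else 0"
  by (simp add: conv_near_0_finite)

lift_definition plus_conv_ps :: "'a conv_ps \<Rightarrow> 'a conv_ps \<Rightarrow> 'a conv_ps"
  is "\<lambda>c d m. c m + d m"
  by (rule conv_near_0_add)

lift_definition uminus_conv_ps :: "'a conv_ps \<Rightarrow> 'a conv_ps" is "\<lambda>c m. - c m"
  by (rule conv_near_0_uminus)

lift_definition minus_conv_ps :: "'a conv_ps \<Rightarrow> 'a conv_ps \<Rightarrow> 'a conv_ps"
  is "\<lambda>c d m. c m - d m"
  using conv_near_0_add conv_near_0_uminus by fastforce

lift_definition times_conv_ps :: "'a conv_ps \<Rightarrow> 'a conv_ps \<Rightarrow> 'a conv_ps"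
  is "\<lambda>c d m. \<Sum>(a, b) | a + b = m. c a * d b"
  by (rule conv_near_0_times)

instance
proof
  fix f g h :: "'a conv_ps"
  show "f * g * h = f * (g * h)"
  proof (transfer, rule ext)
    fix f g h :: "nat ^ 'a \<Rightarrow> complex" and m :: "nat ^ 'a"
    let ?S = "\<lambda>m. {(a, b). a + b = (m :: nat ^ 'a)}"
    have "(\<Sum>(a, b)\<in>?S m. (\<Sum>(r, s)\<in>?S a. f r * g s) * h b)
        = (\<Sum>p\<in>?S m. \<Sum>q\<in>?S (fst p). f (fst q) * g (snd q) * h (snd p))"
      by (simp add: sum_distrib_right case_prod_unfold)
    also have "\<dots> = (\<Sum>(p, q)\<in>Sigma (?S m) (\<lambda>p. ?S (fst p)). f (fst q) * g (snd q) * h (snd p))"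
      by (rule sum.Sigma) (auto simp: finite_antidiag)
    also have "\<dots> = (\<Sum>(p, q)\<in>Sigma (?S m) (\<lambda>p. ?S (snd p)). f (fst p) * (g (fst q) * h (snd q)))"
      by (rule sum.reindex_bij_witness
          [where i = "\<lambda>(p, q). ((fst p + fst q, snd q), (fst p, fst q))"
             and j = "\<lambda>(p, q). ((fst q, snd q + snd p), (snd q, snd p))"])
        (auto simp: algebra_simps)
    also have "\<dots> = (\<Sum>p\<in>?S m. \<Sum>q\<in>?S (snd p). f (fst p) * (g (fst q) * h (snd q)))"
      by (rule sum.Sigma[symmetric]) (auto simp: finite_antidiag)
    also have "\<dots> = (\<Sum>(a, b)\<in>?S m. f a * (\<Sum>(r, s)\<in>?S b. g r * h s))"
      by (simp add: sum_distrib_left case_prod_unfold)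
    finally show "(\<Sum>(a, b)\<in>?S m. (\<Sum>(r, s)\<in>?S a. f r * g s) * h b)
        = (\<Sum>(a, b)\<in>?S m. f a * (\<Sum>(r, s)\<in>?S b. g r * h s))" .
  qed
  show "f * g = g * f"
    by (transfer, rule ext, rule sum.reindex_bij_witness[where i = prod.swap and j = prod.swap])
      (auto simp: add.commute)
  show "1 * f = f"
  proof (transfer, rule ext)
    fix f :: "nat ^ 'a \<Rightarrow> complex" and m :: "nat ^ 'a"
    have "(\<Sum>(a, b) | a + b = m. (if a = 0 then 1 else 0) * f b)
        = (\<Sum>(a, b)\<in>{(0 :: nat ^ 'a, m)}. (if a = 0 then 1 else 0) * f b)"
      by (rule sum.mono_neutral_right) (auto simp: finite_antidiag split: if_splits)
    then show "(\<Sum>(a, b) | a + b = m. (if a = 0 then 1 else 0) * f b) = f m" by simp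
  qed
  show "(f + g) * h = f * h + g * h"
    by (transfer, rule ext)
      (simp add: sum.distrib[symmetric] case_prod_unfold distrib_right)
  show "(0 :: 'a conv_ps) \<noteq> 1"
    by transfer (metis zero_neq_one)
qed (transfer; auto)+

end

definition cps_eval :: "'n conv_ps \<Rightarrow> complex ^ 'n \<Rightarrow> complex"
  where "cps_eval f w = (\<Sum>\<^sub>\<infinity>m. cps_coeff f m * monom_eval w m)"

lift_definition cps_of_mpoly :: "(complex, 'n::finite) mpoly \<Rightarrow> 'n conv_ps" is Poly_Mapping.lookup
  by (simp add: conv_near_0_finite)

text \<open>
  The variables \<open>x\<^sub>1, \<dots>, x\<^sub>d\<close> are indexed by a type \<open>'d\<close> with \<open>d\<close> elements. The variables
  \<open>x\<^sub>1, \<dots>, x\<^sub>d, z\<close> are indexed by \<open>'d option\<close>, where \<^term>\<open>None\<close> is the index of \<open>z\<close>.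
  The following map is the inclusion of the power series in \<open>x\<close> into the power series
  in \<open>(x, z)\<close>.
\<close>

lift_definition cps_incl :: "'d::finite conv_ps \<Rightarrow> 'd option conv_ps"
  is "\<lambda>c m. if m $ None = 0 then c (\<chi> j. m $ Some j) else 0"
proof -
  fix c :: "nat ^ 'd \<Rightarrow> complex"
  assume "conv_near_0 c"
  moreover have "filterlim (\<lambda>w :: complex ^ 'd option. \<chi> j. w $ Some j) (nhds (\<chi> j. 0 $ Some j)) (nhds 0)"
    by (intro tendsto_vec_lambda tendsto_vec_nth tendsto_ident_at filterlim_ident)
  moreover have "(\<chi> j. (0 :: complex ^ 'd option) $ Some j) = 0"
    by (simp add: vec_eq_iff)
  ultimately have "\<forall>\<^sub>F w :: complex ^ 'd option in nhds 0.
      (\<lambda>m. c m * monom_eval (\<chi> j. w $ Some j) m) summable_on UNIV"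
    unfolding conv_near_0_def by (auto dest: eventually_compose_filterlim)
  then show "conv_near_0 (\<lambda>m. if m $ None = 0 then c (\<chi> j. m $ Some j) else 0)"
    unfolding conv_near_0_def
  proof eventually_elim
    case (elim w)
    let ?C = "\<lambda>m. if m $ None = 0 then c (\<chi> j. m $ Some j) else 0"
    have me: "monom_eval w m = monom_eval (\<chi> j. w $ Some j) (\<chi> j. m $ Some j)"
      if "m $ None = 0" for m
      using that by (simp add: monom_eval_def UNIV_option_conv prod.reindex)
    have "(\<lambda>m. ?C m * monom_eval w m) summable_on {m. m $ None = 0}"
      by (subst summable_on_reindex_bij_witness
          [where i = "\<lambda>m. \<chi> i. case i of None \<Rightarrow> 0 | Some j \<Rightarrow> m $ j" and j = "\<lambda>m. \<chi> j. m $ Some j"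
             and T = UNIV and h = "\<lambda>m. c m * monom_eval (\<chi> j. w $ Some j) m"])
        (auto simp: vec_eq_iff me elim split: option.splits)
    then show ?case
      by (rule summable_on_cong_neutral[THEN iffD1, rotated -1]) auto
  qed
qed

definition cps_z :: "'d::finite option conv_ps"
  where "cps_z = cps_of_mpoly (Poly_Mapping.single (axis None 1) 1)"


section \<open>Ideals\<close>

lemma module_times: "module ((*) :: 'a::comm_ring_1 \<Rightarrow> 'a \<Rightarrow> 'a)"
  by unfold_locales (simp_all add: algebra_simps)

definition ideal_gen :: "'a::comm_ring_1 set \<Rightarrow> 'a set"
  where "ideal_gen S = module.span (*) S"

text \<open>
  Enlarging \<open>\<epsilon>\<close> only makes the condition below stronger, so the value of \<^const>\<open>cps_eval\<close> at points
  where the series diverges is irrelevant.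
\<close>

definition admissible_numerators :: "(complex, 'n::finite) mpoly \<Rightarrow> 'n conv_ps set"
  where "admissible_numerators p = {q. \<exists>\<epsilon>>0. bounded
    ((\<lambda>w. cps_eval q w / mpoly_eval p w) ` {w. \<forall>i. Im (w $ i) > 0 \<and> norm (w $ i) < \<epsilon>})}"

definition IC :: "(real, 'd::finite) mpoly \<Rightarrow> 'd conv_ps set"
  where "IC g = {q. \<exists>C>0. \<forall>\<^sub>F x in nhds 0. norm (cps_eval q (cvec x)) \<le> C * mpoly_eval g x}"

end

theory Submission
  imports Defs
begin

text \<open>
  Since \<open>p\<close> vanishes at \<open>0\<close> to first order in \<open>z\<close>, it equals \<open>z + \<phi>(x)\<close> up to a unit, for a convergent
  power series \<open>\<phi>\<close> with \<open>\<phi>(0) = 0\<close> (\<open>implicit_function_comparison\<close>). Admissibility of \<open>q\<close> therefore means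
  that \<open>\<bar>q\<bar>\<close> is dominated by \<open>\<bar>z + \<phi>(x)\<bar>\<close> on the product of half-planes near \<open>0\<close>.

  Stability says that \<open>-\<phi>(x)\<close> never lies in the upper half-plane when all \<open>x\<^sub>j\<close> do, so
  \<open>Im \<phi> \<ge> 0\<close> there, and the isolated zero says that \<open>B(x) = Im \<phi>(x)\<close> is positive for real \<open>x \<noteq> 0\<close>.
  Restricted to a coordinate axis, \<open>\<phi>\<close> is a nonzero function of one variable with nonnegative imaginary
  part on a half-disc; its leading term must then be \<open>\<alpha>\<^sub>j t\<close> with \<open>\<alpha>\<^sub>j > 0\<close>. Hence \<open>\<phi>\<close> is
  the sum of a linear form with positive coefficients and a remainder with small Lipschitz constant, and
  \<open>Im \<phi>(\<xi> + i\<eta>) \<ge> B(\<xi>) + \<kappa> (\<eta>\<^sub>1 + \<dots> + \<eta>\<^sub>d)\<close>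
  (\<open>Im_lower_bound_half_space\<close>). A series \<open>r(x)\<close> differs between \<open>\<xi>\<close> and \<open>\<xi> + i\<eta>\<close> by at most a
  constant times \<open>\<eta>\<^sub>1 + \<dots> + \<eta>\<^sub>d\<close>. So \<open>\<bar>r\<bar> \<lesssim> B\<close> on real points already gives
  \<open>\<bar>r\<bar> \<lesssim> Im \<phi> \<le> \<bar>z + \<phi>\<bar>\<close> on the half-space, and the converse follows by letting \<open>z\<close> tend to
  \<open>-Re \<phi>(x)\<close>: the admissible numerators that depend on \<open>x\<close> only are \<open>IC(B)\<close>.

  To replace \<open>B\<close> and \<open>Re \<phi>\<close> by polynomials, one needs \<open>B(x) \<ge> c \<parallel>x\<parallel>\<^sup>N\<close>. This is a consequence of a
  Lojasiewicz inequality for the real polynomial \<open>\<bar>p\<bar>\<^sup>2\<close>, which has an isolated zero at \<open>0\<close>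
  (\<open>polynomial_isolated_zero_lower_bound\<close>), evaluated at \<open>z = -Re \<phi>(x)\<close>. Let \<open>H\<close> and \<open>g\<close> be the
  polynomials of degree at most \<open>N\<close> whose coefficients are the real and imaginary parts of those of \<open>\<phi>\<close>. The error
  is of order \<open>N + 1\<close>, hence at most \<open>B / 2\<close> near \<open>0\<close>. Thus \<open>IC(g) = IC(B)\<close> and
  \<open>z + H = (z + \<phi>) + (H - \<phi>)\<close> is admissible. Finally, every series is divisible by \<open>z + H\<close> with a
  remainder in \<open>x\<close> alone (\<open>division_regular_order_one\<close>), and for an admissible numerator this
  remainder is admissible, that is, in \<open>IC(g)\<close>.
\<close>

section \<open>Multi-indices and polydiscs\<close>

definition mdeg :: "nat ^ 'n \<Rightarrow> nat"
  where "mdeg m = (\<Sum>i\<in>UNIV. m $ i)"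

lemma mdeg_0 [simp]: "mdeg 0 = 0"
  by (simp add: mdeg_def)

lemma mdeg_add: "mdeg (a + b) = mdeg a + mdeg b"
  by (simp add: mdeg_def sum.distrib)

lemma mdeg_axis [simp]: "mdeg (axis i k :: nat ^ 'n::finite) = k"
  by (simp add: mdeg_def axis_def)

lemma component_le_mdeg: "m $ i \<le> mdeg (m :: nat ^ 'n::finite)"
  unfolding mdeg_def by (rule member_le_sum) auto

lemma mdeg_eq_0_iff: "mdeg (m :: nat ^ 'n::finite) = 0 \<longleftrightarrow> m = 0"
  by (auto simp: mdeg_def vec_eq_iff)

lemma mdeg_eq_1_iff: "mdeg (m :: nat ^ 'n::finite) = 1 \<longleftrightarrow> (\<exists>i. m = axis i 1)"
proof
  assume 1: "mdeg m = 1"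
  then obtain i where i: "m $ i \<noteq> 0"
    by (metis mdeg_eq_0_iff vec_eq_iff zero_index zero_neq_one)
  have s: "m $ i + (\<Sum>j\<in>UNIV - {i}. m $ j) = 1"
    using 1 by (simp add: mdeg_def sum.remove[of UNIV i])
  then have "m $ i = 1" "(\<Sum>j\<in>UNIV - {i}. m $ j) = 0"
    using i by linarith+
  then have "m = axis i 1"
    by (auto simp: vec_eq_iff axis_def)
  then show "\<exists>i. m = axis i 1" ..
qed auto

lemma finite_bounded_multi_indices: "finite {m :: nat ^ 'n::finite. \<forall>i. m $ i \<le> N}"
proof (rule finite_subset)
  show "{m :: nat ^ 'n. \<forall>i. m $ i \<le> N} \<subseteq> fst ` {(a, b). a + b = (\<chi> i. N)}"
  proof
    fix m :: "nat ^ 'n" assume "m \<in> {m. \<forall>i. m $ i \<le> N}"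
    then have "m + (\<chi> i. N - m $ i) = (\<chi> i. N)" by (simp add: vec_eq_iff)
    then show "m \<in> fst ` {(a, b). a + b = (\<chi> i. N)}"
      by (metis (mono_tags, lifting) case_prodI fst_conv image_iff mem_Collect_eq)
  qed
qed (simp add: finite_antidiag)

lemma finite_mdeg_le: "finite {m :: nat ^ 'n::finite. mdeg m \<le> N}"
  by (rule finite_subset[OF _ finite_bounded_multi_indices[of N]])
    (auto intro: order_trans[OF component_le_mdeg])

lemma monom_eval_0 [simp]: "monom_eval w 0 = 1"
  by (simp add: monom_eval_def)

lemma monom_eval_axis: "monom_eval w (axis i k :: nat ^ 'n::finite) = (w $ i) ^ k"
proof -
  have "monom_eval w (axis i k) = (\<Prod>j\<in>{i}. (w $ j) ^ (axis i k $ j))"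
    unfolding monom_eval_def by (rule prod.mono_neutral_right) (auto simp: axis_def)
  then show ?thesis by simp
qed

lemma norm_monom_eval_le:
  fixes w :: "'a::{real_normed_field} ^ 'n::finite"
  assumes "\<And>i. norm (w $ i) \<le> s"
  shows "norm (monom_eval w m) \<le> s ^ mdeg m"
proof -
  have "norm (monom_eval w m) = (\<Prod>i\<in>UNIV. norm (w $ i) ^ (m $ i))"
    by (simp add: monom_eval_def norm_power flip: prod_norm)
  also have "\<dots> \<le> (\<Prod>i\<in>UNIV. s ^ (m $ i))"
    by (rule prod_mono) (auto intro!: power_mono assms)
  finally show ?thesis by (simp add: mdeg_def power_sum)
qed

text \<open>
  The bound is that of the gradient of a monomial on the polydisc of radius \<open>s\<close>; rescaling by \<open>s\<close> reduces
  it to the known estimate for products of numbers in the unit disc.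
\<close>

lemma norm_monom_eval_diff_le:
  fixes w v :: "'a::{real_normed_field} ^ 'n::finite"
  assumes w: "\<And>i. norm (w $ i) \<le> s" and v: "\<And>i. norm (v $ i) \<le> s" and s: "s > 0"
  shows "norm (monom_eval w m - monom_eval v m)
    \<le> real (mdeg m) * s ^ (mdeg m - 1) * (\<Sum>i\<in>UNIV. norm (w $ i - v $ i))"
proof (cases "mdeg m = 0")
  case True
  then show ?thesis by (simp add: mdeg_eq_0_iff)
next
  case False
  let ?w = "\<lambda>i. (w $ i / of_real s) ^ (m $ i)" and ?v = "\<lambda>i. (v $ i / of_real s) ^ (m $ i)"
  have scale: "monom_eval u m = of_real (s ^ mdeg m) * (\<Prod>i\<in>UNIV. (u $ i / of_real s) ^ (m $ i))"
    for u :: "'a ^ 'n"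
    using s by (simp add: monom_eval_def mdeg_def power_sum power_divide flip: prod.distrib)
  have le1: "norm (w $ i / of_real s) \<le> 1" "norm (v $ i / of_real s) \<le> 1" for i
    using w[of i] v[of i] s by (auto simp: norm_divide divide_le_eq_1)
  have "norm ((\<Prod>i\<in>UNIV. ?w i) - (\<Prod>i\<in>UNIV. ?v i)) \<le> (\<Sum>i\<in>UNIV. norm (?w i - ?v i))"
    by (rule norm_prod_diff) (use le1 in \<open>auto simp: norm_power intro!: power_le_one\<close>)
  also have "\<dots> \<le> (\<Sum>i\<in>UNIV. real (mdeg m) * (norm (w $ i - v $ i) / s))"
  proof (rule sum_mono)
    fix i
    have "norm (?w i - ?v i) \<le> real (m $ i) * norm (w $ i / of_real s - v $ i / of_real s)"
      using le1 by (intro norm_power_diff) auto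
    also have "norm (w $ i / of_real s - v $ i / of_real s) = norm (w $ i - v $ i) / s"
      using s by (simp add: norm_divide flip: diff_divide_distrib)
    also have "real (m $ i) * (norm (w $ i - v $ i) / s) \<le> real (mdeg m) * (norm (w $ i - v $ i) / s)"
      using s component_le_mdeg[of m i] by (intro mult_right_mono) auto
    finally show "norm (?w i - ?v i) \<le> real (mdeg m) * (norm (w $ i - v $ i) / s)" .
  qed
  finally have le: "norm ((\<Prod>i\<in>UNIV. ?w i) - (\<Prod>i\<in>UNIV. ?v i))
      \<le> (\<Sum>i\<in>UNIV. real (mdeg m) * (norm (w $ i - v $ i) / s))" .
  have "norm (monom_eval w m - monom_eval v m)
      = s ^ mdeg m * norm ((\<Prod>i\<in>UNIV. ?w i) - (\<Prod>i\<in>UNIV. ?v i))"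
    unfolding scale right_diff_distrib[symmetric] norm_mult using s by (simp add: norm_power)
  also have "\<dots> \<le> s ^ mdeg m * (\<Sum>i\<in>UNIV. real (mdeg m) * (norm (w $ i - v $ i) / s))"
    using le s by (intro mult_left_mono) auto
  also have "\<dots> = real (mdeg m) * (s ^ mdeg m / s) * (\<Sum>i\<in>UNIV. norm (w $ i - v $ i))"
    by (simp add: sum_distrib_left sum_distrib_right mult_ac)
  also have "s ^ mdeg m / s = s ^ (mdeg m - 1)"
    using False s by (simp add: power_diff)
  finally show ?thesis .
qed

lemma eventually_nhds_0_polydisc:
  fixes P :: "'a::real_normed_vector ^ 'n::finite \<Rightarrow> bool"
  shows "(\<forall>\<^sub>F w in nhds 0. P w) \<longleftrightarrow> (\<exists>\<delta>>0. \<forall>w. (\<forall>i. norm (w $ i) < \<delta>) \<longrightarrow> P w)"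
proof
  assume "\<forall>\<^sub>F w in nhds 0. P w"
  then obtain d where d: "d > 0" "\<And>w. norm w < d \<Longrightarrow> P w"
    by (auto simp: eventually_nhds_metric)
  let ?c = "real CARD('n)"
  have "P w" if "\<forall>i. norm (w $ i) < d / ?c" for w
  proof (rule d(2))
    have "norm w \<le> (\<Sum>i\<in>UNIV. norm (w $ i))"
      unfolding norm_vec_def by (rule L2_set_le_sum) auto
    also have "\<dots> < (\<Sum>i\<in>(UNIV :: 'n set). d / ?c)"
      using that by (intro sum_strict_mono) auto
    finally show "norm w < d" by simp
  qed
  then show "\<exists>\<delta>>0. \<forall>w. (\<forall>i. norm (w $ i) < \<delta>) \<longrightarrow> P w"
    using d(1) by (intro exI[of _ "d / ?c"]) auto
next
  assume "\<exists>\<delta>>0. \<forall>w. (\<forall>i. norm (w $ i) < \<delta>) \<longrightarrow> P w"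
  then obtain d where d: "d > 0" "\<And>w. (\<forall>i. norm (w $ i) < d) \<Longrightarrow> P w" by auto
  have "P w" if "norm w < d" for w
    by (rule d(2)) (use that Finite_Cartesian_Product.norm_nth_le in \<open>blast intro: order.strict_trans1\<close>)
  then show "\<forall>\<^sub>F w in nhds 0. P w"
    using d(1) by (auto simp: eventually_nhds_metric)
qed


section \<open>Convergent power series as functions near the origin\<close>

text \<open>
  Over a box of multi-indices the sum factorises into geometric sums, and every finite set of
  multi-indices lies in a box.
\<close>

lemma geometric_multi_summable:
  fixes s :: real
  assumes "0 \<le> s" "s < 1"
  shows "(\<lambda>m :: nat ^ 'n::finite. s ^ mdeg m) summable_on UNIV"
proof (rule nonneg_bdd_above_summable_on)
  show "bdd_above (sum (\<lambda>m :: nat ^ 'n. s ^ mdeg m) ` {F. F \<subseteq> UNIV \<and> finite F})"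
  proof (rule bdd_aboveI2)
    fix F :: "(nat ^ 'n) set" assume "F \<in> {F. F \<subseteq> UNIV \<and> finite F}"
    then have F: "finite F" by simp
    obtain N where N: "\<And>m. m \<in> F \<Longrightarrow> mdeg m \<le> N"
      using finite_nat_set_iff_bounded_le[of "mdeg ` F"] F by auto
    have "(\<Sum>m\<in>F. s ^ mdeg m) = (\<Sum>f\<in>vec_nth ` F. \<Prod>i\<in>UNIV. s ^ f i)"
      by (subst sum.reindex) (auto simp: inj_on_def vec_eq_iff mdeg_def power_sum)
    also have "\<dots> \<le> (\<Sum>f\<in>PiE (UNIV :: 'n set) (\<lambda>_. {..N}). \<Prod>i\<in>UNIV. s ^ f i)"
    proof (rule sum_mono2)
      show "vec_nth ` F \<subseteq> PiE UNIV (\<lambda>_. {..N})"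
        using order_trans[OF component_le_mdeg N] by auto
    qed (auto intro!: finite_PiE prod_nonneg zero_le_power assms)
    also have "\<dots> = (\<Prod>i\<in>(UNIV :: 'n set). \<Sum>k\<in>{..N}. s ^ k)"
      by (rule prod_sum_PiE[symmetric]) auto
    also have "\<dots> \<le> (\<Prod>i\<in>(UNIV :: 'n set). 1 / (1 - s))"
    proof (rule prod_mono, safe)
      show "(\<Sum>k\<le>N. s ^ k) \<le> 1 / (1 - s)"
        using sum_le_suminf[OF summable_geometric[of s], of "{..N}"] assms
        by (simp add: suminf_geometric)
    qed (auto intro!: sum_nonneg zero_le_power assms)
    finally show "(\<Sum>m\<in>F. s ^ mdeg m) \<le> (\<Prod>i\<in>(UNIV :: 'n set). 1 / (1 - s))" .
  qed
qed (use assms in auto)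

lemma conv_near_0_if_geometric_bound:
  fixes c :: "nat ^ 'n::finite \<Rightarrow> complex"
  assumes R: "R > 0" and c: "\<And>m. norm (c m) * R ^ mdeg m \<le> K"
  shows "conv_near_0 c"
  unfolding conv_near_0_def eventually_nhds_0_polydisc
proof (intro exI[of _ "R / 2"] conjI allI impI)
  fix w :: "complex ^ 'n" assume w: "\<forall>i. norm (w $ i) < R / 2"
  show "(\<lambda>m. c m * monom_eval w m) summable_on UNIV"
  proof (rule abs_summable_summable, rule summable_on_comparison_test)
    show "(\<lambda>m :: nat ^ 'n. K * (1 / 2) ^ mdeg m) summable_on UNIV"
      by (intro summable_on_cmult_right geometric_multi_summable) auto
    fix m
    have "norm (c m * monom_eval w m) \<le> norm (c m) * (R / 2) ^ mdeg m"
      unfolding norm_mult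
      by (intro mult_left_mono norm_monom_eval_le) (use w in \<open>auto intro: less_imp_le\<close>)
    also have "\<dots> = (norm (c m) * R ^ mdeg m) * (1 / 2) ^ mdeg m"
      by (simp add: power_divide)
    also have "\<dots> \<le> K * (1 / 2) ^ mdeg m"
      by (intro mult_right_mono c) auto
    finally show "norm (c m * monom_eval w m) \<le> K * (1 / 2) ^ mdeg m" .
  qed auto
qed (use R in auto)

lemma conv_near_0_summable_radius:
  fixes c :: "nat ^ 'n::finite \<Rightarrow> complex"
  assumes "conv_near_0 c"
  obtains R where "R > 0" "(\<lambda>m. norm (c m) * R ^ mdeg m) summable_on UNIV"
proof -
  obtain d where d: "d > 0" "\<And>w. (\<forall>i. norm (w $ i) < d) \<Longrightarrow> (\<lambda>m. c m * monom_eval w m) summable_on UNIV"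
    using assms unfolding conv_near_0_def eventually_nhds_0_polydisc by blast
  let ?w = "\<chi> i. complex_of_real (d / 2) :: complex ^ 'n"
  have "(\<lambda>m. c m * monom_eval ?w m) summable_on UNIV"
    by (rule d(2)) (use d(1) in auto)
  then have "(\<lambda>m. norm (c m * monom_eval ?w m)) summable_on UNIV"
    by (simp add: summable_on_iff_abs_summable_on_complex)
  moreover have "norm (c m * monom_eval ?w m) = norm (c m) * (d / 2) ^ mdeg m" for m
    using d(1) by (simp add: norm_mult monom_eval_def mdeg_def norm_power power_sum power_divide norm_divide flip: prod_norm)
  ultimately show ?thesis using that[of "d / 2"] d(1) by simp
qed

lemma conv_near_0_cps_coeff: "conv_near_0 (cps_coeff f)"
  using cps_coeff by auto

lemma cps_coeff_Abs: "conv_near_0 c \<Longrightarrow> cps_coeff (Abs_conv_ps c) = c"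
  by (simp add: Abs_conv_ps_inverse)

lemma eventually_cps_eval_plus:
  fixes f g :: "'n::finite conv_ps"
  shows "\<forall>\<^sub>F w in nhds 0. cps_eval (f + g) w = cps_eval f w + cps_eval g w"
  using conv_near_0_cps_coeff[of f] conv_near_0_cps_coeff[of g] unfolding conv_near_0_def
  by eventually_elim (simp add: cps_eval_def plus_conv_ps.rep_eq distrib_right infsum_add)

lemma cps_eval_uminus: "cps_eval (- f) w = - cps_eval f w" for f :: "'n::finite conv_ps"
  by (simp add: cps_eval_def uminus_conv_ps.rep_eq infsum_uminus)

lemma eventually_cps_eval_minus:
  fixes f g :: "'n::finite conv_ps"
  shows "\<forall>\<^sub>F w in nhds 0. cps_eval (f - g) w = cps_eval f w - cps_eval g w"
  using eventually_cps_eval_plus[of f "- g"] by (simp add: cps_eval_uminus)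

text \<open>
  Wherever both series converge, they converge absolutely, so the double series of products can be
  summed along the fibres of addition.
\<close>

lemma eventually_cps_eval_times:
  fixes f g :: "'n::finite conv_ps"
  shows "\<forall>\<^sub>F w in nhds 0. cps_eval (f * g) w = cps_eval f w * cps_eval g w"
  using conv_near_0_cps_coeff[of f] conv_near_0_cps_coeff[of g] unfolding conv_near_0_def
proof eventually_elim
  case (elim w)
  let ?F = "\<lambda>(a, b). (cps_coeff f a * monom_eval w a) * (cps_coeff g b * monom_eval w b)"
  let ?S = "\<lambda>m. {(a, b). a + b = (m :: nat ^ 'n)}"
  have F: "?F summable_on UNIV \<times> UNIV"
    using summable_on_pairs[OF elim] by (simp add: case_prod_unfold)
  then have F': "(\<lambda>(m, p). ?F p) summable_on Sigma UNIV ?S"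
    by (subst summable_on_reindex_bij_witness
        [where i = "\<lambda>p. (fst p + snd p, p)" and j = snd and T = "UNIV \<times> UNIV" and h = ?F]) auto
  have "cps_eval f w * cps_eval g w = infsum ?F (UNIV \<times> UNIV)"
  proof -
    have "infsum ?F (UNIV \<times> UNIV) = (\<Sum>\<^sub>\<infinity>a. \<Sum>\<^sub>\<infinity>b. (cps_coeff f a * monom_eval w a) * (cps_coeff g b * monom_eval w b))"
      using infsum_Sigma'_banach[of "\<lambda>a b. (cps_coeff f a * monom_eval w a) * (cps_coeff g b * monom_eval w b)" UNIV "\<lambda>_. UNIV"] F by simp
    also have "\<dots> = cps_eval f w * cps_eval g w"
      by (simp add: infsum_cmult_right' infsum_cmult_left' cps_eval_def)
    finally show ?thesis ..
  qed
  also have "\<dots> = infsum (\<lambda>(m, p). ?F p) (Sigma UNIV ?S)"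
    by (rule infsum_reindex_bij_witness[where j = "\<lambda>p. (fst p + snd p, p)" and i = snd]) auto
  also have "\<dots> = (\<Sum>\<^sub>\<infinity>m. infsum ?F (?S m))"
    using infsum_Sigma'_banach[of "\<lambda>m p. ?F p" UNIV ?S] F' by simp
  also have "\<dots> = (\<Sum>\<^sub>\<infinity>m. cps_coeff (f * g) m * monom_eval w m)"
    by (auto simp: finite_antidiag sum_distrib_right monom_eval_add times_conv_ps.rep_eq
        intro!: sum.cong infsum_cong)
  finally show ?case by (simp add: cps_eval_def)
qed

lemma cps_eval_of_mpoly: "cps_eval (cps_of_mpoly p) w = mpoly_eval p w"
proof -
  have "cps_eval (cps_of_mpoly p) w = (\<Sum>\<^sub>\<infinity>m\<in>Poly_Mapping.keys p. Poly_Mapping.lookup p m * monom_eval w m)"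
    unfolding cps_eval_def cps_of_mpoly.rep_eq
    by (rule infsum_cong_neutral) (auto simp: in_keys_iff)
  then show ?thesis by (simp add: mpoly_eval_def)
qed

lemma mpoly_eval_single: "mpoly_eval (Poly_Mapping.single m c) w = c * monom_eval w m"
  by (simp add: mpoly_eval_def)

lemma cps_eval_z: "cps_eval cps_z w = w $ None"
  by (simp add: cps_z_def cps_eval_of_mpoly mpoly_eval_single monom_eval_axis)

lemma cps_coeff_z: "cps_coeff cps_z m = (if m = axis None 1 then 1 else 0)"
  by (simp add: cps_z_def cps_of_mpoly.rep_eq lookup_single when_def eq_commute)

lemma cps_eval_incl: "cps_eval (cps_incl f) w = cps_eval f (\<chi> j. w $ Some j)"
proof -
  have me: "monom_eval w m = monom_eval (\<chi> j. w $ Some j) (\<chi> j. m $ Some j)" if "m $ None = 0" for m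
    using that by (simp add: monom_eval_def UNIV_option_conv prod.reindex)
  have "cps_eval (cps_incl f) w
      = (\<Sum>\<^sub>\<infinity>m | m $ None = 0. cps_coeff f (\<chi> j. m $ Some j) * monom_eval (\<chi> j. w $ Some j) (\<chi> j. m $ Some j))"
    unfolding cps_eval_def cps_incl.rep_eq
    by (rule infsum_cong_neutral) (auto simp: me)
  also have "\<dots> = cps_eval f (\<chi> j. w $ Some j)"
    unfolding cps_eval_def
    by (rule infsum_reindex_bij_witness
        [where j = "\<lambda>m. \<chi> j. m $ Some j" and i = "\<lambda>m. \<chi> i. case i of None \<Rightarrow> 0 | Some j \<Rightarrow> m $ j"])
      (auto simp: vec_eq_iff split: option.splits)
  finally show ?thesis .
qed

text \<open>
  Compared with the polydisc of some radius \<open>R\<close> on which the series converges absolutely, every term is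
  smaller by the factor \<open>(s / R)\<^sup>N\<close> at least.
\<close>

lemma cps_eval_power_bound:
  fixes f :: "'n::finite conv_ps"
  assumes "\<And>m. mdeg m < N \<Longrightarrow> cps_coeff f m = 0"
  obtains K \<delta> where "K > 0" "\<delta> > 0"
    "\<forall>w s. s \<le> \<delta> \<longrightarrow> (\<forall>i. norm (w $ i) \<le> s) \<longrightarrow> norm (cps_eval f w) \<le> K * s ^ N"
proof -
  obtain R where R: "R > 0" and sR: "(\<lambda>m. norm (cps_coeff f m) * R ^ mdeg m) summable_on UNIV"
    using conv_near_0_summable_radius[OF conv_near_0_cps_coeff] by blast
  define S where "S = (\<Sum>\<^sub>\<infinity>m. norm (cps_coeff f m) * R ^ mdeg m)"
  have "S \<ge> 0" unfolding S_def using R by (auto intro!: infsum_nonneg)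
  have "norm (cps_eval f w) \<le> (S + 1) / R ^ N * s ^ N" if s: "s \<le> R" and w: "\<And>i. norm (w $ i) \<le> s" for w s
  proof -
    have s0: "s \<ge> 0" using norm_ge_zero order_trans w by blast
    have le: "norm (cps_coeff f m * monom_eval w m) \<le> norm (cps_coeff f m) * R ^ mdeg m * (s / R) ^ N" for m
    proof (cases "mdeg m < N")
      case False
      have "norm (cps_coeff f m * monom_eval w m) \<le> norm (cps_coeff f m) * s ^ mdeg m"
        by (auto simp: norm_mult intro!: mult_left_mono norm_monom_eval_le w)
      also have "s ^ mdeg m = R ^ mdeg m * (s / R) ^ mdeg m"
        using R by (simp add: power_divide)
      also have "norm (cps_coeff f m) * (R ^ mdeg m * (s / R) ^ mdeg m)
          \<le> norm (cps_coeff f m) * (R ^ mdeg m * (s / R) ^ N)"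
        using R False s s0 by (intro mult_left_mono power_decreasing) auto
      finally show ?thesis by (simp add: mult_ac)
    qed (simp add: assms)
    have sum: "(\<lambda>m. norm (cps_coeff f m) * R ^ mdeg m * (s / R) ^ N) summable_on UNIV"
      by (intro summable_on_cmult_left sR)
    have abs: "(\<lambda>m. norm (cps_coeff f m * monom_eval w m)) summable_on UNIV"
      by (rule summable_on_comparison_test[OF sum]) (use le in auto)
    have "norm (cps_eval f w) \<le> (\<Sum>\<^sub>\<infinity>m. norm (cps_coeff f m * monom_eval w m))"
      unfolding cps_eval_def by (rule norm_infsum_bound[OF abs])
    also have "\<dots> \<le> (\<Sum>\<^sub>\<infinity>m. norm (cps_coeff f m) * R ^ mdeg m * (s / R) ^ N)"
      by (rule infsum_mono[OF abs sum le])
    also have "\<dots> = S * (s / R) ^ N"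
      by (simp add: infsum_cmult_left' S_def)
    also have "\<dots> \<le> (S + 1) * (s / R) ^ N"
      using s0 R by (intro mult_right_mono) auto
    finally show ?thesis by (simp add: power_divide)
  qed
  then show ?thesis using that[of "(S + 1) / R ^ N" R] R \<open>S \<ge> 0\<close> by auto
qed

lemma mult_half_power_le_1: "real n * (1 / 2) ^ n \<le> 1"
proof -
  have "real n \<le> 2 ^ n" by (simp add: less_imp_le of_nat_less_two_power)
  then show ?thesis by (simp add: power_divide)
qed

text \<open>
  The constant term cancels in the difference. When also the terms of degrees \<open>1, \<dots>, N\<close> are absent, the
  Lipschitz constant on the polydisc of radius \<open>s\<close> is of order \<open>s\<^sup>N\<close>. The case \<open>N = 0\<close> gives a
  Lipschitz bound for every series; the case \<open>N = 1\<close> shows that the nonlinear part has an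
  arbitrarily small Lipschitz constant.
\<close>

lemma cps_eval_lipschitz:
  fixes f :: "'n::finite conv_ps"
  assumes f: "\<And>m. 0 < mdeg m \<Longrightarrow> mdeg m \<le> N \<Longrightarrow> cps_coeff f m = 0"
  obtains K \<delta> where "K > 0" "\<delta> > 0"
    "\<forall>w v s. 0 < s \<longrightarrow> s \<le> \<delta> \<longrightarrow> (\<forall>i. norm (w $ i) \<le> s) \<longrightarrow> (\<forall>i. norm (v $ i) \<le> s) \<longrightarrow>
      norm (cps_eval f w - cps_eval f v) \<le> K * s ^ N * (\<Sum>i\<in>UNIV. norm (w $ i - v $ i))"
proof -
  obtain R where R: "R > 0" and sR: "(\<lambda>m. norm (cps_coeff f m) * R ^ mdeg m) summable_on UNIV"
    using conv_near_0_summable_radius[OF conv_near_0_cps_coeff] by blast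
  define S where "S = (\<Sum>\<^sub>\<infinity>m. norm (cps_coeff f m) * R ^ mdeg m)"
  have S0: "S \<ge> 0" unfolding S_def using R by (auto intro!: infsum_nonneg)
  have "norm (cps_eval f w - cps_eval f v)
      \<le> (S + 1) * (2 / R) ^ Suc N * s ^ N * (\<Sum>i\<in>UNIV. norm (w $ i - v $ i))"
    if s: "0 < s" "s \<le> R / 2" and w: "\<And>i. norm (w $ i) \<le> s" and v: "\<And>i. norm (v $ i) \<le> s" for w v s
  proof -
    define D where "D = (\<Sum>i\<in>UNIV. norm (w $ i - v $ i))"
    have D: "D \<ge> 0" unfolding D_def by (simp add: sum_nonneg)
    have summ: "(\<lambda>m. cps_coeff f m * monom_eval u m) summable_on UNIV" if u: "\<And>i. norm (u $ i) \<le> s" for u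
    proof (rule abs_summable_summable, rule summable_on_comparison_test[OF sR])
      fix m
      have "norm (monom_eval u m) \<le> R ^ mdeg m"
        by (rule norm_monom_eval_le) (use u s in \<open>smt (verit) field_sum_of_halves\<close>)
      then show "norm (cps_coeff f m * monom_eval u m) \<le> norm (cps_coeff f m) * R ^ mdeg m"
        by (simp add: norm_mult mult_left_mono)
    qed auto
    let ?d = "\<lambda>m. cps_coeff f m * monom_eval w m - cps_coeff f m * monom_eval v m"
    let ?C = "(2 / R) ^ Suc N * s ^ N * D"
    \<comment> \<open>Differentiating costs a factor \<open>mdeg m\<close>, which is absorbed by halving the radius.\<close>
    have le: "norm (?d m) \<le> norm (cps_coeff f m) * R ^ mdeg m * ?C" for m
    proof (cases "mdeg m \<le> N")
      case True
      then have "?d m = 0"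
        using f[of m] by (cases "mdeg m = 0") (auto simp: mdeg_eq_0_iff)
      then have "norm (?d m) = 0" by simp
      also have "0 \<le> norm (cps_coeff f m) * R ^ mdeg m * ?C" using R s D by simp
      finally show ?thesis .
    next
      case False
      then obtain k where k: "mdeg m = Suc (k + N)"
        by (metis add_Suc add_Suc_right le_add_diff_inverse2 not_less_eq_eq)
      have "norm (?d m) = norm (cps_coeff f m) * norm (monom_eval w m - monom_eval v m)"
        by (simp add: norm_mult flip: right_diff_distrib)
      also have "\<dots> \<le> norm (cps_coeff f m) * (real (mdeg m) * s ^ (mdeg m - 1) * D)"
        unfolding D_def by (intro mult_left_mono norm_monom_eval_diff_le s w v) auto
      also have "real (mdeg m) * s ^ (mdeg m - 1) \<le> R ^ mdeg m * ((2 / R) ^ Suc N * s ^ N)"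
      proof -
        have "s ^ (mdeg m - 1) \<le> (R / 2) ^ k * s ^ N"
          using s by (auto simp: k power_add intro!: mult_right_mono power_mono)
        also have "(R / 2) ^ k = (R / 2) ^ mdeg m * (2 / R) ^ Suc N"
          using R by (simp add: k power_add power_divide field_simps)
        finally have "real (mdeg m) * s ^ (mdeg m - 1)
            \<le> real (mdeg m) * ((R / 2) ^ mdeg m * (2 / R) ^ Suc N * s ^ N)"
          by (rule mult_left_mono) auto
        also have "\<dots> = (real (mdeg m) * (1 / 2) ^ mdeg m) * (R ^ mdeg m * ((2 / R) ^ Suc N * s ^ N))"
          by (simp add: power_divide)
        also have "\<dots> \<le> 1 * (R ^ mdeg m * ((2 / R) ^ Suc N * s ^ N))"
          using R s by (intro mult_right_mono mult_half_power_le_1) auto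
        finally show ?thesis by simp
      qed
      finally show ?thesis using D by (simp add: mult_left_mono mult_right_mono mult_ac)
    qed
    have sum: "(\<lambda>m. norm (cps_coeff f m) * R ^ mdeg m * ?C) summable_on UNIV"
      by (intro summable_on_cmult_left sR)
    have abs: "(\<lambda>m. norm (?d m)) summable_on UNIV"
      by (rule summable_on_comparison_test[OF sum]) (use le in auto)
    have "cps_eval f w - cps_eval f v = infsum ?d UNIV"
      using infsum_add[OF summ[of w] summable_on_uminus[THEN iffD2, OF summ[of v]]] w v
      by (simp add: cps_eval_def infsum_uminus)
    then have "norm (cps_eval f w - cps_eval f v) \<le> (\<Sum>\<^sub>\<infinity>m. norm (?d m))"
      using norm_infsum_bound[OF abs] by simp
    also have "\<dots> \<le> (\<Sum>\<^sub>\<infinity>m. norm (cps_coeff f m) * R ^ mdeg m * ?C)"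
      by (rule infsum_mono[OF abs sum le])
    also have "\<dots> = S * ?C"
      unfolding S_def by (rule infsum_cmult_left')
    also have "\<dots> \<le> (S + 1) * ?C"
      using s R D by (intro mult_right_mono) auto
    finally show ?thesis by (simp add: D_def mult_ac)
  qed
  then show ?thesis using that[of "(S + 1) * (2 / R) ^ Suc N" "R / 2"] R S0 by auto
qed


section \<open>A Lojasiewicz inequality at an isolated zero of a polynomial\<close>

lemma underdetermined_system_nontrivial_solution:
  fixes M :: "'a \<Rightarrow> 'b \<Rightarrow> real"
  assumes "finite B" "finite A" "card B < card A"
  shows "\<exists>a. (\<exists>i\<in>A. a i \<noteq> 0) \<and> (\<forall>b\<in>B. (\<Sum>i\<in>A. a i * M i b) = 0)"
  using assms
proof (induction B arbitrary: A M rule: finite_induct)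
  case empty
  then have "A \<noteq> {}" by auto
  then show ?case by (intro exI[of _ "\<lambda>_. 1"]) auto
next
  case (insert b B)
  show ?case
  proof (cases "\<forall>i\<in>A. M i b = 0")
    case True
    have "card B < card A" using insert by simp
    then obtain a where "\<exists>i\<in>A. a i \<noteq> 0" "\<forall>b\<in>B. (\<Sum>i\<in>A. a i * M i b) = 0"
      using insert.IH[of A M] insert.prems by blast
    then show ?thesis using True by (intro exI[of _ a]) auto
  next
    case False
    then obtain i0 where i0: "i0 \<in> A" "M i0 b \<noteq> 0" by auto
    let ?M = "\<lambda>i b'. M i b' - M i b / M i0 b * M i0 b'"
    have "card B < card (A - {i0})" using insert i0 by simp
    then obtain a where a: "\<exists>i\<in>A - {i0}. a i \<noteq> 0" "\<forall>b\<in>B. (\<Sum>i\<in>A - {i0}. a i * ?M i b) = 0"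
      using insert.IH[of "A - {i0}" ?M] insert.prems by blast
    define s where "s = (\<Sum>i\<in>A - {i0}. a i * M i b)"
    define a' where "a' = a(i0 := - s / M i0 b)"
    have sum: "(\<Sum>i\<in>A. a' i * M i b') = - s / M i0 b * M i0 b' + (\<Sum>i\<in>A - {i0}. a i * M i b')" for b'
      using insert.prems i0 by (simp add: sum.remove[of A i0] a'_def)
    have "(\<Sum>i\<in>A. a' i * M i b') = 0" if "b' \<in> insert b B" for b'
    proof (cases "b' = b")
      case True
      then show ?thesis using i0 by (simp add: sum s_def)
    next
      case False
      then have "0 = (\<Sum>i\<in>A - {i0}. a i * ?M i b')" using a that by simp
      also have "\<dots> = (\<Sum>i\<in>A - {i0}. a i * M i b') - s / M i0 b * M i0 b'"
        unfolding right_diff_distrib sum_subtractf s_def sum_divide_distrib sum_distrib_right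
        by (simp add: mult_ac)
      finally show ?thesis by (simp add: sum)
    qed
    moreover have "\<exists>i\<in>A. a' i \<noteq> 0" using a by (auto simp: a'_def)
    ultimately show ?thesis by blast
  qed
qed

definition small_indices :: "nat \<Rightarrow> (nat ^ 'n::finite) set"
  where "small_indices L = {\<beta>. \<forall>i. \<beta> $ i < L}"

text \<open>
  Here \<open>Z t x\<close> is a relation between a parameter \<open>t\<close> and a point \<open>x\<close>, and a function is reducible if
  on \<open>Z\<close> it is a combination of the finitely many monomials in \<open>x\<close> with exponents below \<open>L\<close>, with
  coefficients that are polynomials in \<open>t\<close> of degree at most \<open>N\<close>.
\<close>

definition reducible ::
    "nat \<Rightarrow> (real \<Rightarrow> real ^ 'n::finite \<Rightarrow> bool) \<Rightarrow> nat \<Rightarrow> (real \<Rightarrow> real ^ 'n \<Rightarrow> real) \<Rightarrow> bool"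
  where "reducible L Z N f \<longleftrightarrow> (\<exists>u. \<forall>t x. Z t x \<longrightarrow>
    f t x = (\<Sum>l\<le>N. \<Sum>\<beta>\<in>small_indices L. u l \<beta> * t ^ l * monom_eval x \<beta>))"

lemma finite_small_indices: "finite (small_indices L)"
  by (rule finite_subset[OF _ finite_bounded_multi_indices[of L]]) (auto simp: small_indices_def less_imp_le)

lemma reducible_mono:
  assumes "reducible L Z N f" "N \<le> N'"
  shows "reducible L Z N' f"
proof -
  obtain u where u: "\<And>t x. Z t x \<Longrightarrow>
      f t x = (\<Sum>l\<le>N. \<Sum>\<beta>\<in>small_indices L. u l \<beta> * t ^ l * monom_eval x \<beta>)"
    using assms(1) unfolding reducible_def by blast
  have "f t x = (\<Sum>l\<le>N'. \<Sum>\<beta>\<in>small_indices L. (if l \<le> N then u l \<beta> else 0) * t ^ l * monom_eval x \<beta>)"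
    if "Z t x" for t x
    unfolding u[OF that] using assms(2) by (intro sum.mono_neutral_cong_left) (auto simp: finite_small_indices)
  then show ?thesis unfolding reducible_def
    by (intro exI[of _ "\<lambda>l \<beta>. if l \<le> N then u l \<beta> else 0"]) simp
qed

lemma reducible_add:
  assumes "reducible L Z N f" "reducible L Z N g"
  shows "reducible L Z N (\<lambda>t x. f t x + g t x)"
proof -
  obtain u where u: "\<And>t x. Z t x \<Longrightarrow>
      f t x = (\<Sum>l\<le>N. \<Sum>\<beta>\<in>small_indices L. u l \<beta> * t ^ l * monom_eval x \<beta>)"
    using assms(1) unfolding reducible_def by blast
  obtain v where v: "\<And>t x. Z t x \<Longrightarrow>
      g t x = (\<Sum>l\<le>N. \<Sum>\<beta>\<in>small_indices L. v l \<beta> * t ^ l * monom_eval x \<beta>)"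
    using assms(2) unfolding reducible_def by blast
  show ?thesis unfolding reducible_def
    by (rule exI[of _ "\<lambda>l \<beta>. u l \<beta> + v l \<beta>"]) (simp add: u v sum.distrib distrib_right)
qed

lemma reducible_cmult:
  assumes "reducible L Z N f"
  shows "reducible L Z N (\<lambda>t x. c * f t x)"
proof -
  obtain u where u: "\<And>t x. Z t x \<Longrightarrow>
      f t x = (\<Sum>l\<le>N. \<Sum>\<beta>\<in>small_indices L. u l \<beta> * t ^ l * monom_eval x \<beta>)"
    using assms(1) unfolding reducible_def by blast
  show ?thesis unfolding reducible_def
    by (rule exI[of _ "\<lambda>l \<beta>. c * u l \<beta>"]) (simp add: u sum_distrib_left mult.assoc)
qed

lemma reducible_zero: "reducible L Z N (\<lambda>t x. 0)"
  unfolding reducible_def by (rule exI[of _ "\<lambda>_ _. 0"]) simp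

lemma reducible_sum:
  assumes "\<And>k. k \<in> K \<Longrightarrow> reducible L Z N (f k)"
  shows "reducible L Z N (\<lambda>t x. \<Sum>k\<in>K. f k t x)"
  using assms
  by (induction K rule: infinite_finite_induct) (auto intro: reducible_zero reducible_add)

lemma reducible_times_parameter:
  assumes "reducible L Z N f"
  shows "reducible L Z (Suc N) (\<lambda>t x. t * f t x)"
proof -
  obtain u where u: "\<And>t x. Z t x \<Longrightarrow>
      f t x = (\<Sum>l\<le>N. \<Sum>\<beta>\<in>small_indices L. u l \<beta> * t ^ l * monom_eval x \<beta>)"
    using assms(1) unfolding reducible_def by blast
  have "t * f t x = (\<Sum>l\<le>Suc N. \<Sum>\<beta>\<in>small_indices L. (case l of 0 \<Rightarrow> 0 | Suc l' \<Rightarrow> u l' \<beta>) * t ^ l * monom_eval x \<beta>)"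
    if "Z t x" for t x
    unfolding u[OF that] sum.atMost_Suc_shift by (simp add: sum_distrib_left mult_ac)
  then show ?thesis unfolding reducible_def
    by (intro exI[of _ "\<lambda>l \<beta>. case l of 0 \<Rightarrow> 0 | Suc l' \<Rightarrow> u l' \<beta>"]) simp
qed

lemma reducible_times_parameter_power:
  assumes "reducible L Z N f"
  shows "reducible L Z (i + N) (\<lambda>t x. t ^ i * f t x)"
proof (induction i)
  case (Suc i)
  then show ?case using reducible_times_parameter[OF Suc] by (simp add: mult.assoc)
qed (simp add: assms)

text \<open>
  Near \<open>0\<close> and for \<open>L \<ge> 2\<close> this is comparable to \<open>\<parallel>x\<parallel>\<^sup>2\<close>. The terms of degree \<open>L + 1\<close> are there for algebraic reasons: they
  make \<open>x\<^sub>i\<^sup>L\<close> the leading terms of the equations for critical points.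
\<close>

definition penalty :: "nat \<Rightarrow> real ^ 'n::finite \<Rightarrow> real"
  where "penalty L x = (\<Sum>i\<in>UNIV. monom_eval x (axis i 2)) - (\<Sum>i\<in>UNIV. monom_eval x (axis i (Suc L)))"

definition polyfun :: "'k set \<Rightarrow> ('k \<Rightarrow> real) \<Rightarrow> ('k \<Rightarrow> nat ^ 'n::finite) \<Rightarrow> real ^ 'n \<Rightarrow> real"
  where "polyfun K c e x = (\<Sum>k\<in>K. c k * monom_eval x (e k))"

text \<open>
  The vanishing of the gradient of \<open>penalty L - t * polyfun K c e\<close> at \<open>x\<close>.
\<close>

definition critical ::
    "nat \<Rightarrow> 'k set \<Rightarrow> ('k \<Rightarrow> real) \<Rightarrow> ('k \<Rightarrow> nat ^ 'n::finite) \<Rightarrow> real \<Rightarrow> real ^ 'n \<Rightarrow> bool"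
  where "critical L K c e t x \<longleftrightarrow> (\<forall>i. real (Suc L) * (x $ i) ^ L =
    2 * x $ i - t * (\<Sum>k\<in>K. c k * (real (e k $ i) * monom_eval x (e k - axis i 1))))"

text \<open>
  The equations for critical points express \<open>x\<^sub>i\<^sup>L\<close> by monomials of lower degree, at the cost of at most one
  factor \<open>t\<close>. As each step lowers the degree, the total degree bounds the power of \<open>t\<close>.
\<close>

lemma reducible_monom:
  fixes e :: "'k \<Rightarrow> nat ^ 'n::finite"
  assumes e: "\<And>k. k \<in> K \<Longrightarrow> mdeg (e k) \<le> L" and L: "2 \<le> L"
  shows "reducible L (critical L K c e) (mdeg \<alpha>) (\<lambda>t x. monom_eval x \<alpha>)"
proof (induction "mdeg \<alpha>" arbitrary: \<alpha> rule: less_induct)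
  case less
  let ?Z = "critical L K c e"
  show ?case
  proof (cases "\<alpha> \<in> small_indices L")
    case True
    have "monom_eval x \<alpha> = (\<Sum>l\<le>0. \<Sum>\<beta>\<in>small_indices L. (if \<beta> = \<alpha> then 1 else 0) * t ^ l * monom_eval x \<beta>)"
      for t :: real and x :: "real ^ 'n"
      using True by (simp add: finite_small_indices if_distrib[of "\<lambda>z. z * _"] cong: if_cong)
    then have "reducible L ?Z 0 (\<lambda>t x. monom_eval x \<alpha>)"
      unfolding reducible_def by (intro exI[of _ "\<lambda>_ \<beta>. if \<beta> = \<alpha> then 1 else 0"]) simp
    then show ?thesis by (rule reducible_mono) simp
  next
    case False
    then obtain i where i: "L \<le> \<alpha> $ i" by (auto simp: small_indices_def not_less)
    define \<gamma> where "\<gamma> = \<alpha> - axis i L"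
    have \<alpha>: "\<alpha> = \<gamma> + axis i L" using i by (auto simp: \<gamma>_def vec_eq_iff axis_def)
    have deg: "mdeg \<alpha> = mdeg \<gamma> + L" by (simp add: \<alpha> mdeg_add)
    let ?A = "\<lambda>t x. 2 * monom_eval x (\<gamma> + axis i 1) +
      - 1 * (t * (\<Sum>k\<in>K. c k * (real (e k $ i) * monom_eval x (\<gamma> + (e k - axis i 1)))))"
    have red: "reducible L ?Z (mdeg \<gamma> + L - 1)
        (\<lambda>t x. real (e k $ i) * monom_eval x (\<gamma> + (e k - axis i 1)))" if k: "k \<in> K" for k
    proof (cases "e k $ i = 0")
      case True
      then show ?thesis by (simp add: reducible_zero)
    next
      case False
      then have "e k = (e k - axis i 1) + axis i 1" by (auto simp: vec_eq_iff axis_def)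
      then have "mdeg (e k) = mdeg (e k - axis i 1) + 1" by (metis mdeg_add mdeg_axis)
      then have "mdeg (\<gamma> + (e k - axis i 1)) \<le> mdeg \<gamma> + L - 1"
        "mdeg (\<gamma> + (e k - axis i 1)) < mdeg \<alpha>"
        using e[OF k] L by (auto simp: mdeg_add deg)
      then show ?thesis using less reducible_mono by (blast intro: reducible_cmult)
    qed
    have "reducible L ?Z (mdeg \<alpha>) (\<lambda>t x. t * (\<Sum>k\<in>K. c k * (real (e k $ i) * monom_eval x (\<gamma> + (e k - axis i 1)))))"
      by (rule reducible_mono[OF reducible_times_parameter[of _ _ "mdeg \<gamma> + L - 1"]])
        (use L deg in \<open>auto intro!: reducible_sum reducible_cmult red simp del: One_nat_def\<close>)
    moreover have "reducible L ?Z (mdeg \<alpha>) (\<lambda>t x. monom_eval x (\<gamma> + axis i 1))"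
      by (rule reducible_mono[OF less]) (use L deg in \<open>auto simp: mdeg_add\<close>)
    ultimately have "reducible L ?Z (mdeg \<alpha>) ?A"
      by (intro reducible_add reducible_cmult)
    then have "reducible L ?Z (mdeg \<alpha>) (\<lambda>t x. 1 / real (Suc L) * ?A t x)"
      by (rule reducible_cmult)
    moreover have "monom_eval x \<alpha> = 1 / real (Suc L) * ?A t x" if "?Z t x" for t x
    proof -
      have "real (Suc L) * monom_eval x \<alpha> = monom_eval x \<gamma> * (real (Suc L) * (x $ i) ^ L)"
        by (simp add: \<alpha> monom_eval_add monom_eval_axis)
      also have "real (Suc L) * (x $ i) ^ L =
          2 * x $ i - t * (\<Sum>k\<in>K. c k * (real (e k $ i) * monom_eval x (e k - axis i 1)))"
        using that unfolding critical_def by blast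
      also have "monom_eval x \<gamma> * \<dots> = ?A t x"
        by (simp add: monom_eval_add monom_eval_axis right_diff_distrib sum_distrib_left sum_negf mult_ac)
      finally show ?thesis by (simp add: field_simps)
    qed
    ultimately show ?thesis unfolding reducible_def by simp
  qed
qed

lemma reducible_value_power_monom:
  fixes e :: "'k \<Rightarrow> nat ^ 'n::finite"
  assumes e: "\<And>k. k \<in> K \<Longrightarrow> mdeg (e k) \<le> L" and L: "2 \<le> L"
  shows "reducible L (critical L K c e) (Suc L * j + mdeg \<alpha>)
    (\<lambda>t x. (penalty L x - t * polyfun K c e x) ^ j * monom_eval x \<alpha>)"
proof (induction j arbitrary: \<alpha>)
  case 0
  then show ?case using reducible_monom[OF e L] by simp
next
  case (Suc j)
  let ?Z = "critical L K c e"
  let ?N = "Suc L * Suc j + mdeg \<alpha>"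
  let ?v = "\<lambda>t x. penalty L x - t * polyfun K c e x"
  let ?m = "\<lambda>\<beta> t x. ?v t x ^ j * monom_eval x (\<alpha> + \<beta>)"
  have red: "reducible L ?Z ?N (?m (axis i l))" if "l \<le> Suc L" for i l
    by (rule reducible_mono[OF Suc]) (use that in \<open>auto simp: mdeg_add\<close>)
  have "reducible L ?Z (?N - 1) (?m (e k))" if "k \<in> K" for k
    by (rule reducible_mono[OF Suc]) (use e[OF that] in \<open>auto simp: mdeg_add\<close>)
  then have "reducible L ?Z (Suc (?N - 1)) (\<lambda>t x. t * (\<Sum>k\<in>K. c k * ?m (e k) t x))"
    by (intro reducible_times_parameter reducible_sum reducible_cmult)
  then have redF: "reducible L ?Z ?N (\<lambda>t x. t * (\<Sum>k\<in>K. c k * ?m (e k) t x))"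
    by simp
  have "reducible L ?Z ?N (\<lambda>t x. (\<Sum>i\<in>UNIV. ?m (axis i 2) t x) + (- 1 * (\<Sum>i\<in>UNIV. ?m (axis i (Suc L)) t x)
      + - 1 * (t * (\<Sum>k\<in>K. c k * ?m (e k) t x))))"
    using L by (intro reducible_add reducible_cmult reducible_sum red redF) auto
  moreover have "(\<lambda>t x. (\<Sum>i\<in>UNIV. ?m (axis i 2) t x) + (- 1 * (\<Sum>i\<in>UNIV. ?m (axis i (Suc L)) t x)
      + - 1 * (t * (\<Sum>k\<in>K. c k * ?m (e k) t x)))) = (\<lambda>t x. ?v t x ^ Suc j * monom_eval x \<alpha>)"
    (is "?l = ?r")
  proof (intro ext)
    fix t :: real and x :: "real ^ 'n"
    have "?v t x = (\<Sum>i\<in>UNIV. monom_eval x (axis i 2)) - (\<Sum>i\<in>UNIV. monom_eval x (axis i (Suc L)))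
        - t * (\<Sum>k\<in>K. c k * monom_eval x (e k))"
      by (simp add: penalty_def polyfun_def)
    then have "?r t x = (?v t x ^ j * monom_eval x \<alpha>) * \<dots>"
      by (simp only: power_Suc mult_ac)
    also have "\<dots> = ?l t x"
      unfolding right_diff_distrib sum_distrib_left monom_eval_add by (simp add: mult_ac sum_negf)
    finally show "?l t x = ?r t x" ..
  qed
  ultimately show ?case by simp
qed

text \<open>
  The critical values \<open>\<nu>\<close> of \<open>penalty L - t * polyfun K c e\<close> satisfy a nontrivial polynomial equation in
  \<open>t\<close> and \<open>\<nu>\<close>, by counting dimensions: on the set of critical points, the products \<open>t\<^sup>i \<nu>\<^sup>j\<close> with
  \<open>i \<le> I\<close>, \<open>j \<le> J\<close> lie in the span of the products \<open>t\<^sup>l x\<^sup>\<beta>\<close> with \<open>l \<le> I + (L + 1) J\<close> and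
  \<open>\<beta>\<close> in a finite set, and there are fewer of the latter than of the former.
\<close>

lemma critical_value_algebraic:
  fixes e :: "'k \<Rightarrow> nat ^ 'n::finite"
  assumes e: "\<And>k. k \<in> K \<Longrightarrow> mdeg (e k) \<le> L" and L: "2 \<le> L"
  obtains I J :: nat and a where "\<exists>i\<le>I. \<exists>j\<le>J. a i j \<noteq> (0::real)"
    "\<And>t x. critical L K c e t x \<Longrightarrow>
      (\<Sum>i\<le>I. \<Sum>j\<le>J. a i j * t ^ i * (penalty L x - t * polyfun K c e x) ^ j) = 0"
proof -
  let ?v = "\<lambda>t x. penalty L x - t * polyfun K c e x"
  define b where "b = card (small_indices L :: (nat ^ 'n) set)"
  \<comment> \<open>The choice of \<open>J\<close> and \<open>I\<close> makes \<open>(I + (L + 1) J + 1) b < (I + 1) (J + 1)\<close>.\<close>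
  define J where "J = 2 * b"
  define I where "I = 2 * Suc L * b"
  define N where "N = I + Suc L * J"
  let ?A = "{..I} \<times> {..J}" and ?B = "{..N} \<times> (small_indices L :: (nat ^ 'n) set)"
  have red: "reducible L (critical L K c e) N (\<lambda>t x. t ^ i * ?v t x ^ j)" if "i \<le> I" "j \<le> J" for i j
  proof -
    have "reducible L (critical L K c e) (i + Suc L * j) (\<lambda>t x. t ^ i * ?v t x ^ j)"
      using reducible_times_parameter_power[OF reducible_value_power_monom[OF e L, where j = j and \<alpha> = 0 and c = c and K = K], where i = i]
      by simp
    moreover have "i + Suc L * j \<le> N"
      unfolding N_def using that by (intro add_mono mult_le_mono2)
    ultimately show ?thesis by (rule reducible_mono)
  qed
  have "\<forall>p\<in>?A. \<exists>u. \<forall>t x. critical L K c e t x \<longrightarrow> t ^ fst p * ?v t x ^ snd p =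
      (\<Sum>l\<le>N. \<Sum>\<beta>\<in>small_indices L. u l \<beta> * t ^ l * monom_eval x \<beta>)"
  proof
    fix p assume "p \<in> ?A"
    then have "fst p \<le> I" "snd p \<le> J" by (auto simp: mem_Times_iff)
    from red[OF this] show "\<exists>u. \<forall>t x. critical L K c e t x \<longrightarrow> t ^ fst p * ?v t x ^ snd p =
      (\<Sum>l\<le>N. \<Sum>\<beta>\<in>small_indices L. u l \<beta> * t ^ l * monom_eval x \<beta>)"
      unfolding reducible_def .
  qed
  from bchoice[OF this] obtain U where U: "\<forall>p\<in>?A. \<forall>t x. critical L K c e t x \<longrightarrow> t ^ fst p * ?v t x ^ snd p =
      (\<Sum>l\<le>N. \<Sum>\<beta>\<in>small_indices L. U p l \<beta> * t ^ l * monom_eval x \<beta>)"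
    by blast
  have "card ?B < card ?A"
  proof -
    have "card ?B = Suc N * b" "card ?A = Suc I * Suc J"
      by (simp_all add: b_def card_cartesian_product)
    then show ?thesis by (simp add: N_def J_def I_def algebra_simps)
  qed
  moreover have "finite ?B" "finite ?A" by (simp_all add: finite_small_indices)
  ultimately have "\<exists>a. (\<exists>p\<in>?A. a p \<noteq> 0) \<and> (\<forall>q\<in>?B. (\<Sum>p\<in>?A. a p * U p (fst q) (snd q)) = 0)"
    by (intro underdetermined_system_nontrivial_solution)
  then obtain a where a: "\<exists>p\<in>?A. a p \<noteq> 0" "\<forall>q\<in>?B. (\<Sum>p\<in>?A. a p * U p (fst q) (snd q)) = 0"
    by (elim exE conjE)
  have "(\<Sum>i\<le>I. \<Sum>j\<le>J. a (i, j) * t ^ i * ?v t x ^ j) = 0" if crit: "critical L K c e t x" for t x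
  proof -
    have "(\<Sum>i\<le>I. \<Sum>j\<le>J. a (i, j) * t ^ i * ?v t x ^ j) = (\<Sum>p\<in>?A. a p * (t ^ fst p * ?v t x ^ snd p))"
      by (simp add: sum.cartesian_product case_prod_unfold mult.assoc)
    also have "\<dots> = (\<Sum>p\<in>?A. \<Sum>q\<in>?B. a p * (U p (fst q) (snd q) * t ^ fst q * monom_eval x (snd q)))"
    proof (rule sum.cong[OF refl])
      fix p assume "p \<in> ?A"
      then have "t ^ fst p * ?v t x ^ snd p =
          (\<Sum>l\<le>N. \<Sum>\<beta>\<in>small_indices L. U p l \<beta> * t ^ l * monom_eval x \<beta>)"
        using U crit by blast
      then show "a p * (t ^ fst p * ?v t x ^ snd p) =
          (\<Sum>q\<in>?B. a p * (U p (fst q) (snd q) * t ^ fst q * monom_eval x (snd q)))"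
        by (simp only: sum.cartesian_product case_prod_unfold sum_distrib_left)
    qed
    also have "\<dots> = (\<Sum>q\<in>?B. (\<Sum>p\<in>?A. a p * U p (fst q) (snd q)) * (t ^ fst q * monom_eval x (snd q)))"
      by (subst sum.swap) (simp only: sum_distrib_right mult.assoc)
    also have "\<dots> = 0"
      by (intro sum.neutral ballI) (simp only: a(2)[rule_format] mult_zero_left)
    finally show ?thesis .
  qed
  moreover have "\<exists>i\<le>I. \<exists>j\<le>J. a (i, j) \<noteq> 0"
    using a(1) by (metis SigmaE atMost_iff)
  ultimately show ?thesis using that[of I J "\<lambda>i j. a (i, j)"] by blast
qed

text \<open>
  In the polynomial, the coefficient of the highest power of \<open>t\<close> is a nonzero polynomial in \<open>\<nu>\<close>. At a root with
  \<open>t\<close> large it is at most of size \<open>1 / t\<close>, and for small \<open>\<nu>\<close> it is at least a multiple of its lowest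
  power of \<open>\<nu>\<close>.
\<close>

lemma small_root_decay:
  fixes a :: "nat \<Rightarrow> nat \<Rightarrow> real"
  assumes "\<exists>i\<le>I. \<exists>j\<le>J. a i j \<noteq> 0"
  obtains C \<eta> :: real and k :: nat where "C > 0" "\<eta> > 0" "k \<ge> 1"
    "\<And>t \<nu>. t \<ge> 1 \<Longrightarrow> 0 \<le> \<nu> \<Longrightarrow> \<nu> \<le> \<eta> \<Longrightarrow> (\<Sum>i\<le>I. \<Sum>j\<le>J. a i j * t ^ i * \<nu> ^ j) = 0 \<Longrightarrow> t * \<nu> ^ k \<le> C"
proof -
  define S where "S = {i. i \<le> I \<and> (\<exists>j\<le>J. a i j \<noteq> 0)}"
  have S: "finite S" "S \<noteq> {}" using assms by (auto simp: S_def)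
  \<comment> \<open>\<open>E\<close> is the degree in \<open>t\<close>, and \<open>k\<close> below is the order in \<open>\<nu>\<close> of the coefficient of \<open>t\<^sup>E\<close>.\<close>
  define E where "E = Max S"
  have "E \<in> S" unfolding E_def using S by (rule Max_in)
  then have E: "E \<le> I" "\<exists>j\<le>J. a E j \<noteq> 0" by (auto simp: S_def)
  have above: "a i j = 0" if "E < i" "i \<le> I" "j \<le> J" for i j
    proof (rule ccontr)
    assume "a i j \<noteq> 0"
    then have "i \<in> S" using that unfolding S_def by blast
    then show False using Max_ge[OF S(1), of i] that(1) by (simp add: E_def)
  qed
  define k where "k = (LEAST j. j \<le> J \<and> a E j \<noteq> 0)"
  have k: "k \<le> J" "a E k \<noteq> 0"
    using LeastI_ex[of "\<lambda>j. j \<le> J \<and> a E j \<noteq> 0"] E(2) by (auto simp: k_def)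
  have below: "a E j = 0" if "j < k" for j
    using not_less_Least[of j "\<lambda>j. j \<le> J \<and> a E j \<noteq> 0"] that k(1) by (auto simp: k_def)
  define M where "M = (\<Sum>i\<le>I. \<Sum>j\<le>J. \<bar>a i j\<bar>)"
  have row: "(\<Sum>j\<le>J. \<bar>a i j\<bar>) \<le> M" if "i \<le> I" for i
    unfolding M_def using that by (intro member_le_sum) (auto intro: sum_nonneg)
  have aM: "\<bar>a E k\<bar> \<le> M"
    using row[OF E(1)] member_le_sum[of k "{..J}" "\<lambda>j. \<bar>a E j\<bar>"] k(1) by simp
  then have M: "M > 0" using k by linarith
  have "t * \<nu> ^ Suc k \<le> 2 * M / \<bar>a E k\<bar>"
    if t: "t \<ge> 1" and \<nu>: "0 \<le> \<nu>" "\<nu> \<le> \<bar>a E k\<bar> / (2 * M)"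
      and zero: "(\<Sum>i\<le>I. \<Sum>j\<le>J. a i j * t ^ i * \<nu> ^ j) = 0" for t \<nu>
  proof -
    have "\<bar>a E k\<bar> / (2 * M) \<le> 1" using aM M by (simp add: divide_le_eq)
    then have \<nu>1: "\<nu> \<le> 1" using \<nu> by linarith
    define top where "top = (\<Sum>j\<le>J. a E j * \<nu> ^ j)"
    have "(\<Sum>i\<le>I. \<Sum>j\<le>J. a i j * t ^ i * \<nu> ^ j) = (\<Sum>i\<le>E. \<Sum>j\<le>J. a i j * t ^ i * \<nu> ^ j)"
      using E(1) above by (intro sum.mono_neutral_right) auto
    also have "\<dots> = (\<Sum>i<E. \<Sum>j\<le>J. a i j * t ^ i * \<nu> ^ j) + (\<Sum>j\<le>J. a E j * t ^ E * \<nu> ^ j)"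
      by (subst lessThan_Suc_atMost[symmetric, of E]) simp
    also have "(\<Sum>j\<le>J. a E j * t ^ E * \<nu> ^ j) = t ^ E * top"
      by (simp add: top_def sum_distrib_left mult_ac)
    finally have eq: "t ^ E * top = - (\<Sum>i<E. \<Sum>j\<le>J. a i j * t ^ i * \<nu> ^ j)"
      using zero by simp
    have "t ^ E * \<bar>top\<bar> = \<bar>t ^ E * top\<bar>"
      using t by (simp add: abs_mult)
    also have "\<dots> = \<bar>\<Sum>i<E. \<Sum>j\<le>J. a i j * t ^ i * \<nu> ^ j\<bar>"
      unfolding eq by (rule abs_minus_cancel)
    also have "\<dots> \<le> (\<Sum>i<E. \<Sum>j\<le>J. \<bar>a i j\<bar> * t ^ i)"
    proof (rule order_trans[OF sum_abs], rule sum_mono, rule order_trans[OF sum_abs], rule sum_mono)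
      fix i j
      have "\<nu> ^ j \<le> 1" using \<nu> \<nu>1 by (simp add: power_le_one)
      then have "\<bar>a i j\<bar> * t ^ i * \<nu> ^ j \<le> \<bar>a i j\<bar> * t ^ i * 1"
        using t by (intro mult_left_mono) auto
      then show "\<bar>a i j * t ^ i * \<nu> ^ j\<bar> \<le> \<bar>a i j\<bar> * t ^ i"
        using t \<nu> by (simp add: abs_mult)
    qed
    finally have "t ^ E * \<bar>top\<bar> \<le> (\<Sum>i<E. \<Sum>j\<le>J. \<bar>a i j\<bar> * t ^ i)" .
    then have "t * (t ^ E * \<bar>top\<bar>) \<le> t * (\<Sum>i<E. \<Sum>j\<le>J. \<bar>a i j\<bar> * t ^ i)"
      using t by (intro mult_left_mono) auto
    also have "\<dots> = (\<Sum>i<E. \<Sum>j\<le>J. \<bar>a i j\<bar> * t ^ Suc i)"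
      by (simp add: sum_distrib_left mult_ac)
    also have "\<dots> \<le> (\<Sum>i<E. \<Sum>j\<le>J. \<bar>a i j\<bar> * t ^ E)"
      using t by (intro sum_mono mult_left_mono power_increasing) auto
    also have "\<dots> = t ^ E * (\<Sum>i<E. \<Sum>j\<le>J. \<bar>a i j\<bar>)"
      by (simp add: sum_distrib_left mult_ac)
    also have "\<dots> \<le> t ^ E * M"
      unfolding M_def using t E(1) by (intro mult_left_mono sum_mono2) (auto intro: sum_nonneg)
    finally have "t ^ E * (t * \<bar>top\<bar>) \<le> t ^ E * M" by (simp add: mult_ac)
    then have top_le: "t * \<bar>top\<bar> \<le> M" using t by simp
    have "top = (\<Sum>j\<in>{k..J}. a E j * \<nu> ^ j)"
      unfolding top_def using below by (intro sum.mono_neutral_right) (auto simp: not_le)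
    also have "\<dots> = a E k * \<nu> ^ k + (\<Sum>j\<in>{Suc k..J}. a E j * \<nu> ^ j)"
      using k(1) by (simp add: sum.atLeast_Suc_atMost)
    finally have top_eq: "top = a E k * \<nu> ^ k + (\<Sum>j\<in>{Suc k..J}. a E j * \<nu> ^ j)" .
    have "\<bar>\<Sum>j\<in>{Suc k..J}. a E j * \<nu> ^ j\<bar> \<le> (\<Sum>j\<in>{Suc k..J}. \<bar>a E j\<bar> * \<nu> ^ Suc k)"
    proof (rule order_trans[OF sum_abs], rule sum_mono)
      fix j assume "j \<in> {Suc k..J}"
      then have "\<nu> ^ j \<le> \<nu> ^ Suc k" using \<nu> \<nu>1 by (intro power_decreasing) auto
      then show "\<bar>a E j * \<nu> ^ j\<bar> \<le> \<bar>a E j\<bar> * \<nu> ^ Suc k"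
        using \<nu> by (simp add: abs_mult mult_left_mono)
    qed
    also have "\<dots> = \<nu> ^ Suc k * (\<Sum>j\<in>{Suc k..J}. \<bar>a E j\<bar>)"
      by (simp add: sum_distrib_left mult_ac)
    also have "\<dots> \<le> \<nu> ^ Suc k * (\<Sum>j\<le>J. \<bar>a E j\<bar>)"
      using \<nu> by (intro mult_left_mono sum_mono2) auto
    also have "\<dots> \<le> \<nu> ^ Suc k * M"
      using \<nu> by (intro mult_left_mono row E(1)) auto
    also have "\<dots> = \<nu> ^ k * (\<nu> * M)" by simp
    also have "\<dots> \<le> \<nu> ^ k * (\<bar>a E k\<bar> / 2)"
      using \<nu> M by (intro mult_left_mono) (auto simp: field_simps)
    finally have "\<bar>top\<bar> \<ge> \<bar>a E k * \<nu> ^ k\<bar> - \<nu> ^ k * (\<bar>a E k\<bar> / 2)"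
      using top_eq by linarith
    then have "\<bar>top\<bar> \<ge> \<nu> ^ k * (\<bar>a E k\<bar> / 2)"
      using \<nu> by (simp add: abs_mult)
    then have "t * (\<nu> ^ k * (\<bar>a E k\<bar> / 2)) \<le> t * \<bar>top\<bar>"
      using t by (intro mult_left_mono) auto
    then have "t * \<nu> ^ k \<le> 2 * M / \<bar>a E k\<bar>"
      using top_le k by (simp add: field_simps)
    \<comment> \<open>Raising the exponent from \<open>k\<close> to \<open>k + 1\<close> makes it positive.\<close>
    moreover have "t * \<nu> ^ Suc k \<le> t * \<nu> ^ k"
      using t \<nu> \<nu>1 by (intro mult_left_mono power_decreasing) auto
    ultimately show ?thesis by linarith
  qed
  then show ?thesis
    using that[of "2 * M / \<bar>a E k\<bar>" "\<bar>a E k\<bar> / (2 * M)" "Suc k"] M k by auto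
qed

lemma axis_zero: "axis i 0 = 0"
  by (simp add: vec_eq_iff axis_def)

lemma has_real_derivative_monom_axis:
  fixes x :: "real ^ 'n::finite"
  shows "((\<lambda>s. monom_eval (x + axis i s) m) has_real_derivative
    real (m $ i) * monom_eval x (m - axis i 1)) (at 0)"
proof -
  have split: "monom_eval y m = (y $ i) ^ (m $ i) * (\<Prod>j\<in>UNIV - {i}. (y $ j) ^ (m $ j))" for y :: "real ^ 'n" and m
    unfolding monom_eval_def by (rule prod.remove) auto
  have "(\<lambda>s. monom_eval (x + axis i s) m)
      = (\<lambda>s. (x $ i + s) ^ (m $ i) * (\<Prod>j\<in>UNIV - {i}. (x $ j) ^ (m $ j)))"
    by (simp add: split axis_def fun_eq_iff)
  moreover have "real (m $ i) * monom_eval x (m - axis i 1)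
      = real (m $ i) * ((x $ i) ^ (m $ i - 1) * (\<Prod>j\<in>UNIV - {i}. (x $ j) ^ (m $ j)))"
    by (simp add: split axis_def)
  ultimately show ?thesis
    by (auto intro!: derivative_eq_intros)
qed

lemma local_max_critical:
  fixes e :: "'k \<Rightarrow> nat ^ 'n::finite" and x :: "real ^ 'n"
  assumes "d > 0" and max: "\<And>y. dist y x < d \<Longrightarrow>
    penalty L y - t * polyfun K c e y \<le> penalty L x - t * polyfun K c e x"
  shows "critical L K c e t x"
  unfolding critical_def
proof
  fix i
  let ?h = "\<lambda>s. penalty L (x + axis i s) - t * polyfun K c e (x + axis i s)"
  let ?D = "(\<Sum>j\<in>UNIV. real (axis j 2 $ i) * monom_eval x (axis j 2 - axis i 1))
    - (\<Sum>j\<in>UNIV. real (axis j (Suc L) $ i) * monom_eval x (axis j (Suc L) - axis i 1))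
    - t * (\<Sum>k\<in>K. c k * (real (e k $ i) * monom_eval x (e k - axis i 1)))"
  have "(?h has_real_derivative ?D) (at 0)"
    unfolding penalty_def polyfun_def
    by (intro DERIV_cmult DERIV_diff DERIV_sum has_real_derivative_monom_axis)
  moreover have "?h s \<le> ?h 0" if "\<bar>0 - s\<bar> < d" for s
    using max[of "x + axis i s"] that by (simp add: dist_norm norm_eq_sqrt_inner inner_axis_axis axis_zero)
  ultimately have "?D = 0"
    using DERIV_local_max[of ?h ?D 0 d] assms(1) by auto
  moreover have "(\<Sum>j\<in>UNIV. real (axis j (Suc l) $ i) * monom_eval x (axis j (Suc l) - axis i 1))
      = real (Suc l) * (x $ i) ^ l" for l
  proof -
    have "(\<Sum>j\<in>UNIV. real (axis j (Suc l) $ i) * monom_eval x (axis j (Suc l) - axis i 1))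
      = (\<Sum>j\<in>{i}. real (axis j (Suc l) $ i) * monom_eval x (axis j (Suc l) - axis i 1))"
      by (rule sum.mono_neutral_right) (auto simp: axis_def)
    also have "axis i (Suc l) - axis i 1 = axis i l" by (auto simp: vec_eq_iff axis_def)
    then have "(\<Sum>j\<in>{i}. real (axis j (Suc l) $ i) * monom_eval x (axis j (Suc l) - axis i 1))
      = real (Suc l) * (x $ i) ^ l" by (simp add: monom_eval_axis)
    finally show ?thesis .
  qed
  from this[of 1] this[of L] have
    "(\<Sum>j\<in>UNIV. real (axis j 2 $ i) * monom_eval x (axis j 2 - axis i 1)) = 2 * x $ i"
    "(\<Sum>j\<in>UNIV. real (axis j (Suc L) $ i) * monom_eval x (axis j (Suc L) - axis i 1))
      = real (Suc L) * (x $ i) ^ L"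
    by (simp_all add: numeral_2_eq_2)
  ultimately show "real (Suc L) * (x $ i) ^ L =
    2 * x $ i - t * (\<Sum>k\<in>K. c k * (real (e k $ i) * monom_eval x (e k - axis i 1)))"
    by linarith
qed

lemma continuous_on_monom_eval: "continuous_on S (\<lambda>x :: real ^ 'n::finite. monom_eval x m)"
  unfolding monom_eval_def by (intro continuous_intros)

lemma continuous_on_polyfun: "continuous_on S (polyfun K c e)"
  unfolding polyfun_def by (intro continuous_intros continuous_on_monom_eval)

lemma continuous_on_penalty: "continuous_on S (penalty L)"
  unfolding penalty_def by (intro continuous_intros continuous_on_monom_eval)

lemma penalty_bounds:
  fixes x :: "real ^ 'n::finite"
  assumes L: "2 \<le> L" and x: "norm x \<le> 1 / 2"
  shows "norm x ^ 2 / 2 \<le> penalty L x" "penalty L x \<le> 2 * norm x ^ 2"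
proof -
  have sq: "norm x ^ 2 = (\<Sum>i\<in>UNIV. (x $ i) ^ 2)"
    by (simp add: norm_vec_def L2_set_def sum_nonneg)
  have "\<bar>\<Sum>i\<in>UNIV. (x $ i) ^ Suc L\<bar> \<le> (\<Sum>i\<in>UNIV. (x $ i) ^ 2 / 2)"
  proof (rule order_trans[OF sum_abs], rule sum_mono)
    fix i
    have xi: "\<bar>x $ i\<bar> \<le> 1 / 2"
      using x component_le_norm_cart[of x i] by linarith
    have "\<bar>x $ i\<bar> ^ Suc L \<le> \<bar>x $ i\<bar> ^ 3"
      using L xi by (intro power_decreasing) auto
    also have "\<dots> = \<bar>x $ i\<bar> ^ 2 * \<bar>x $ i\<bar>" by (simp add: power3_eq_cube power2_eq_square)
    also have "\<dots> \<le> \<bar>x $ i\<bar> ^ 2 * (1 / 2)" using xi by (intro mult_left_mono) auto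
    finally show "\<bar>(x $ i) ^ Suc L\<bar> \<le> (x $ i) ^ 2 / 2"
      by (simp only: power_abs) simp
  qed
  also have "\<dots> = norm x ^ 2 / 2" by (simp add: sq sum_divide_distrib)
  finally have "\<bar>\<Sum>i\<in>UNIV. (x $ i) ^ Suc L\<bar> \<le> norm x ^ 2 / 2" .
  moreover have "penalty L x = norm x ^ 2 - (\<Sum>i\<in>UNIV. (x $ i) ^ Suc L)"
    by (simp add: penalty_def monom_eval_axis sq)
  ultimately show "norm x ^ 2 / 2 \<le> penalty L x" "penalty L x \<le> 2 * norm x ^ 2"
    by linarith+
qed

text \<open>
  Let \<open>\<nu>(t)\<close> be the maximum of \<open>\<rho> - t F\<close> over a small ball, where \<open>\<rho>\<close> is comparable to
  \<open>\<parallel>x\<parallel>\<^sup>2\<close>. It gives the lower bounds \<open>F \<ge> (\<rho> - \<nu>(t)) / t\<close>, so what is needed is a rate at which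
  \<open>\<nu>(t)\<close> tends to \<open>0\<close>. As \<open>t\<close> grows, the maximum is attained close to the isolated zero, thus in
  the interior of the ball and with small value. So \<open>\<nu>(t)\<close> is a critical value, hence algebraic in \<open>t\<close>, and a
  small algebraic function decays like a negative power of \<open>t\<close>. Choosing \<open>t\<close> so that \<open>\<nu>(t) \<le> \<parallel>y\<parallel>\<^sup>2 / 4\<close>
  gives the bound at \<open>y\<close>.
\<close>

theorem polynomial_isolated_zero_lower_bound:
  fixes c :: "'k \<Rightarrow> real" and e :: "'k \<Rightarrow> nat ^ 'n::finite"
  assumes K: "finite K" and F0: "polyfun K c e 0 = 0"
    and pos: "\<forall>\<^sub>F x in nhds 0. x \<noteq> 0 \<longrightarrow> polyfun K c e x > 0"
  obtains C N where "C > 0" "\<forall>\<^sub>F x in nhds 0. C * norm x ^ N \<le> polyfun K c e x"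
proof -
  let ?F = "polyfun K c e"
  obtain d where d: "d > 0" "\<And>x. norm x < d \<Longrightarrow> x \<noteq> 0 \<Longrightarrow> ?F x > 0"
    using pos by (auto simp: eventually_nhds_metric)
  define r where "r = min (1 / 2) (d / 2)"
  have r: "r > 0" "r \<le> 1 / 2" using d by (auto simp: r_def)
  have Fpos: "?F x > 0" if "norm x \<le> r" "x \<noteq> 0" for x
    using d that by (auto simp: r_def)
  define L where "L = Max (insert 2 ((\<lambda>k. mdeg (e k)) ` K))"
  have L: "2 \<le> L" and e: "\<And>k. k \<in> K \<Longrightarrow> mdeg (e k) \<le> L"
    unfolding L_def using K by (auto intro!: Max_ge)
  let ?G = "\<lambda>t x. penalty L x - t * ?F x"
  have G0: "?G t 0 = 0" for t
    using penalty_bounds[OF L, of 0] F0 by (auto simp: penalty_def monom_eval_axis)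
  obtain I J :: nat and a where a: "\<exists>i\<le>I. \<exists>j\<le>J. a i j \<noteq> (0::real)"
    and alg: "\<And>t x. critical L K c e t x \<Longrightarrow> (\<Sum>i\<le>I. \<Sum>j\<le>J. a i j * t ^ i * ?G t x ^ j) = 0"
    by (rule critical_value_algebraic[where K = K and c = c, OF e L], assumption, rule that)
  obtain C \<eta> :: real and k :: nat where C: "C > 0" and \<eta>: "\<eta> > 0" and k: "k \<ge> 1"
    and decay: "\<And>t \<nu>. t \<ge> 1 \<Longrightarrow> 0 \<le> \<nu> \<Longrightarrow> \<nu> \<le> \<eta> \<Longrightarrow>
      (\<Sum>i\<le>I. \<Sum>j\<le>J. a i j * t ^ i * \<nu> ^ j) = 0 \<Longrightarrow> t * \<nu> ^ k \<le> C"
    by (rule small_root_decay[OF a], rule that)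
  define \<epsilon> where "\<epsilon> = min (r / 2) (\<eta> / 2)"
  have \<epsilon>: "\<epsilon> > 0" "\<epsilon> < r" "\<epsilon> \<le> 1" "2 * \<epsilon> \<le> \<eta>" using r \<eta> by (auto simp: \<epsilon>_def)
  obtain \<mu> where \<mu>: "\<mu> > 0" "\<And>x. \<epsilon> \<le> norm x \<Longrightarrow> norm x \<le> r \<Longrightarrow> \<mu> \<le> ?F x"
  proof (cases "cball 0 r - ball (0 :: real ^ 'n) \<epsilon> = {}")
    case True
    have False if "\<epsilon> \<le> norm x" "norm x \<le> r" for x :: "real ^ 'n"
      using True that by (auto simp: not_less[symmetric])
    then show ?thesis using that[of 1] by auto
  next
    case False
    have "compact (cball 0 r - ball (0 :: real ^ 'n) \<epsilon>)"
      by (simp add: compact_diff)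
    from continuous_attains_inf[OF this False continuous_on_polyfun[of _ K c e]]
    obtain y where y: "y \<in> cball 0 r - ball 0 \<epsilon>"
      "\<forall>x\<in>cball 0 r - ball 0 \<epsilon>. ?F y \<le> ?F x"
      by blast
    then have "?F y > 0" using \<epsilon> by (intro Fpos) auto
    then show ?thesis using that[of "?F y"] y(2) by auto
  qed
  define t0 where "t0 = max 1 (1 / \<mu>)"
  have t0: "t0 \<ge> 1" "t0 * \<mu> \<ge> 1" using \<mu> by (auto simp: t0_def max_def field_simps)
  have legendre: "\<exists>\<nu>\<ge>0. t * \<nu> ^ k \<le> C \<and> (\<forall>y. norm y \<le> r \<longrightarrow> ?G t y \<le> \<nu>)" if t: "t \<ge> t0" for t
  proof -
    have "continuous_on (cball 0 r) (?G t)"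
      by (intro continuous_intros continuous_on_polyfun continuous_on_penalty)
    moreover have "cball (0 :: real ^ 'n) r \<noteq> {}" using r by simp
    ultimately obtain x where x: "x \<in> cball 0 r" and "\<forall>y\<in>cball 0 r. ?G t y \<le> ?G t x"
      using continuous_attains_sup[OF compact_cball, of 0 r "?G t"] by blast
    then have max: "?G t y \<le> ?G t x" if "norm y \<le> r" for y using that by simp
    have x0: "0 \<le> ?G t x" using max[of 0] G0[of t] r by simp
    have "norm x < \<epsilon>"
    proof (rule ccontr)
      assume "\<not> norm x < \<epsilon>"
      then have "\<mu> \<le> ?F x" using \<mu>(2) x by auto
      then have "t0 * \<mu> \<le> t * ?F x" using t t0(1) \<mu>(1) by (intro mult_mono) auto
      moreover have "penalty L x \<le> 2 * norm x ^ 2"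
        using x r by (intro penalty_bounds L) auto
      moreover have "norm x ^ 2 \<le> (1 / 2) ^ 2"
        using x r by (intro power_mono) auto
      ultimately show False using x0 t0(2) by (simp add: power2_eq_square)
    qed
    have "critical L K c e t x"
    proof (rule local_max_critical)
      show "r - \<epsilon> > 0" using \<epsilon> by simp
      show "?G t y \<le> ?G t x" if "dist y x < r - \<epsilon>" for y
      proof (rule max)
        have "norm y \<le> norm (y - x) + norm x" using norm_triangle_ineq[of "y - x" x] by simp
        then show "norm y \<le> r" using that \<open>norm x < \<epsilon>\<close> by (simp add: dist_norm)
      qed
    qed
    then have "(\<Sum>i\<le>I. \<Sum>j\<le>J. a i j * t ^ i * ?G t x ^ j) = 0" by (rule alg)
    moreover have "?G t x \<le> \<eta>"
    proof -
      have "0 \<le> ?F x" using Fpos[of x] x F0 by (cases "x = 0") auto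
      then have "?G t x \<le> penalty L x" using t t0 by simp
      also have "\<dots> \<le> 2 * norm x ^ 2"
        using x r by (intro penalty_bounds L) auto
      also have "\<dots> \<le> 2 * norm x"
        using \<open>norm x < \<epsilon>\<close> \<epsilon> by (simp add: power2_eq_square mult_left_le)
      finally show ?thesis using \<open>norm x < \<epsilon>\<close> \<epsilon> by linarith
    qed
    ultimately have "t * ?G t x ^ k \<le> C"
      using t t0 x0 by (intro decay) auto
    then show ?thesis using max x0 by (intro exI[of _ "?G t x"]) blast
  qed
  have bound: "(norm y ^ 2 / 4) ^ Suc k / C \<le> ?F y" if y: "norm y < min r (C / t0)" for y
  proof (cases "y = 0")
    case False
    define q where "q = norm y ^ 2 / 4"
    have q: "q > 0" using False by (simp add: q_def)
    define t where "t = C / q ^ k"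
    have "norm y < 1 / 2" using y r by simp
    have "norm y ^ 2 \<le> norm y" using \<open>norm y < 1 / 2\<close> by (simp add: power2_eq_square mult_left_le)
    then have "q \<le> norm y" unfolding q_def using norm_ge_zero[of y] by linarith
    then have "q \<le> 1" "q < C / t0" using \<open>norm y < 1 / 2\<close> y by auto
    have "q ^ k \<le> q" using q \<open>q \<le> 1\<close> k by (metis less_imp_le power_decreasing power_one_right)
    then have "q ^ k \<le> C / t0" using \<open>q < C / t0\<close> by simp
    then have "t0 \<le> t" using q t0 C by (simp add: t_def field_simps)
    then obtain \<nu> where \<nu>: "\<nu> \<ge> 0" "t * \<nu> ^ k \<le> C" "\<And>y. norm y \<le> r \<Longrightarrow> ?G t y \<le> \<nu>"
      using legendre by blast
    have "\<nu> ^ k \<le> q ^ k" using \<nu>(2) C q by (simp add: t_def field_simps)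
    then have "\<nu> \<le> q" using k \<nu>(1) q by (metis less_imp_le order.strict_trans2 power_mono_iff zero_less_one)
    have "norm y ^ 2 / 2 \<le> penalty L y" using y r by (intro penalty_bounds L) auto
    then have "q \<le> t * ?F y" using \<nu>(3)[of y] y \<open>\<nu> \<le> q\<close> by (simp add: q_def)
    then show ?thesis using q C unfolding q_def[symmetric] by (simp add: t_def field_simps)
  qed (simp add: F0)
  have "1 / (4 ^ Suc k * C) * norm y ^ (2 * Suc k) \<le> ?F y" if "norm y < min r (C / t0)" for y
    using bound[OF that] unfolding power_divide power_mult by (simp del: power_Suc add: mult.commute)
  moreover have "min r (C / t0) > 0" using r C t0 by simp
  ultimately have "\<forall>\<^sub>F y in nhds 0. 1 / (4 ^ Suc k * C) * norm y ^ (2 * Suc k) \<le> ?F y"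
    unfolding eventually_nhds_metric by (auto intro!: exI[of _ "min r (C / t0)"])
  then show ?thesis by (rule that[rotated]) (use C in simp)
qed


section \<open>Weierstrass division in order one\<close>

text \<open>
  The grading in which \<open>z\<close> has weight one and every \<open>x\<^sub>j\<close> has weight two. A series whose constant term
  vanishes has no monomial of weight below two except possibly \<open>z\<close>.
\<close>

definition weight :: "nat ^ 'd::finite option \<Rightarrow> nat"
  where "weight m = mdeg m + (\<Sum>j\<in>UNIV. m $ Some j)"

lemma mdeg_option: "mdeg (m :: nat ^ 'd::finite option) = m $ None + (\<Sum>j\<in>UNIV. m $ Some j)"
  by (simp add: mdeg_def UNIV_option_conv sum.reindex)

lemma weight_add: "weight (a + b) = weight a + weight b"
  by (simp add: weight_def mdeg_add sum.distrib)

lemma weight_axis_None [simp]: "weight (axis None k) = k"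
  by (simp add: weight_def axis_def mdeg_option)

lemma weight_le: "weight m \<le> 2 * mdeg m"
  by (simp add: weight_def mdeg_option)

lemma weight_ge_2:
  assumes "v \<noteq> 0" "v \<noteq> axis None 1"
  shows "2 \<le> weight v"
proof (rule ccontr)
  assume "\<not> 2 \<le> weight v"
  then have "(\<Sum>j\<in>UNIV. v $ Some j) = 0" "mdeg v \<le> 1"
    unfolding weight_def mdeg_option by linarith+
  then have "mdeg v = 1" using assms(1) mdeg_eq_0_iff[of v] by linarith
  then obtain i where i: "v = axis i 1" using mdeg_eq_1_iff by blast
  with assms(2) obtain j where "i = Some j" by (cases i) auto
  then have "v $ Some j = 1" using i by simp
  moreover have "v $ Some j \<le> (\<Sum>j\<in>UNIV. v $ Some j)" by (rule member_le_sum) auto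
  ultimately show False using \<open>(\<Sum>j\<in>UNIV. v $ Some j) = 0\<close> by simp
qed

text \<open>
  The pairs of exponents, other than the one with factor \<open>z\<close> in second place, that contribute to
  the coefficient of \<open>x\<^sup>m z\<close> in a product whose second factor has no constant term.
\<close>

definition lower_splits :: "nat ^ 'd::finite option \<Rightarrow> ((nat ^ 'd option) \<times> (nat ^ 'd option)) set"
  where "lower_splits m = {(u, v). u + v = m + axis None 1 \<and> v \<noteq> 0 \<and> v \<noteq> axis None 1}"

lemma finite_lower_splits: "finite (lower_splits m)"
  by (rule finite_subset[OF _ finite_antidiag[of "m + axis None 1"]]) (auto simp: lower_splits_def)

lemma weight_lower_splits:
  assumes "p \<in> lower_splits m"
  shows "weight (fst p) < weight m"
proof -
  have "fst p + snd p = m + axis None 1" "snd p \<noteq> 0" "snd p \<noteq> axis None 1"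
    using assms by (auto simp: lower_splits_def)
  then have "weight (fst p) + weight (snd p) = weight m + 1" "2 \<le> weight (snd p)"
    by (metis weight_add weight_axis_None, intro weight_ge_2)
  then show ?thesis by linarith
qed

text \<open>
  Comparing the coefficients of the monomials divisible by \<open>z\<close> in \<open>q = a f + r(x)\<close> determines \<open>a\<close>. The
  degree need not decrease in this recursion, because \<open>f\<close> may contain linear terms in \<open>x\<close>, but the weight does.
\<close>

function quotient_coeff ::
    "(nat ^ 'd::finite option \<Rightarrow> complex) \<Rightarrow> (nat ^ 'd option \<Rightarrow> complex) \<Rightarrow> nat ^ 'd option \<Rightarrow> complex"
  where "quotient_coeff q f m = (q (m + axis None 1) -
    (\<Sum>p\<in>lower_splits m. quotient_coeff q f (fst p) * f (snd p))) / f (axis None 1)"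
  by auto
termination
  by (relation "Wellfounded.measure (\<lambda>(q, f, m). weight m)") (auto simp: weight_lower_splits)

declare quotient_coeff.simps [simp del]

text \<open>
  The radii are \<open>\<tau>R\<close> for \<open>z\<close> and \<open>\<tau>\<^sup>2R\<close> for \<open>x\<close>. Apart from its term in \<open>z\<close>, the divisor is of order
  \<open>\<tau>\<^sup>2\<close> on this polydisc, while its term in \<open>z\<close> is of order \<open>\<tau>\<close>. For small \<open>\<tau>\<close> the recursion
  therefore contributes at most half of the claimed bound.
\<close>

lemma quotient_coeff_bound:
  fixes q f :: "nat ^ 'd::finite option \<Rightarrow> complex"
  assumes f1: "f (axis None 1) \<noteq> 0" and R: "R > 0" and \<tau>: "0 < \<tau>" "\<tau> \<le> 1"
    and S: "\<And>F. finite F \<Longrightarrow> (\<Sum>m\<in>F. norm (f m) * R ^ mdeg m) \<le> S"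
    and \<tau>S: "2 * \<tau> * S \<le> norm (f (axis None 1)) * R"
    and Q: "\<And>m. norm (q m) * R ^ mdeg m \<le> Q"
  shows "norm (quotient_coeff q f m) * (R ^ mdeg m * \<tau> ^ weight m) \<le> 2 * Q / (norm (f (axis None 1)) * \<tau> * R)"
proof (induction "weight m" arbitrary: m rule: less_induct)
  case less
  define c where "c = norm (f (axis None 1))"
  have c: "c > 0" using f1 by (simp add: c_def)
  define K where "K = 2 * Q / (c * \<tau> * R)"
  have "0 \<le> norm (q 0) * R ^ mdeg (0 :: nat ^ 'd option)" by simp
  also have "\<dots> \<le> Q" by (rule Q)
  finally have "0 \<le> Q" .
  then have K: "K \<ge> 0" using c \<tau> R by (simp add: K_def)
  let ?W = "\<lambda>m :: nat ^ 'd option. R ^ mdeg m * \<tau> ^ weight m"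
  let ?a = "quotient_coeff q f"
  have W0: "?W m > 0" for m using R \<tau> by simp
  have Wadd: "?W (a + b) = ?W a * ?W b" for a b by (simp add: mdeg_add weight_add power_add)
  have We: "?W (axis None 1) = R * \<tau>" by simp
  have "norm (\<Sum>p\<in>lower_splits m. ?a (fst p) * f (snd p)) * ?W (m + axis None 1)
      \<le> (\<Sum>p\<in>lower_splits m. norm (?a (fst p) * f (snd p)) * ?W (m + axis None 1))"
    unfolding sum_distrib_right[symmetric] using W0[of "m + axis None 1"]
    by (intro mult_right_mono norm_sum) auto
  also have "\<dots> \<le> (\<Sum>p\<in>lower_splits m. K * \<tau> ^ 2 * (norm (f (snd p)) * R ^ mdeg (snd p)))"
  proof (rule sum_mono)
    fix p assume p: "p \<in> lower_splits m"
    then have m: "m + axis None 1 = fst p + snd p" and v: "snd p \<noteq> 0" "snd p \<noteq> axis None 1"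
      by (auto simp: lower_splits_def)
    have IH: "norm (?a (fst p)) * ?W (fst p) \<le> K"
      unfolding K_def c_def by (rule less) (rule weight_lower_splits[OF p])
    have \<tau>p: "\<tau> ^ weight (snd p) \<le> \<tau> ^ 2"
      using \<tau> weight_ge_2[OF v] by (intro power_decreasing) auto
    have "norm (?a (fst p) * f (snd p)) * ?W (m + axis None 1)
        = (norm (?a (fst p)) * ?W (fst p)) * (norm (f (snd p)) * R ^ mdeg (snd p) * \<tau> ^ weight (snd p))"
      unfolding m Wadd norm_mult by (simp only: mult_ac)
    also have "\<dots> \<le> K * (norm (f (snd p)) * R ^ mdeg (snd p) * \<tau> ^ 2)"
      using IH \<tau>p K R \<tau> by (intro mult_mono mult_nonneg_nonneg) auto
    finally show "norm (?a (fst p) * f (snd p)) * ?W (m + axis None 1)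
        \<le> K * \<tau> ^ 2 * (norm (f (snd p)) * R ^ mdeg (snd p))"
      by (simp only: mult_ac)
  qed
  also have "\<dots> = K * \<tau> ^ 2 * (\<Sum>p\<in>lower_splits m. norm (f (snd p)) * R ^ mdeg (snd p))"
    by (rule sum_distrib_left[symmetric])
  also have "\<dots> = K * \<tau> ^ 2 * (\<Sum>v\<in>snd ` lower_splits m. norm (f v) * R ^ mdeg v)"
    by (subst sum.reindex) (auto simp: inj_on_def lower_splits_def, metis add_right_cancel)
  also have "\<dots> \<le> K * \<tau> ^ 2 * S"
    using K by (intro mult_left_mono S finite_imageI finite_lower_splits) auto
  also have "\<dots> = K * \<tau> * (2 * \<tau> * S) / 2" by (simp add: power2_eq_square)
  also have "\<dots> \<le> K * \<tau> * (c * R) / 2"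
    using \<tau>S K \<tau> unfolding c_def[symmetric] by (intro divide_right_mono mult_left_mono) auto
  also have "\<dots> = Q" using c \<tau> R by (simp add: K_def field_simps)
  finally have sum: "norm (\<Sum>p\<in>lower_splits m. ?a (fst p) * f (snd p)) * ?W (m + axis None 1) \<le> Q" .
  have qm: "norm (q (m + axis None 1)) * ?W (m + axis None 1) \<le> Q"
  proof -
    have "norm (q (m + axis None 1)) * R ^ mdeg (m + axis None 1) * \<tau> ^ weight (m + axis None 1)
        \<le> norm (q (m + axis None 1)) * R ^ mdeg (m + axis None 1) * 1"
      using \<tau> R by (intro mult_left_mono power_le_one) auto
    then show ?thesis using Q[of "m + axis None 1"] by (simp only: mult.assoc mult_1_right)
  qed
  have "norm (?a m) * c = norm (q (m + axis None 1) - (\<Sum>p\<in>lower_splits m. ?a (fst p) * f (snd p)))"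
    using c unfolding c_def by (subst quotient_coeff.simps) (simp add: norm_divide)
  also have "\<dots> \<le> norm (q (m + axis None 1)) + norm (\<Sum>p\<in>lower_splits m. ?a (fst p) * f (snd p))"
    by (rule norm_triangle_ineq4)
  finally have "norm (?a m) * c * ?W (m + axis None 1)
      \<le> (norm (q (m + axis None 1)) + norm (\<Sum>p\<in>lower_splits m. ?a (fst p) * f (snd p))) * ?W (m + axis None 1)"
    using W0[of "m + axis None 1"] by (intro mult_right_mono) auto
  also have "\<dots> \<le> 2 * Q" using sum qm by (simp only: distrib_right)
  finally have "(norm (?a m) * ?W m) * (c * \<tau> * R) \<le> 2 * Q"
    unfolding Wadd We by (simp only: mult_ac)
  then show ?case using c \<tau> R unfolding c_def[symmetric] by (subst pos_le_divide_eq) auto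
qed

lemma conv_near_0_quotient_coeff:
  fixes q f :: "nat ^ 'd::finite option \<Rightarrow> complex"
  assumes f1: "f (axis None 1) \<noteq> 0" and f: "conv_near_0 f" and q: "conv_near_0 q"
  shows "conv_near_0 (quotient_coeff q f)"
proof -
  obtain R1 where R1: "R1 > 0" "(\<lambda>m. norm (f m) * R1 ^ mdeg m) summable_on UNIV"
    using conv_near_0_summable_radius[OF f] by blast
  obtain R2 where R2: "R2 > 0" "(\<lambda>m. norm (q m) * R2 ^ mdeg m) summable_on UNIV"
    using conv_near_0_summable_radius[OF q] by blast
  define R where "R = min R1 R2"
  have R: "R > 0" "R \<le> R1" "R \<le> R2" using R1 R2 by (auto simp: R_def)
  define S where "S = (\<Sum>\<^sub>\<infinity>m. norm (f m) * R1 ^ mdeg m)"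
  define Q where "Q = (\<Sum>\<^sub>\<infinity>m. norm (q m) * R2 ^ mdeg m)"
  have S: "(\<Sum>m\<in>F. norm (f m) * R ^ mdeg m) \<le> S" if "finite F" for F
  proof -
    have "(\<Sum>m\<in>F. norm (f m) * R ^ mdeg m) \<le> (\<Sum>m\<in>F. norm (f m) * R1 ^ mdeg m)"
      using R by (intro sum_mono mult_left_mono power_mono) auto
    also have "\<dots> \<le> S"
      unfolding S_def using R1 that by (intro finite_sum_le_infsum) auto
    finally show ?thesis .
  qed
  have Q: "norm (q m) * R ^ mdeg m \<le> Q" for m
  proof -
    have "norm (q m) * R ^ mdeg m \<le> (\<Sum>m\<in>{m}. norm (q m) * R2 ^ mdeg m)"
      using R by (auto intro!: mult_left_mono power_mono)
    also have "\<dots> \<le> Q"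
      unfolding Q_def using R2 by (intro finite_sum_le_infsum) auto
    finally show ?thesis .
  qed
  have S0: "S \<ge> 0" using S[of "{}"] by simp
  define \<tau> where "\<tau> = min 1 (norm (f (axis None 1)) * R / (2 * (S + 1)))"
  have \<tau>: "0 < \<tau>" "\<tau> \<le> 1" using f1 R S0 by (auto simp: \<tau>_def)
  have "\<tau> \<le> norm (f (axis None 1)) * R / (2 * (S + 1))" by (simp add: \<tau>_def)
  then have "\<tau> * (2 * (S + 1)) \<le> norm (f (axis None 1)) * R" using S0 by (simp add: pos_le_divide_eq)
  moreover have "2 * \<tau> * S \<le> \<tau> * (2 * (S + 1))" using \<tau> by simp
  ultimately have "2 * \<tau> * S \<le> norm (f (axis None 1)) * R" by linarith
  note bound = quotient_coeff_bound[OF f1 R(1) \<tau> S this Q]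
  show ?thesis
  proof (rule conv_near_0_if_geometric_bound)
    show "R * \<tau> ^ 2 > 0" using R \<tau> by simp
    fix m :: "nat ^ 'd option"
    have "\<tau> ^ (2 * mdeg m) \<le> \<tau> ^ weight m" using \<tau> weight_le by (intro power_decreasing) auto
    then have "norm (quotient_coeff q f m) * (R ^ mdeg m * \<tau> ^ (2 * mdeg m))
        \<le> norm (quotient_coeff q f m) * (R ^ mdeg m * \<tau> ^ weight m)"
      using R by (intro mult_left_mono) auto
    also note bound
    finally show "norm (quotient_coeff q f m) * (R * \<tau> ^ 2) ^ mdeg m \<le> 2 * Q / (norm (f (axis None 1)) * \<tau> * R)"
      by (simp only: power_mult_distrib power_mult)
  qed
qed

lemma conv_near_0_restrict:
  fixes c :: "nat ^ 'd::finite option \<Rightarrow> complex"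
  assumes "conv_near_0 c"
  shows "conv_near_0 (\<lambda>m. c (\<chi> i. case i of None \<Rightarrow> 0 | Some j \<Rightarrow> m $ j))"
proof -
  let ?e = "\<lambda>m :: nat ^ 'd. (\<chi> i. case i of None \<Rightarrow> 0 | Some j \<Rightarrow> m $ j) :: nat ^ 'd option"
  obtain R where R: "R > 0" "(\<lambda>m. norm (c m) * R ^ mdeg m) summable_on UNIV"
    using conv_near_0_summable_radius[OF assms] by blast
  show ?thesis
  proof (rule conv_near_0_if_geometric_bound[OF R(1)])
    fix m :: "nat ^ 'd"
    have "mdeg (?e m) = mdeg m" by (simp add: mdeg_option) (simp add: mdeg_def)
    then have "norm (c (?e m)) * R ^ mdeg m = (\<Sum>k\<in>{?e m}. norm (c k) * R ^ mdeg k)" by simp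
    also have "\<dots> \<le> (\<Sum>\<^sub>\<infinity>k. norm (c k) * R ^ mdeg k)"
      using R by (intro finite_sum_le_infsum) auto
    finally show "norm (c (?e m)) * R ^ mdeg m \<le> (\<Sum>\<^sub>\<infinity>k. norm (c k) * R ^ mdeg k)" .
  qed
qed

text \<open>
  With the quotient given by the recursion, no monomial of \<open>q - a f\<close> is divisible by \<open>z\<close>, so what is left is a
  series in \<open>x\<close>.
\<close>

theorem division_regular_order_one:
  fixes f q :: "'d::finite option conv_ps"
  assumes f0: "cps_coeff f 0 = 0" and f1: "cps_coeff f (axis None 1) \<noteq> 0"
  obtains a r where "q = a * f + cps_incl r"
proof -
  let ?f = "cps_coeff f" and ?q = "cps_coeff q"
  define a where "a = Abs_conv_ps (quotient_coeff ?q ?f)"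
  have a: "cps_coeff a = quotient_coeff ?q ?f"
    unfolding a_def by (intro cps_coeff_Abs conv_near_0_quotient_coeff f1 conv_near_0_cps_coeff)
  let ?e = "\<lambda>m :: nat ^ 'd. (\<chi> i. case i of None \<Rightarrow> 0 | Some j \<Rightarrow> m $ j) :: nat ^ 'd option"
  define r where "r = Abs_conv_ps (\<lambda>m. cps_coeff (q - a * f) (?e m))"
  have r: "cps_coeff r = (\<lambda>m. cps_coeff (q - a * f) (?e m))"
    unfolding r_def by (intro cps_coeff_Abs conv_near_0_restrict conv_near_0_cps_coeff)
  have eq: "cps_coeff (a * f) (m + axis None 1) = ?q (m + axis None 1)" for m
  proof -
    let ?S = "{(u, v). u + v = m + axis None 1}"
    have "cps_coeff (a * f) (m + axis None 1) = (\<Sum>p\<in>?S. cps_coeff a (fst p) * ?f (snd p))"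
      by (simp add: times_conv_ps.rep_eq case_prod_unfold)
    also have "\<dots> = (\<Sum>p\<in>insert (m, axis None 1) (lower_splits m). cps_coeff a (fst p) * ?f (snd p))"
      by (rule sum.mono_neutral_right) (auto simp: finite_antidiag lower_splits_def f0)
    also have "\<dots> = cps_coeff a m * ?f (axis None 1) + (\<Sum>p\<in>lower_splits m. cps_coeff a (fst p) * ?f (snd p))"
      by (subst sum.insert) (auto simp: finite_lower_splits, auto simp: lower_splits_def)
    also have "\<dots> = ?q (m + axis None 1)"
      using f1 unfolding a by (subst quotient_coeff.simps) simp
    finally show ?thesis .
  qed
  have "q = a * f + cps_incl r"
  proof (rule cps_coeff_inject[THEN iffD1], rule ext)
    fix m :: "nat ^ 'd option"
    show "cps_coeff q m = cps_coeff (a * f + cps_incl r) m"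
    proof (cases "m $ None = 0")
      case True
      then have "?e (\<chi> j. m $ Some j) = m" by (auto simp: vec_eq_iff split: option.splits)
      with True show ?thesis
        by (simp add: plus_conv_ps.rep_eq cps_incl.rep_eq r minus_conv_ps.rep_eq)
    next
      case False
      then have "m = (m - axis None 1) + axis None 1" by (auto simp: vec_eq_iff axis_def)
      then have "cps_coeff (a * f) m = ?q m" using eq[of "m - axis None 1"] by simp
      with False show ?thesis by (simp add: plus_conv_ps.rep_eq cps_incl.rep_eq)
    qed
  qed
  then show ?thesis by (rule that)
qed


section \<open>The zero set of p as a graph\<close>

definition with_z :: "'a ^ 'd \<Rightarrow> 'a \<Rightarrow> 'a ^ 'd option"
  where "with_z x z = (\<chi> i. case i of None \<Rightarrow> z | Some j \<Rightarrow> x $ j)"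

definition without_z :: "'a ^ 'd option \<Rightarrow> 'a ^ 'd"
  where "without_z w = (\<chi> j. w $ Some j)"

lemma with_z_None [simp]: "with_z x z $ None = z"
  and with_z_Some [simp]: "with_z x z $ Some j = x $ j"
  and without_z_nth [simp]: "without_z w $ j = w $ Some j"
  and without_z_with_z [simp]: "without_z (with_z x z) = x"
  by (simp_all add: with_z_def without_z_def vec_eq_iff)

lemma all_option: "(\<forall>i. P i) \<longleftrightarrow> P None \<and> (\<forall>j. P (Some j))"
  by (metis option.exhaust)

lemma cps_eval_incl_without_z: "cps_eval (cps_incl f) w = cps_eval f (without_z w)"
  by (simp add: cps_eval_incl without_z_def)

lemma cvec_nth [simp]: "cvec x $ i = of_real (x $ i)"
  by (simp add: cvec_def)

lemma eventually_without_z: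
  fixes P :: "'a::real_normed_vector ^ 'd::finite \<Rightarrow> bool"
  assumes "\<forall>\<^sub>F x in nhds 0. P x"
  shows "\<forall>\<^sub>F w in nhds 0. P (without_z w)"
  using assms unfolding eventually_nhds_0_polydisc by fastforce

lemma eventually_cvec:
  fixes P :: "complex ^ 'n::finite \<Rightarrow> bool"
  assumes "\<forall>\<^sub>F w in nhds 0. P w"
  shows "\<forall>\<^sub>F x in nhds 0. P (cvec x)"
  using assms unfolding eventually_nhds_0_polydisc by fastforce

lemma eventually_norm_less: "e > 0 \<Longrightarrow> \<forall>\<^sub>F x in nhds (0 :: 'a::real_normed_vector). norm x < e"
  by (auto simp: eventually_nhds_metric)

lemma norm_cvec [simp]: "norm (cvec x) = norm x"
  by (simp add: norm_vec_def)

lemma cvec_with_z: "cvec (with_z x z) = with_z (cvec x) (of_real z)"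
  by (simp add: vec_eq_iff all_option)

lemma cps_eval_at_0: "cps_eval f 0 = cps_coeff f 0" for f :: "'n::finite conv_ps"
proof -
  have "monom_eval (0 :: complex ^ 'n) m = 0" if "m \<noteq> 0" for m
    using that by (auto simp: monom_eval_def vec_eq_iff)
  then have "cps_eval f 0 = (\<Sum>\<^sub>\<infinity>m\<in>{0}. cps_coeff f m * monom_eval 0 m)"
    unfolding cps_eval_def by (intro infsum_cong_neutral) auto
  then show ?thesis by simp
qed

lemma cps_eval_lipschitz_near_0:
  fixes f :: "'n::finite conv_ps"
  obtains K \<delta> where "K > 0" "\<delta> > 0"
    "\<forall>w v. (\<forall>i. norm (w $ i) \<le> \<delta>) \<longrightarrow> (\<forall>i. norm (v $ i) \<le> \<delta>) \<longrightarrow>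
      norm (cps_eval f w - cps_eval f v) \<le> K * (\<Sum>i\<in>UNIV. norm (w $ i - v $ i))"
proof -
  obtain K \<delta> where K: "K > 0" "\<delta> > 0" and lip:
    "\<forall>w v s. 0 < s \<longrightarrow> s \<le> \<delta> \<longrightarrow> (\<forall>i. norm (w $ i) \<le> s) \<longrightarrow> (\<forall>i. norm (v $ i) \<le> s) \<longrightarrow>
      norm (cps_eval f w - cps_eval f v) \<le> K * s ^ 0 * (\<Sum>i\<in>UNIV. norm (w $ i - v $ i))"
    by (rule cps_eval_lipschitz[of 0 f]) auto
  show thesis
    by (rule that[OF K]) (use K(2) lip[rule_format, of \<delta>] in simp)
qed

lemma cps_eval_tendsto_0:
  fixes f :: "'n::finite conv_ps"
  shows "(cps_eval f \<longlongrightarrow> cps_coeff f 0) (nhds 0)"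
proof -
  obtain K \<delta> where K: "K > 0" "\<delta> > 0" and lip:
    "\<forall>w v. (\<forall>i. norm (w $ i) \<le> \<delta>) \<longrightarrow> (\<forall>i. norm (v $ i) \<le> \<delta>) \<longrightarrow>
      norm (cps_eval f w - cps_eval f v) \<le> K * (\<Sum>i\<in>UNIV. norm (w $ i - v $ i))"
    using cps_eval_lipschitz_near_0[of f] by blast
  have "\<forall>\<^sub>F w in nhds 0. norm (cps_eval f w - cps_coeff f 0) \<le> K * (\<Sum>i\<in>UNIV. norm (w $ i))"
    unfolding eventually_nhds_0_polydisc
    using K lip[rule_format, of _ 0] by (intro exI[of _ \<delta>]) (auto simp: cps_eval_at_0 less_imp_le)
  moreover have "((\<lambda>w :: complex ^ 'n. K * (\<Sum>i\<in>UNIV. norm (w $ i)))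
      \<longlongrightarrow> K * (\<Sum>i\<in>(UNIV :: 'n set). norm ((0 :: complex ^ 'n) $ i))) (nhds 0)"
    by (intro tendsto_intros filterlim_ident)
  then have "((\<lambda>w :: complex ^ 'n. K * (\<Sum>i\<in>UNIV. norm (w $ i))) \<longlongrightarrow> 0) (nhds 0)"
    by simp
  ultimately have "((\<lambda>w. cps_eval f w - cps_coeff f 0) \<longlongrightarrow> 0) (nhds 0)"
    by (rule Lim_null_comparison)
  then show ?thesis by (simp add: LIM_zero_iff)
qed

lemma z_coefficient_nonzero:
  fixes p :: "(complex, 'd::finite option) mpoly"
  assumes "deriv (\<lambda>t. mpoly_eval p (axis None t)) 0 \<noteq> 0"
  shows "Poly_Mapping.lookup p (axis None 1) \<noteq> 0"
proof
  assume 0: "Poly_Mapping.lookup p (axis None 1) = 0"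
  have D: "((\<lambda>t. monom_eval (axis None t :: complex ^ 'd option) m) has_field_derivative 0) (at 0)"
    if "m \<noteq> axis None 1" for m
  proof (cases "\<exists>j. m $ Some j \<noteq> 0")
    case True
    then obtain j where "m $ Some j \<noteq> 0" by blast
    then have "monom_eval (axis None t :: complex ^ 'd option) m = 0" for t
      unfolding monom_eval_def by (intro prod_zero bexI[of _ "Some j"]) (auto simp: axis_def)
    then show ?thesis by simp
  next
    case False
    then have m: "m = axis None (m $ None)"
      by (auto simp: vec_eq_iff axis_def all_option)
    then have m1: "m $ None \<noteq> 1" using that by metis
    have "(\<lambda>t. monom_eval (axis None t :: complex ^ 'd option) m) = (\<lambda>t. t ^ (m $ None))"
      by (subst m) (simp only: monom_eval_axis axis_nth)
    moreover have "((\<lambda>t :: complex. t ^ (m $ None)) has_field_derivative 0) (at 0)"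
      using m1 by (auto intro!: derivative_eq_intros)
    ultimately show ?thesis by simp
  qed
  have "((\<lambda>t. mpoly_eval p (axis None t)) has_field_derivative (\<Sum>m\<in>Poly_Mapping.keys p. Poly_Mapping.lookup p m * 0)) (at 0)"
    unfolding mpoly_eval_def by (intro DERIV_sum DERIV_cmult D) (use 0 in \<open>auto simp: in_keys_iff\<close>)
  then have "deriv (\<lambda>t. mpoly_eval p (axis None t)) 0 = 0"
    by (simp add: DERIV_imp_deriv)
  then show False using assms by simp
qed

lemma mpoly_eval_at_0: "mpoly_eval p 0 = Poly_Mapping.lookup p 0" for p :: "(complex, 'n::finite) mpoly"
  by (simp flip: cps_eval_of_mpoly add: cps_eval_at_0 cps_of_mpoly.rep_eq)

lemma cps_incl_uminus: "cps_incl (- r) = - cps_incl r"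
  by (rule cps_coeff_inject[THEN iffD1]) (auto simp: cps_incl.rep_eq uminus_conv_ps.rep_eq)

lemma cps_coeff_times_0: "cps_coeff (a * f) 0 = cps_coeff a 0 * cps_coeff f 0" for f :: "'n::finite conv_ps"
proof -
  have "{(a, b). a + b = (0 :: nat ^ 'n)} = {(0, 0)}" by (auto simp: vec_eq_iff)
  then show ?thesis by (simp add: times_conv_ps.rep_eq)
qed

lemma cps_coeff_times_axis:
  fixes f :: "'n::finite conv_ps"
  shows "cps_coeff (a * f) (axis i 1) =
    cps_coeff a 0 * cps_coeff f (axis i 1) + cps_coeff a (axis i 1) * cps_coeff f 0"
proof -
  have "{(a, b). a + b = (axis i 1 :: nat ^ 'n)} = {(0, axis i 1), (axis i 1, 0)}"
  proof (intro equalityI subsetI)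
    fix q :: "(nat ^ 'n) \<times> (nat ^ 'n)" assume "q \<in> {(a, b). a + b = axis i 1}"
    then have q: "fst q + snd q = axis i 1" by auto
    have "mdeg (fst q) + mdeg (snd q) = 1" using arg_cong[OF q, of mdeg] by (simp add: mdeg_add)
    then consider "mdeg (fst q) = 0" | "mdeg (snd q) = 0" by linarith
    then have "fst q = 0 \<or> snd q = 0" by cases (auto simp: mdeg_eq_0_iff)
    then show "q \<in> {(0, axis i 1), (axis i 1, 0)}" using q by (cases q) auto
  qed auto
  moreover have "(0, axis i 1) \<noteq> (axis i 1, 0 :: nat ^ 'n)"
    by (auto simp: axis_eq_0_iff)
  ultimately show ?thesis by (simp add: times_conv_ps.rep_eq)
qed

text \<open>
  Dividing \<open>z\<close> by \<open>p\<close> gives \<open>z + \<phi>(x) = a p\<close>. Comparing the coefficients of \<open>z\<close> shows that \<open>a\<close> does not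
  vanish at \<open>0\<close>. This replaces an implicit function theorem: \<open>-\<phi>\<close> parametrises the zeros of \<open>p\<close>.
\<close>

lemma implicit_function_comparison:
  fixes p :: "(complex, 'd::finite option) mpoly"
  assumes p0: "mpoly_eval p 0 = 0"
    and p1: "deriv (\<lambda>t. mpoly_eval p (axis None t)) 0 \<noteq> 0"
  obtains \<phi> :: "'d conv_ps" and C where "cps_coeff \<phi> 0 = 0" "C > 0"
    "\<forall>\<^sub>F w in nhds 0. norm (mpoly_eval p w) \<le> C * norm (w $ None + cps_eval \<phi> (without_z w))"
    "\<forall>\<^sub>F w in nhds 0. norm (w $ None + cps_eval \<phi> (without_z w)) \<le> C * norm (mpoly_eval p w)"
proof -
  let ?p = "cps_of_mpoly p"
  have c0: "cps_coeff ?p 0 = 0" and c1: "cps_coeff ?p (axis None 1) \<noteq> 0"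
    using p0 z_coefficient_nonzero[OF p1] by (simp_all add: cps_of_mpoly.rep_eq mpoly_eval_at_0)
  obtain a r where ar: "cps_z = a * ?p + cps_incl r"
    using division_regular_order_one[OF c0 c1, of cps_z] by blast
  define \<phi> where "\<phi> = - r"
  have eq: "cps_z + cps_incl \<phi> = a * ?p"
    by (simp add: ar \<phi>_def cps_incl_uminus)
  have "cps_coeff (cps_z + cps_incl \<phi>) 0 = 0"
    unfolding eq by (simp add: cps_coeff_times_0 c0)
  then have \<phi>0: "cps_coeff \<phi> 0 = 0"
    by (simp add: plus_conv_ps.rep_eq cps_coeff_z cps_incl.rep_eq axis_eq_0_iff zero_vec_def[symmetric])
  have "cps_coeff (cps_z + cps_incl \<phi>) (axis None 1) = cps_coeff a 0 * cps_coeff ?p (axis None 1)"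
    unfolding eq by (simp add: cps_coeff_times_axis c0 del: One_nat_def)
  then have a0: "cps_coeff a 0 \<noteq> 0"
    by (auto simp: plus_conv_ps.rep_eq cps_coeff_z cps_incl.rep_eq)
  define A where "A = norm (cps_coeff a 0)"
  have A: "A > 0" using a0 by (simp add: A_def)
  have "((\<lambda>w. norm (cps_eval a w)) \<longlongrightarrow> A) (nhds 0)"
    unfolding A_def by (intro tendsto_norm cps_eval_tendsto_0)
  from order_tendstoD(1)[OF this, of "A / 2"] order_tendstoD(2)[OF this, of "2 * A"]
  have ev_a: "\<forall>\<^sub>F w in nhds 0. norm (cps_eval a w) > A / 2" "\<forall>\<^sub>F w in nhds 0. norm (cps_eval a w) < 2 * A"
    using A by simp_all
  define C where "C = max (2 * A) (2 / A)"
  have ev: "\<forall>\<^sub>F w in nhds 0. w $ None + cps_eval \<phi> (without_z w) = cps_eval a w * mpoly_eval p w"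
    using eventually_cps_eval_plus[of cps_z "cps_incl \<phi>"] eventually_cps_eval_times[of a ?p]
    by eventually_elim (simp add: cps_eval_z cps_eval_incl_without_z cps_eval_of_mpoly flip: eq)
  have 1: "\<forall>\<^sub>F w in nhds 0. norm (mpoly_eval p w) \<le> C * norm (w $ None + cps_eval \<phi> (without_z w))"
    using ev ev_a(1)
  proof eventually_elim
    case (elim w)
    have "norm (mpoly_eval p w) = 2 / A * (A / 2 * norm (mpoly_eval p w))" using A by simp
    also have "\<dots> \<le> 2 / A * (norm (cps_eval a w) * norm (mpoly_eval p w))"
      using A elim(2) by (intro mult_left_mono mult_right_mono) auto
    also have "\<dots> \<le> C * (norm (cps_eval a w) * norm (mpoly_eval p w))"
      by (intro mult_right_mono) (auto simp: C_def)
    finally show ?case by (simp add: elim(1) norm_mult)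
  qed
  have 2: "\<forall>\<^sub>F w in nhds 0. norm (w $ None + cps_eval \<phi> (without_z w)) \<le> C * norm (mpoly_eval p w)"
    using ev ev_a(2)
  proof eventually_elim
    case (elim w)
    then have "norm (cps_eval a w) \<le> C" by (auto simp: C_def)
    then show ?case by (simp add: elim(1) norm_mult mult_right_mono)
  qed
  have "C > 0" using A by (auto simp: C_def)
  show ?thesis by (rule that[OF \<phi>0 \<open>C > 0\<close> 1 2])
qed


section \<open>The implicit function on the half-space\<close>

lemma cps_split_off_finite:
  fixes f :: "'n::finite conv_ps"
  assumes S: "finite S"
  obtains h where "cps_coeff h = (\<lambda>m. if m \<in> S then 0 else cps_coeff f m)"
    "\<And>w. (\<lambda>m. cps_coeff f m * monom_eval w m) summable_on UNIV \<Longrightarrow>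
      cps_eval f w = cps_eval h w + (\<Sum>m\<in>S. cps_coeff f m * monom_eval w m)"
proof -
  let ?h = "\<lambda>m. if m \<in> S then 0 else cps_coeff f m"
  have "conv_near_0 (\<lambda>m. cps_coeff f m + (if m \<in> S then - cps_coeff f m else 0))"
    by (intro conv_near_0_add conv_near_0_cps_coeff conv_near_0_finite)
      (auto intro: finite_subset[OF _ S])
  also have "(\<lambda>m. cps_coeff f m + (if m \<in> S then - cps_coeff f m else 0)) = ?h"
    by (auto simp: fun_eq_iff)
  finally have h: "cps_coeff (Abs_conv_ps ?h) = ?h" by (rule cps_coeff_Abs)
  show ?thesis
  proof (rule that[OF h])
    fix w assume sum: "(\<lambda>m. cps_coeff f m * monom_eval w m) summable_on UNIV"
    have "cps_eval f w = (\<Sum>\<^sub>\<infinity>m\<in>(UNIV - S) \<union> S. cps_coeff f m * monom_eval w m)"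
      by (simp add: cps_eval_def)
    also have "\<dots> = (\<Sum>\<^sub>\<infinity>m\<in>UNIV - S. cps_coeff f m * monom_eval w m) +
        (\<Sum>\<^sub>\<infinity>m\<in>S. cps_coeff f m * monom_eval w m)"
      by (rule infsum_Un_disjoint) (auto intro: summable_on_subset_banach[OF sum])
    also have "(\<Sum>\<^sub>\<infinity>m\<in>UNIV - S. cps_coeff f m * monom_eval w m) = cps_eval (Abs_conv_ps ?h) w"
      unfolding cps_eval_def h by (rule infsum_cong_neutral) auto
    finally show "cps_eval f w = cps_eval (Abs_conv_ps ?h) w + (\<Sum>m\<in>S. cps_coeff f m * monom_eval w m)"
      using S by simp
  qed
qed

lemma eventually_cps_summable:
  "\<forall>\<^sub>F w in nhds 0. (\<lambda>m. cps_coeff f m * monom_eval w m) summable_on UNIV"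
  using conv_near_0_cps_coeff[of f] by (simp add: conv_near_0_def)

lemma conv_near_0_subset:
  fixes c :: "nat ^ 'n::finite \<Rightarrow> complex"
  assumes "conv_near_0 c"
  shows "conv_near_0 (\<lambda>m. if m \<in> A then c m else 0)"
  using assms unfolding conv_near_0_def
proof eventually_elim
  case (elim w)
  have "(\<lambda>m. c m * monom_eval w m) summable_on A"
    by (rule summable_on_subset_banach[OF elim]) simp
  then show ?case
    by (rule summable_on_cong_neutral[THEN iffD1, rotated -1]) auto
qed

lemma monom_eval_axis_eq_0:
  assumes "\<nexists>k. m = axis j k"
  shows "monom_eval (axis j t :: complex ^ 'n::finite) m = 0"
proof -
  have "\<exists>i. i \<noteq> j \<and> m $ i \<noteq> 0"
  proof (rule ccontr)
    assume "\<nexists>i. i \<noteq> j \<and> m $ i \<noteq> 0"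
    then have "m = axis j (m $ j)" by (auto simp: vec_eq_iff axis_def)
    then show False using assms by blast
  qed
  then obtain i where "i \<noteq> j" "m $ i \<noteq> 0" by blast
  then show ?thesis
    unfolding monom_eval_def by (intro prod_zero bexI[of _ i]) (auto simp: axis_def)
qed

text \<open>
  Only the monomials in the \<open>j\<close>-th variable are seen on the \<open>j\<close>-th axis, so the bound for series of high order
  applies to the series of the terms \<open>x\<^sub>j\<^sup>l\<close> with \<open>l > k\<close>, regardless of the other terms of \<open>f\<close>.
\<close>

lemma cps_eval_axis_leading_term:
  fixes f :: "'n::finite conv_ps"
  assumes f: "\<And>l. l < k \<Longrightarrow> cps_coeff f (axis j l) = 0"
  obtains K \<delta> where "K > 0" "\<delta> > 0"
    "\<forall>t. norm t < \<delta> \<longrightarrow> norm (cps_eval f (axis j t) - cps_coeff f (axis j k) * t ^ k) \<le> K * norm t ^ Suc k"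
proof -
  let ?S = "{axis j k :: nat ^ 'n}"
  obtain h where h: "cps_coeff h = (\<lambda>m. if m \<in> ?S then 0 else cps_coeff f m)" and
    hf: "\<And>w. (\<lambda>m. cps_coeff f m * monom_eval w m) summable_on UNIV \<Longrightarrow>
      cps_eval f w = cps_eval h w + (\<Sum>m\<in>?S. cps_coeff f m * monom_eval w m)"
    by (rule cps_split_off_finite[of ?S f]) (simp, rule that)
  let ?A = "range (axis j :: nat \<Rightarrow> nat ^ 'n)"
  define g where "g = Abs_conv_ps (\<lambda>m. if m \<in> ?A then cps_coeff h m else 0)"
  have g: "cps_coeff g = (\<lambda>m. if m \<in> ?A then cps_coeff h m else 0)"
    unfolding g_def by (intro cps_coeff_Abs conv_near_0_subset conv_near_0_cps_coeff)
  have g0: "cps_coeff g m = 0" if "mdeg m < Suc k" for m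
    using that f by (auto simp: g h less_Suc_eq)
  obtain K \<delta> where K: "K > 0" "\<delta> > 0"
    "\<forall>w s. s \<le> \<delta> \<longrightarrow> (\<forall>i. norm (w $ i) \<le> s) \<longrightarrow> norm (cps_eval g w) \<le> K * s ^ Suc k"
    using cps_eval_power_bound[of "Suc k" g] g0 by blast
  have hg: "cps_eval h (axis j t) = cps_eval g (axis j t)" for t
    unfolding cps_eval_def
    by (rule infsum_cong) (auto simp: g intro: monom_eval_axis_eq_0)
  obtain \<delta>' where \<delta>': "\<delta>' > 0" "\<And>w. (\<forall>i. norm (w $ i) < \<delta>') \<Longrightarrow>
      (\<lambda>m. cps_coeff f m * monom_eval w m) summable_on UNIV"
    using eventually_cps_summable[of f] unfolding eventually_nhds_0_polydisc by blast
  show ?thesis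
  proof (rule that[of K "min \<delta> \<delta>'"]; (intro allI impI)?)
    fix t :: complex assume t: "norm t < min \<delta> \<delta>'"
    then have "(\<lambda>m. cps_coeff f m * monom_eval (axis j t) m) summable_on UNIV"
      using \<delta>' by (intro \<delta>'(2)) (auto simp: axis_def)
    from hf[OF this] have "cps_eval f (axis j t) = cps_eval g (axis j t) + cps_coeff f (axis j k) * t ^ k"
      by (simp add: hg monom_eval_axis)
    then show "norm (cps_eval f (axis j t) - cps_coeff f (axis j k) * t ^ k) \<le> K * norm t ^ Suc k"
      using K(3)[rule_format, of "norm t" "axis j t"] t by (simp add: axis_def)
  qed (use K(1,2) \<delta>'(1) in auto)
qed

lemma nonneg_if_bounded_below_by_small:
  fixes a :: real
  assumes "\<delta> > 0" "\<And>s. 0 < s \<Longrightarrow> s < \<delta> \<Longrightarrow> a \<ge> - K * s"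
  shows "a \<ge> 0"
proof -
  have "((\<lambda>s. - K * s) \<longlongrightarrow> - K * 0) (at_right 0)"
    by (intro tendsto_intros)
  moreover have "\<forall>\<^sub>F s in at_right 0. - K * s \<le> a"
    using assms by (auto simp: eventually_at_right_field)
  ultimately show ?thesis
    using tendsto_upperbound[of "\<lambda>s. - K * s" "- K * 0" "at_right 0" a] by simp
qed

text \<open>
  Along a ray the bound gives \<open>Im (\<beta> u\<^sup>k) \<ge> 0\<close> for every unit vector \<open>u\<close> in the closed upper half-plane. The
  values \<open>u\<^sup>k = 1, -1, \<i>\<close> are attained for every \<open>k \<ge> 1\<close> and force \<open>\<beta> > 0\<close>; for \<open>k \<ge> 2\<close> the value
  \<open>u\<^sup>k = -\<i>\<close> is attained as well, which is impossible.
\<close>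

lemma leading_term_upper_half_plane:
  fixes \<beta> :: complex
  assumes \<beta>: "\<beta> \<noteq> 0" and k: "k \<ge> 1" and \<delta>: "\<delta> > 0"
    and bound: "\<And>t. norm t < \<delta> \<Longrightarrow> Im t \<ge> 0 \<Longrightarrow> Im (\<beta> * t ^ k) \<ge> - K * norm t ^ Suc k"
  shows "k = 1 \<and> Im \<beta> = 0 \<and> Re \<beta> > 0"
proof -
  have *: "Im (\<beta> * cis (real k * \<theta>)) \<ge> 0" if "0 \<le> \<theta>" "\<theta> \<le> pi" for \<theta>
  proof (rule nonneg_if_bounded_below_by_small[OF \<delta>])
    fix s assume s: "0 < s" "s < \<delta>"
    let ?t = "complex_of_real s * cis \<theta>"
    have "Im (\<beta> * ?t ^ k) \<ge> - K * norm ?t ^ Suc k"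
      using s that by (intro bound) (auto simp: norm_mult intro!: mult_nonneg_nonneg sin_ge_zero)
    moreover have "\<beta> * ?t ^ k = complex_of_real (s ^ k) * (\<beta> * cis (real k * \<theta>))"
      by (simp add: power_mult_distrib Complex.DeMoivre)
    then have "Im (\<beta> * ?t ^ k) = s ^ k * Im (\<beta> * cis (real k * \<theta>))"
      by (simp only: times_complex.simps Re_complex_of_real Im_complex_of_real mult_zero_left add_0_right)
    moreover have "- K * norm ?t ^ Suc k = s ^ k * (- K * s)"
      using s by (simp add: norm_mult)
    ultimately have "s ^ k * (- K * s) \<le> s ^ k * Im (\<beta> * cis (real k * \<theta>))" by linarith
    then show "- K * s \<le> Im (\<beta> * cis (real k * \<theta>))"
      using s by (simp only: mult_le_cancel_left_pos zero_less_power)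
  qed
  have k0: "real k \<ge> 1" using k by simp
  have 0: "Im \<beta> \<ge> 0" using *[of 0] by simp
  have 1: "Im \<beta> \<le> 0" using *[of "pi / real k"] k0 by (simp add: cis_pi divide_le_eq)
  have 2: "Re \<beta> \<ge> 0" using *[of "pi / 2 / real k"] k0 by (simp add: divide_le_eq)
  have Im: "Im \<beta> = 0" using 0 1 by simp
  then have Re: "Re \<beta> > 0" using 2 \<beta> by (simp add: complex_eq_iff less_le)
  have "k = 1"
  proof (rule ccontr)
    assume "k \<noteq> 1"
    then have k2: "real k \<ge> 2" using k by simp
    have "3 * pi / 2 / real k \<le> pi" using k2 by (simp add: divide_le_eq)
    then have "Im (\<beta> * cis (3 * pi / 2)) \<ge> 0" using *[of "3 * pi / 2 / real k"] k0 by simp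
    moreover have "cis (3 * pi / 2) = cis pi * cis (pi / 2)"
      unfolding cis_mult by (rule arg_cong[of _ _ cis]) simp
    then have "cis (3 * pi / 2) = - \<i>" by simp
    ultimately show False using Re by simp
  qed
  then show ?thesis using Im Re by simp
qed

text \<open>
  The restriction of \<open>\<phi>\<close> to the \<open>j\<close>-th axis is not identically zero, because its imaginary part is nonzero at
  real points, and it maps the upper half-disc to the closed upper half-plane.
\<close>

lemma implicit_function_gradient_positive:
  fixes \<phi> :: "'d::finite conv_ps"
  assumes \<phi>0: "cps_coeff \<phi> 0 = 0"
    and half: "\<forall>\<^sub>F x in nhds 0. (\<forall>j. Im (x $ j) \<ge> 0) \<longrightarrow> Im (cps_eval \<phi> x) \<ge> 0"
    and isolated: "\<forall>\<^sub>F x in nhds 0. x \<noteq> 0 \<longrightarrow> Im (cps_eval \<phi> (cvec x)) \<noteq> 0"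
  shows "Im (cps_coeff \<phi> (axis j 1)) = 0" "Re (cps_coeff \<phi> (axis j 1)) > 0"
proof -
  obtain \<delta>1 where \<delta>1: "\<delta>1 > 0" "\<And>x. (\<forall>i. norm (x $ i) < \<delta>1) \<Longrightarrow> (\<forall>j. Im (x $ j) \<ge> 0) \<Longrightarrow> Im (cps_eval \<phi> x) \<ge> 0"
    using half unfolding eventually_nhds_0_polydisc by blast
  obtain \<delta>2 where \<delta>2: "\<delta>2 > 0" "\<And>x. (\<forall>i. norm (x $ i) < \<delta>2) \<Longrightarrow> x \<noteq> 0 \<Longrightarrow> Im (cps_eval \<phi> (cvec x)) \<noteq> 0"
    using isolated unfolding eventually_nhds_0_polydisc by blast
  have "\<exists>k. cps_coeff \<phi> (axis j k) \<noteq> 0"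
  proof (rule ccontr)
    assume "\<not> ?thesis"
    then have c: "cps_coeff \<phi> (axis j k) = 0" for k by blast
    let ?x = "axis j (\<delta>2 / 2) :: real ^ 'd"
    have "cvec ?x = axis j (complex_of_real (\<delta>2 / 2))" by (simp add: vec_eq_iff axis_def)
    moreover have "cps_coeff \<phi> m * monom_eval (axis j (complex_of_real (\<delta>2 / 2))) m = 0" for m
      using c monom_eval_axis_eq_0[of m j] by (cases "\<exists>k. m = axis j k") auto
    then have "cps_eval \<phi> (axis j (complex_of_real (\<delta>2 / 2))) = 0"
      unfolding cps_eval_def by (simp only: infsum_0_simp)
    ultimately have "Im (cps_eval \<phi> (cvec ?x)) = 0" by simp
    moreover have "Im (cps_eval \<phi> (cvec ?x)) \<noteq> 0"
    proof (rule \<delta>2(2))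
      show "?x \<noteq> 0" using \<delta>2(1) by (simp add: axis_eq_0_iff)
    qed (use \<delta>2(1) in \<open>auto simp: axis_def\<close>)
    ultimately show False by contradiction
  qed
  define k where "k = (LEAST k. cps_coeff \<phi> (axis j k) \<noteq> 0)"
  have k: "cps_coeff \<phi> (axis j k) \<noteq> 0" "\<And>l. l < k \<Longrightarrow> cps_coeff \<phi> (axis j l) = 0"
    unfolding k_def using LeastI_ex[OF \<open>\<exists>k. cps_coeff \<phi> (axis j k) \<noteq> 0\<close>] not_less_Least by blast+
  have "k \<ge> 1" using k(1) \<phi>0 by (cases k) (auto simp: axis_zero)
  obtain K \<delta>3 where K: "K > 0" "\<delta>3 > 0"
    "\<forall>t. norm t < \<delta>3 \<longrightarrow> norm (cps_eval \<phi> (axis j t) - cps_coeff \<phi> (axis j k) * t ^ k) \<le> K * norm t ^ Suc k"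
    using cps_eval_axis_leading_term[OF k(2)] by blast
  have "k = 1 \<and> Im (cps_coeff \<phi> (axis j k)) = 0 \<and> Re (cps_coeff \<phi> (axis j k)) > 0"
  proof (rule leading_term_upper_half_plane[OF k(1) \<open>k \<ge> 1\<close>])
    show "min \<delta>1 \<delta>3 > 0" using \<delta>1 K by simp
    fix t assume t: "norm t < min \<delta>1 \<delta>3" "Im t \<ge> 0"
    have "Im (cps_eval \<phi> (axis j t)) \<ge> 0"
      using t \<delta>1(1) by (intro \<delta>1(2)) (auto simp: axis_def)
    moreover have "\<bar>Im (cps_eval \<phi> (axis j t) - cps_coeff \<phi> (axis j k) * t ^ k)\<bar> \<le> K * norm t ^ Suc k"
      using t by (intro order_trans[OF abs_Im_le_cmod] K(3)[rule_format]) simp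
    ultimately show "Im (cps_coeff \<phi> (axis j k) * t ^ k) \<ge> - K * norm t ^ Suc k"
      by simp
  qed
  then show "Im (cps_coeff \<phi> (axis j 1)) = 0" "Re (cps_coeff \<phi> (axis j 1)) > 0"
    by (auto simp del: One_nat_def)
qed

text \<open>
  Write \<open>\<phi>(x) = \<alpha> \<bullet> x + \<psi>(x)\<close> with \<open>\<psi>\<close> without linear terms. Passing from \<open>Re x\<close> to \<open>x\<close>, the imaginary part
  of the linear form grows by \<open>\<alpha> \<bullet> Im x\<close>, and the change in \<open>\<psi>\<close> is at most half of that on a small polydisc.
\<close>

lemma Im_lower_bound_half_space:
  fixes \<phi> :: "'d::finite conv_ps"
  assumes grad: "\<And>j. Im (cps_coeff \<phi> (axis j 1)) = 0" "\<And>j. Re (cps_coeff \<phi> (axis j 1)) > 0"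
  obtains \<kappa> where "\<kappa> > 0" "\<forall>\<^sub>F x in nhds 0. (\<forall>j. Im (x $ j) \<ge> 0) \<longrightarrow>
    Im (cps_eval \<phi> (cvec (\<chi> j. Re (x $ j)))) + \<kappa> * (\<Sum>j\<in>UNIV. Im (x $ j)) \<le> Im (cps_eval \<phi> x)"
proof -
  let ?S = "range (\<lambda>j. axis j 1 :: nat ^ 'd)"
  let ?\<alpha> = "\<lambda>j. Re (cps_coeff \<phi> (axis j 1))"
  obtain \<psi> where \<psi>: "cps_coeff \<psi> = (\<lambda>m. if m \<in> ?S then 0 else cps_coeff \<phi> m)" and
    \<phi>\<psi>: "\<And>w. (\<lambda>m. cps_coeff \<phi> m * monom_eval w m) summable_on UNIV \<Longrightarrow>
      cps_eval \<phi> w = cps_eval \<psi> w + (\<Sum>m\<in>?S. cps_coeff \<phi> m * monom_eval w m)"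
    by (rule cps_split_off_finite[of ?S \<phi>]) (simp, rule that)
  have inj: "inj (\<lambda>j. axis j 1 :: nat ^ 'd)" by (auto simp: inj_on_def axis_eq_axis)
  have lin: "(\<Sum>m\<in>?S. cps_coeff \<phi> m * monom_eval w m) = (\<Sum>j\<in>UNIV. of_real (?\<alpha> j) * w $ j)" for w
  proof -
    have "cps_coeff \<phi> (axis j 1) = of_real (?\<alpha> j)" for j
      using grad(1) by (simp add: complex_eq_iff)
    then show ?thesis
      by (subst sum.reindex[OF inj], unfold o_def monom_eval_axis power_one_right) simp
  qed
  have \<psi>0: "cps_coeff \<psi> m = 0" if "0 < mdeg m" "mdeg m \<le> 1" for m
  proof -
    have "mdeg m = 1" using that by linarith
    then show ?thesis unfolding mdeg_eq_1_iff \<psi> by auto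
  qed
  obtain K \<delta>1 where K: "K > 0" "\<delta>1 > 0" and lip:
    "\<forall>w v s. 0 < s \<longrightarrow> s \<le> \<delta>1 \<longrightarrow> (\<forall>i. norm (w $ i) \<le> s) \<longrightarrow> (\<forall>i. norm (v $ i) \<le> s) \<longrightarrow>
      norm (cps_eval \<psi> w - cps_eval \<psi> v) \<le> K * s ^ 1 * (\<Sum>i\<in>UNIV. norm (w $ i - v $ i))"
    using cps_eval_lipschitz[of 1 \<psi>] \<psi>0 by blast
  define \<kappa> where "\<kappa> = Min (range ?\<alpha>) / 2"
  have "Min (range ?\<alpha>) > 0" using grad(2) by (subst Min_gr_iff) auto
  then have \<kappa>: "\<kappa> > 0" by (simp add: \<kappa>_def)
  have \<alpha>: "2 * \<kappa> \<le> ?\<alpha> j" for j by (simp add: \<kappa>_def)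
  obtain \<delta>2 where \<delta>2: "\<delta>2 > 0" "\<And>w. (\<forall>i. norm (w $ i) < \<delta>2) \<Longrightarrow>
      (\<lambda>m. cps_coeff \<phi> m * monom_eval w m) summable_on UNIV"
    using eventually_cps_summable[of \<phi>] unfolding eventually_nhds_0_polydisc by blast
  define s where "s = min (min \<delta>1 \<delta>2) (\<kappa> / K)"
  have s: "s > 0" "s \<le> \<delta>1" "s \<le> \<delta>2" using K \<delta>2 \<kappa> by (auto simp: s_def)
  have "s \<le> \<kappa> / K" by (simp add: s_def)
  then have Ks: "K * s \<le> \<kappa>" using K by (simp add: pos_le_divide_eq mult.commute)
  have "Im (cps_eval \<phi> (cvec (\<chi> j. Re (x $ j)))) + \<kappa> * (\<Sum>j\<in>UNIV. Im (x $ j)) \<le> Im (cps_eval \<phi> x)"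
    if x: "\<forall>i. norm (x $ i) < s" and Im: "\<forall>j. Im (x $ j) \<ge> 0" for x
  proof -
    let ?y = "cvec (\<chi> j. Re (x $ j))"
    have y: "norm (?y $ i) < s" for i
      using x abs_Re_le_cmod[of "x $ i"] by (auto intro: le_less_trans)
    have eq: "cps_eval \<phi> u = cps_eval \<psi> u + (\<Sum>j\<in>UNIV. of_real (?\<alpha> j) * u $ j)"
      if "\<forall>i. norm (u $ i) < s" for u
      unfolding lin[symmetric] using s that by (intro \<phi>\<psi> \<delta>2(2)) (auto intro: less_le_trans)
    have "norm (x $ i - ?y $ i) = Im (x $ i)" for i
    proof -
      have "x $ i - ?y $ i = \<i> * of_real (Im (x $ i))" by (simp add: complex_eq_iff)
      then show ?thesis using Im by (simp add: norm_mult)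
    qed
    then have "norm (cps_eval \<psi> x - cps_eval \<psi> ?y) \<le> K * s * (\<Sum>i\<in>UNIV. Im (x $ i))"
      using lip[rule_format, of s x ?y] s x y by (simp add: less_imp_le)
    also have "\<dots> \<le> \<kappa> * (\<Sum>i\<in>UNIV. Im (x $ i))"
      using Ks Im by (intro mult_right_mono sum_nonneg) auto
    finally have "\<bar>Im (cps_eval \<psi> x - cps_eval \<psi> ?y)\<bar> \<le> \<kappa> * (\<Sum>i\<in>UNIV. Im (x $ i))"
      using abs_Im_le_cmod order_trans by blast
    moreover have "Im (cps_eval \<phi> x) = Im (cps_eval \<psi> x) + (\<Sum>j\<in>UNIV. ?\<alpha> j * Im (x $ j))"
      using x by (simp add: eq Im_sum)
    moreover have "Im (cps_eval \<phi> ?y) = Im (cps_eval \<psi> ?y)"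
      using y by (simp add: eq Im_sum del: cvec_nth) simp
    moreover have "(\<Sum>j\<in>UNIV. 2 * \<kappa> * Im (x $ j)) \<le> (\<Sum>j\<in>UNIV. ?\<alpha> j * Im (x $ j))"
      using \<alpha> Im by (intro sum_mono mult_right_mono) auto
    then have "2 * (\<kappa> * (\<Sum>j\<in>UNIV. Im (x $ j))) \<le> (\<Sum>j\<in>UNIV. ?\<alpha> j * Im (x $ j))"
      by (simp add: sum_distrib_left mult_ac)
    ultimately show ?thesis by simp
  qed
  then show ?thesis
    using that[OF \<kappa>] s(1) unfolding eventually_nhds_0_polydisc by blast
qed


lemma eventually_norm_cps_eval_less:
  fixes f :: "'n::finite conv_ps"
  assumes "cps_coeff f 0 = 0" "e > 0"
  shows "\<forall>\<^sub>F x in nhds 0. norm (cps_eval f x) < e"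
  using order_tendstoD(2)[OF tendsto_norm[OF cps_eval_tendsto_0[of f]], of e] assms by simp

lemma eventually_graph:
  fixes \<phi> :: "'d::finite conv_ps" and P :: "real ^ 'd option \<Rightarrow> bool"
  assumes \<phi>0: "cps_coeff \<phi> 0 = 0" and P: "\<forall>\<^sub>F w in nhds 0. P w"
  shows "\<forall>\<^sub>F x in nhds 0. P (with_z x (- Re (cps_eval \<phi> (cvec x))))"
proof -
  obtain \<delta> where \<delta>: "\<delta> > 0" "\<And>w. (\<forall>i. norm (w $ i) < \<delta>) \<Longrightarrow> P w"
    using P unfolding eventually_nhds_0_polydisc by blast
  have "\<forall>\<^sub>F x in nhds (0 :: real ^ 'd). \<forall>j. norm (x $ j) < \<delta>"
    unfolding eventually_nhds_0_polydisc using \<delta>(1) by blast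
  with eventually_cvec[OF eventually_norm_cps_eval_less[OF \<phi>0 \<delta>(1)]] show ?thesis
  proof eventually_elim
    case (elim x)
    show ?case
      by (rule \<delta>(2))
        (use elim abs_Re_le_cmod[of "cps_eval \<phi> (cvec x)"] in \<open>auto simp: all_option intro: le_less_trans\<close>)
  qed
qed

text \<open>
  When all \<open>x\<^sub>j\<close> are in the open upper half-plane, \<open>z = -\<phi>(x)\<close> is a zero of \<open>p\<close>, so by stability it is not in the
  upper half-plane. The boundary case follows by moving \<open>x\<close> in the direction \<open>\<i> (1, \<dots>, 1)\<close>.
\<close>

lemma implicit_function_half_space:
  fixes p :: "(complex, 'd::finite option) mpoly" and \<phi> :: "'d conv_ps"
  assumes stable: "\<forall>w. (\<forall>i. Im (w $ i) > 0) \<longrightarrow> mpoly_eval p w \<noteq> 0"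
    and \<phi>0: "cps_coeff \<phi> 0 = 0"
    and cmp: "\<forall>\<^sub>F w in nhds 0. norm (mpoly_eval p w) \<le> C * norm (w $ None + cps_eval \<phi> (without_z w))"
  shows "\<forall>\<^sub>F x in nhds 0. (\<forall>j. Im (x $ j) \<ge> 0) \<longrightarrow> Im (cps_eval \<phi> x) \<ge> 0"
proof -
  obtain \<delta>1 where \<delta>1: "\<delta>1 > 0" "\<And>w. (\<forall>i. norm (w $ i) < \<delta>1) \<Longrightarrow>
      norm (mpoly_eval p w) \<le> C * norm (w $ None + cps_eval \<phi> (without_z w))"
    using cmp unfolding eventually_nhds_0_polydisc by blast
  obtain K \<delta>2 where K: "K > 0" "\<delta>2 > 0" and lip:
    "\<forall>w v. (\<forall>i. norm (w $ i) \<le> \<delta>2) \<longrightarrow> (\<forall>i. norm (v $ i) \<le> \<delta>2) \<longrightarrow>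
      norm (cps_eval \<phi> w - cps_eval \<phi> v) \<le> K * (\<Sum>i\<in>UNIV. norm (w $ i - v $ i))"
    using cps_eval_lipschitz_near_0[of \<phi>] by blast
  obtain \<delta>3 where \<delta>3: "\<delta>3 > 0" "\<And>x. (\<forall>i. norm (x $ i) < \<delta>3) \<Longrightarrow> norm (cps_eval \<phi> x) < \<delta>1"
    using eventually_norm_cps_eval_less[OF \<phi>0 \<delta>1(1)] unfolding eventually_nhds_0_polydisc by blast
  define \<delta> where "\<delta> = min (min \<delta>1 \<delta>2) \<delta>3 / 2"
  have \<delta>: "\<delta> > 0" "2 * \<delta> \<le> \<delta>1" "2 * \<delta> \<le> \<delta>2" "2 * \<delta> \<le> \<delta>3"
    using \<delta>1 K \<delta>3 by (auto simp: \<delta>_def)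
  have "Im (cps_eval \<phi> x) \<ge> 0" if x: "\<forall>j. norm (x $ j) < \<delta>" and Im: "\<forall>j. Im (x $ j) \<ge> 0" for x
  proof (rule nonneg_if_bounded_below_by_small[OF \<delta>(1)])
    fix s :: real assume s: "0 < s" "s < \<delta>"
    define y where "y = (\<chi> j. x $ j + \<i> * of_real s)"
    have y: "norm (y $ j) < 2 * \<delta>" for j
      using norm_triangle_ineq[of "x $ j" "\<i> * of_real s"] x s
      by (simp add: y_def norm_mult) (smt (verit, best))
    have "Im (cps_eval \<phi> y) \<ge> 0"
    proof (rule ccontr)
      assume neg: "\<not> Im (cps_eval \<phi> y) \<ge> 0"
      let ?w = "with_z y (- cps_eval \<phi> y)"
      have "mpoly_eval p ?w \<noteq> 0"
      proof (rule stable[rule_format])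
        fix i show "Im (?w $ i) > 0"
          using neg Im s by (cases i) (auto simp: y_def intro: add_nonneg_pos)
      qed
      moreover have "norm (cps_eval \<phi> y) < \<delta>1"
        using y \<delta> by (intro \<delta>3(2)) (auto intro: less_le_trans)
      then have "norm (mpoly_eval p ?w) \<le> C * norm (?w $ None + cps_eval \<phi> (without_z ?w))"
        using y \<delta> by (intro \<delta>1(2)) (auto simp: all_option intro: less_le_trans)
      ultimately show False by simp
    qed
    moreover have "\<bar>Im (cps_eval \<phi> y - cps_eval \<phi> x)\<bar> \<le> K * (\<Sum>j\<in>UNIV. norm (y $ j - x $ j))"
    proof (rule order_trans[OF abs_Im_le_cmod], rule lip[rule_format])
      show "norm (y $ j) \<le> \<delta>2" "norm (x $ j) \<le> \<delta>2" for j
        using y[of j] spec[OF x, of j] \<delta> by linarith+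
    qed
    moreover have "(\<Sum>j\<in>UNIV. norm (y $ j - x $ j)) = real CARD('d) * s"
      using s by (simp add: y_def norm_mult)
    ultimately show "Im (cps_eval \<phi> x) \<ge> - (K * real CARD('d)) * s"
      by (simp add: mult.assoc)
  qed
  then show ?thesis
    unfolding eventually_nhds_0_polydisc using \<delta>(1) by blast
qed

text \<open>
  If \<open>\<phi>(x)\<close> is real at a real point \<open>x\<close>, then \<open>(x, -\<phi>(x))\<close> is a real zero of \<open>p\<close>.
\<close>

lemma implicit_function_isolated:
  fixes p :: "(complex, 'd::finite option) mpoly" and \<phi> :: "'d conv_ps"
  assumes isolated: "\<forall>\<^sub>F w in nhds (0 :: real ^ 'd option). mpoly_eval p (cvec w) = 0 \<longrightarrow> w = 0"
    and \<phi>0: "cps_coeff \<phi> 0 = 0"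
    and cmp: "\<forall>\<^sub>F w in nhds 0. norm (mpoly_eval p w) \<le> C * norm (w $ None + cps_eval \<phi> (without_z w))"
  shows "\<forall>\<^sub>F x in nhds 0. x \<noteq> 0 \<longrightarrow> Im (cps_eval \<phi> (cvec x)) \<noteq> 0"
  using eventually_graph[OF \<phi>0 isolated] eventually_graph[OF \<phi>0 eventually_cvec[OF cmp]]
proof eventually_elim
  case (elim x)
  let ?w = "with_z x (- Re (cps_eval \<phi> (cvec x)))"
  show ?case
  proof (intro impI notI)
    assume "x \<noteq> 0" "Im (cps_eval \<phi> (cvec x)) = 0"
    then have "- of_real (Re (cps_eval \<phi> (cvec x))) + cps_eval \<phi> (cvec x) = 0"
      by (simp add: complex_eq_iff)
    then have "mpoly_eval p (cvec ?w) = 0"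
      using elim(2) by (simp add: cvec_with_z)
    then have "?w = 0" using elim(1) by blast
    then have "without_z ?w = without_z 0" by (rule arg_cong)
    then have "x = 0" by (simp add: vec_eq_iff)
    then show False using \<open>x \<noteq> 0\<close> by contradiction
  qed
qed

lemma norm_mpoly_eval_square:
  fixes p :: "(complex, 'n::finite) mpoly"
  shows "(norm (mpoly_eval p (cvec w)))\<^sup>2 =
    polyfun (Poly_Mapping.keys p \<times> Poly_Mapping.keys p)
      (\<lambda>q. Re (Poly_Mapping.lookup p (fst q) * cnj (Poly_Mapping.lookup p (snd q))))
      (\<lambda>q. fst q + snd q) w"
proof -
  let ?c = "Poly_Mapping.lookup p" and ?S = "Poly_Mapping.keys p"
  have "mpoly_eval p (cvec w) = (\<Sum>m\<in>?S. ?c m * of_real (monom_eval w m))"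
    by (simp add: mpoly_eval_def monom_eval_def)
  then have "mpoly_eval p (cvec w) * cnj (mpoly_eval p (cvec w)) =
      (\<Sum>m\<in>?S. ?c m * of_real (monom_eval w m)) * (\<Sum>m\<in>?S. cnj (?c m) * of_real (monom_eval w m))"
    by simp
  also have "\<dots> = (\<Sum>q\<in>?S \<times> ?S. ?c (fst q) * cnj (?c (snd q)) * of_real (monom_eval w (fst q + snd q)))"
    by (simp add: sum_product sum.cartesian_product case_prod_unfold monom_eval_add mult_ac)
  finally have "Re (mpoly_eval p (cvec w) * cnj (mpoly_eval p (cvec w))) =
      (\<Sum>q\<in>?S \<times> ?S. Re (?c (fst q) * cnj (?c (snd q)) * of_real (monom_eval w (fst q + snd q))))"
    by (simp only: Re_sum)
  also have "\<dots> = (\<Sum>q\<in>?S \<times> ?S. Re (?c (fst q) * cnj (?c (snd q))) * monom_eval w (fst q + snd q))"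
    by (rule sum.cong) (simp_all add: algebra_simps)
  finally show ?thesis
    by (simp only: polyfun_def complex_norm_square[symmetric] Re_complex_of_real)
qed

section \<open>Polynomial approximation of the implicit function\<close>

text \<open>
  At the real point \<open>w = (x, -Re \<phi>(x))\<close>, \<open>\<bar>p(w)\<bar>\<close> is at most a constant times \<open>Im \<phi>(x)\<close>, whereas the
  Lojasiewicz inequality bounds \<open>\<bar>p(w)\<bar>\<^sup>2\<close> from below by a power of \<open>\<parallel>w\<parallel> \<ge> \<parallel>x\<parallel>\<close>.
\<close>

lemma implicit_function_lojasiewicz:
  fixes p :: "(complex, 'd::finite option) mpoly" and \<phi> :: "'d conv_ps"
  assumes p0: "mpoly_eval p 0 = 0"
    and isolated: "\<forall>\<^sub>F w in nhds (0 :: real ^ 'd option). mpoly_eval p (cvec w) = 0 \<longrightarrow> w = 0"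
    and \<phi>0: "cps_coeff \<phi> 0 = 0"
    and C: "C > 0"
    and cmp: "\<forall>\<^sub>F w in nhds 0. norm (mpoly_eval p w) \<le> C * norm (w $ None + cps_eval \<phi> (without_z w))"
    and half: "\<forall>\<^sub>F x in nhds 0. (\<forall>j. Im (x $ j) \<ge> 0) \<longrightarrow> Im (cps_eval \<phi> x) \<ge> 0"
  obtains c N where "c > 0" "\<forall>\<^sub>F x in nhds 0. c * norm x ^ N \<le> Im (cps_eval \<phi> (cvec x))"
proof -
  let ?F = "polyfun (Poly_Mapping.keys p \<times> Poly_Mapping.keys p)
      (\<lambda>q. Re (Poly_Mapping.lookup p (fst q) * cnj (Poly_Mapping.lookup p (snd q))))
      (\<lambda>q. fst q + snd q)"
  have F: "?F w = (norm (mpoly_eval p (cvec w)))\<^sup>2" for w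
    by (rule norm_mpoly_eval_square[symmetric])
  have "cvec (0 :: real ^ 'd option) = 0" by (simp add: vec_eq_iff)
  then have F0: "?F 0 = 0" unfolding F using p0 by simp
  have pos: "\<forall>\<^sub>F w in nhds 0. w \<noteq> 0 \<longrightarrow> ?F w > 0"
    unfolding F using isolated by eventually_elim auto
  obtain c N where c: "c > 0" and loj: "\<forall>\<^sub>F w in nhds 0. c * norm w ^ N \<le> ?F w"
    by (rule polynomial_isolated_zero_lower_bound[OF _ F0 pos]) (simp, rule that)
  have "\<forall>\<^sub>F x in nhds 0. c / C\<^sup>2 * norm x ^ N \<le> Im (cps_eval \<phi> (cvec x))"
    using eventually_graph[OF \<phi>0 loj] eventually_graph[OF \<phi>0 eventually_cvec[OF cmp]]
      eventually_cvec[OF half] eventually_cvec[OF eventually_norm_cps_eval_less[OF \<phi>0 zero_less_one]]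
  proof eventually_elim
    case (elim x)
    let ?z = "- Re (cps_eval \<phi> (cvec x))"
    let ?B = "Im (cps_eval \<phi> (cvec x))"
    have B0: "?B \<ge> 0" using elim(3) by simp
    have B1: "?B \<le> 1" using elim(4) abs_Im_le_cmod[of "cps_eval \<phi> (cvec x)"] by linarith
    have "of_real ?z + cps_eval \<phi> (cvec x) = \<i> * of_real ?B" by (simp add: complex_eq_iff)
    then have "norm (of_real ?z + cps_eval \<phi> (cvec x)) = ?B" using B0 by (simp add: norm_mult)
    then have p: "norm (mpoly_eval p (cvec (with_z x ?z))) \<le> C * ?B"
      using elim(2) by (simp add: cvec_with_z)
    have "norm x \<le> norm (with_z x ?z)"
      unfolding norm_vec_def L2_set_def by (simp add: UNIV_option_conv sum.reindex)
    then have "c * norm x ^ N \<le> c * norm (with_z x ?z) ^ N"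
      using c by (intro mult_left_mono power_mono) auto
    also have "\<dots> \<le> (norm (mpoly_eval p (cvec (with_z x ?z))))\<^sup>2"
      using elim(1) unfolding F .
    also have "\<dots> \<le> (C * ?B)\<^sup>2" using p by (intro power_mono) auto
    also have "\<dots> = C\<^sup>2 * (?B * ?B)" by (simp add: power2_eq_square)
    also have "\<dots> \<le> C\<^sup>2 * (?B * 1)" using B0 B1 by (intro mult_left_mono) auto
    finally show ?case using C by (simp add: field_simps)
  qed
  then show ?thesis by (rule that[rotated]) (use c C in simp)
qed

text \<open>
  Both polynomials come from truncating \<open>\<phi>\<close> after degree \<open>N\<close>. The remainder has order \<open>N + 1\<close>, one more than
  the lower bound for \<open>Im \<phi>\<close>, and is therefore negligible against it.
\<close>

lemma polynomial_approximation:
  fixes \<phi> :: "'d::finite conv_ps"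
  assumes c: "c > 0" and loj: "\<forall>\<^sub>F x in nhds 0. c * norm x ^ N \<le> Im (cps_eval \<phi> (cvec x))"
  obtains g H :: "(real, 'd) mpoly" where
    "Poly_Mapping.lookup H 0 = Re (cps_coeff \<phi> 0)"
    "\<forall>\<^sub>F x in nhds 0. norm (cps_eval \<phi> (cvec x) - (of_real (mpoly_eval H x) + \<i> * of_real (mpoly_eval g x)))
      \<le> Im (cps_eval \<phi> (cvec x)) / 2"
proof -
  let ?S = "{m :: nat ^ 'd. mdeg m \<le> N}"
  have fin: "finite ?S" by (rule finite_mdeg_le)
  define trunc :: "(nat ^ 'd \<Rightarrow> real) \<Rightarrow> (real, 'd) mpoly"
    where "trunc a = Abs_poly_mapping (\<lambda>m. if m \<in> ?S then a m else 0)" for a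
  have lookup_trunc: "Poly_Mapping.lookup (trunc a) = (\<lambda>m. if m \<in> ?S then a m else 0)" for a
    unfolding trunc_def by (rule Abs_poly_mapping_inverse) (auto intro: finite_subset[OF _ fin])
  have eval_trunc: "mpoly_eval (trunc a) x = (\<Sum>m\<in>?S. a m * monom_eval x m)" for a x
    unfolding mpoly_eval_def lookup_trunc
    by (rule sum.mono_neutral_cong_left[OF fin]) (auto simp: in_keys_iff lookup_trunc split: if_splits)
  define H where "H = trunc (\<lambda>m. Re (cps_coeff \<phi> m))"
  define g where "g = trunc (\<lambda>m. Im (cps_coeff \<phi> m))"
  obtain h where h: "cps_coeff h = (\<lambda>m. if m \<in> ?S then 0 else cps_coeff \<phi> m)" and
    \<phi>h: "\<And>w. (\<lambda>m. cps_coeff \<phi> m * monom_eval w m) summable_on UNIV \<Longrightarrow>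
      cps_eval \<phi> w = cps_eval h w + (\<Sum>m\<in>?S. cps_coeff \<phi> m * monom_eval w m)"
    by (rule cps_split_off_finite[OF fin]) (rule that)
  obtain K \<delta> where K: "K > 0" "\<delta> > 0" and bound:
    "\<forall>w s. s \<le> \<delta> \<longrightarrow> (\<forall>i. norm (w $ i) \<le> s) \<longrightarrow> norm (cps_eval h w) \<le> K * s ^ Suc N"
    using cps_eval_power_bound[of "Suc N" h] h by (auto simp: less_Suc_eq_le)
  have small: "c / (2 * K) > 0" using c K by simp
  have "\<forall>\<^sub>F x in nhds 0. norm (cps_eval \<phi> (cvec x) - (of_real (mpoly_eval H x) + \<i> * of_real (mpoly_eval g x)))
      \<le> Im (cps_eval \<phi> (cvec x)) / 2"
    using loj eventually_cvec[OF eventually_cps_summable[of \<phi>]] eventually_norm_less[OF K(2)]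
      eventually_norm_less[OF small]
  proof eventually_elim
    case (elim x)
    have "(\<Sum>m\<in>?S. cps_coeff \<phi> m * monom_eval (cvec x) m)
        = (\<Sum>m\<in>?S. (of_real (Re (cps_coeff \<phi> m)) + \<i> * of_real (Im (cps_coeff \<phi> m))) * of_real (monom_eval x m))"
      by (simp add: monom_eval_def flip: complex_eq)
    also have "\<dots> = of_real (mpoly_eval H x) + \<i> * of_real (mpoly_eval g x)"
      by (simp add: H_def g_def eval_trunc distrib_right sum.distrib sum_distrib_left mult.assoc)
    finally have "cps_eval \<phi> (cvec x) - (of_real (mpoly_eval H x) + \<i> * of_real (mpoly_eval g x)) = cps_eval h (cvec x)"
      using \<phi>h[OF elim(2)] by simp
    moreover have "norm (cps_eval h (cvec x)) \<le> K * norm x ^ Suc N"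
      using bound[rule_format, of "norm x" "cvec x"] elim(3) component_le_norm_cart[of x] by simp
    moreover have "K * norm x ^ Suc N = (K * norm x) * norm x ^ N" by simp
    moreover have "(K * norm x) * norm x ^ N \<le> (c / 2) * norm x ^ N"
      using elim(4) K c by (intro mult_right_mono) (auto simp: field_simps)
    ultimately show ?case using elim(1) by simp
  qed
  moreover have "Poly_Mapping.lookup H 0 = Re (cps_coeff \<phi> 0)"
    by (simp add: H_def lookup_trunc)
  ultimately show ?thesis using that by blast
qed

section \<open>Boundedness on the half-space and on its real boundary\<close>

text \<open>
  Both sides change at a controlled rate from \<open>Re x\<close> to \<open>x\<close>: \<open>r\<close> by at most a multiple of the sum of the
  \<open>Im x\<^sub>j\<close>, and \<open>Im \<phi>\<close> grows by at least a multiple of that sum.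
\<close>

lemma half_space_bound_from_real_bound:
  fixes \<phi> r :: "'d::finite conv_ps"
  assumes \<kappa>: "\<kappa> > 0" and lower: "\<forall>\<^sub>F x in nhds 0. (\<forall>j. Im (x $ j) \<ge> 0) \<longrightarrow>
      Im (cps_eval \<phi> (cvec (\<chi> j. Re (x $ j)))) + \<kappa> * (\<Sum>j\<in>UNIV. Im (x $ j)) \<le> Im (cps_eval \<phi> x)"
    and half: "\<forall>\<^sub>F x in nhds 0. (\<forall>j. Im (x $ j) \<ge> 0) \<longrightarrow> Im (cps_eval \<phi> x) \<ge> 0"
    and real: "\<forall>\<^sub>F x in nhds 0. norm (cps_eval r (cvec x)) \<le> C * Im (cps_eval \<phi> (cvec x))"
  shows "\<exists>M. \<forall>\<^sub>F w in nhds 0. (\<forall>i. Im (w $ i) > 0) \<longrightarrow>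
    norm (cps_eval r (without_z w)) \<le> M * norm (w $ None + cps_eval \<phi> (without_z w))"
proof -
  obtain K \<delta> where K: "K > 0" "\<delta> > 0" and lip:
    "\<forall>w v. (\<forall>i. norm (w $ i) \<le> \<delta>) \<longrightarrow> (\<forall>i. norm (v $ i) \<le> \<delta>) \<longrightarrow>
      norm (cps_eval r w - cps_eval r v) \<le> K * (\<Sum>i\<in>UNIV. norm (w $ i - v $ i))"
    using cps_eval_lipschitz_near_0[of r] by blast
  define M where "M = max C (K / \<kappa>)"
  have "M > 0" using K \<kappa> by (simp add: M_def less_max_iff_disj)
  have re: "\<forall>\<^sub>F x in nhds (0 :: complex ^ 'd). P (\<chi> j. Re (x $ j))"
    if P: "\<forall>\<^sub>F x in nhds (0 :: real ^ 'd). P x" for P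
  proof -
    obtain e where e: "e > 0" "\<And>x. (\<forall>i. norm (x $ i) < e) \<Longrightarrow> P x"
      using P unfolding eventually_nhds_0_polydisc by blast
    have "P (\<chi> j. Re (x $ j))" if "\<forall>i. norm (x $ i) < e" for x :: "complex ^ 'd"
      by (rule e(2)) (use that abs_Re_le_cmod in \<open>auto intro: le_less_trans\<close>)
    then show ?thesis unfolding eventually_nhds_0_polydisc using e(1) by blast
  qed
  have "\<forall>\<^sub>F x in nhds (0 :: complex ^ 'd). \<forall>j. norm (x $ j) < \<delta>"
    unfolding eventually_nhds_0_polydisc using K(2) by blast
  then have "\<forall>\<^sub>F x in nhds 0. (\<forall>j. Im (x $ j) \<ge> 0) \<longrightarrow> norm (cps_eval r x) \<le> M * Im (cps_eval \<phi> x)"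
    using lower re[OF real] re[OF eventually_cvec[OF half]]
  proof eventually_elim
    case (elim x)
    show ?case
    proof
      assume Im: "\<forall>j. Im (x $ j) \<ge> 0"
      let ?y = "cvec (\<chi> j. Re (x $ j))" and ?s = "\<Sum>j\<in>UNIV. Im (x $ j)"
      have B0: "Im (cps_eval \<phi> ?y) \<ge> 0" using elim(4) by simp
      have s0: "?s \<ge> 0" using Im by (intro sum_nonneg) auto
      have "norm (x $ j - ?y $ j) = Im (x $ j)" for j
      proof -
        have "x $ j - ?y $ j = \<i> * of_real (Im (x $ j))" by (simp add: complex_eq_iff)
        then show ?thesis using Im by (simp add: norm_mult)
      qed
      moreover have "norm (?y $ j) \<le> \<delta>" for j
        using spec[OF elim(1), of j] abs_Re_le_cmod[of "x $ j"] by simp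
      ultimately have "norm (cps_eval r x - cps_eval r ?y) \<le> K * ?s"
        using lip[rule_format, of x ?y] elim(1) by (simp add: less_imp_le)
      then have "norm (cps_eval r x) \<le> C * Im (cps_eval \<phi> ?y) + K * ?s"
        using elim(3) norm_triangle_ineq2[of "cps_eval r x" "cps_eval r ?y"] by linarith
      also have "\<dots> \<le> M * Im (cps_eval \<phi> ?y) + M * (\<kappa> * ?s)"
      proof (rule add_mono)
        show "C * Im (cps_eval \<phi> ?y) \<le> M * Im (cps_eval \<phi> ?y)"
          using B0 by (intro mult_right_mono) (auto simp: M_def)
        have "K * ?s = K / \<kappa> * (\<kappa> * ?s)" using \<kappa> by simp
        also have "\<dots> \<le> M * (\<kappa> * ?s)" using s0 \<kappa> by (intro mult_right_mono) (auto simp: M_def)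
        finally show "K * ?s \<le> M * (\<kappa> * ?s)" .
      qed
      also have "\<dots> = M * (Im (cps_eval \<phi> ?y) + \<kappa> * ?s)" by (simp add: distrib_left)
      also have "\<dots> \<le> M * Im (cps_eval \<phi> x)"
        using elim(2) Im \<open>M > 0\<close> by (intro mult_left_mono) auto
      finally show "norm (cps_eval r x) \<le> M * Im (cps_eval \<phi> x)" .
    qed
  qed
  from eventually_without_z[OF this]
  have "\<forall>\<^sub>F w in nhds 0. (\<forall>i. Im (w $ i) > 0) \<longrightarrow>
    norm (cps_eval r (without_z w)) \<le> M * norm (w $ None + cps_eval \<phi> (without_z w))"
  proof eventually_elim
    case (elim w)
    show ?case
    proof
      assume Im: "\<forall>i. Im (w $ i) > 0"
      then have "norm (cps_eval r (without_z w)) \<le> M * Im (cps_eval \<phi> (without_z w))"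
        using elim by (simp add: less_imp_le)
      also have "Im (cps_eval \<phi> (without_z w)) \<le> Im (w $ None + cps_eval \<phi> (without_z w))"
        using Im by (simp add: less_imp_le)
      also have "\<dots> \<le> norm (w $ None + cps_eval \<phi> (without_z w))"
        using abs_Im_le_cmod abs_le_D1 by blast
      finally show "norm (cps_eval r (without_z w)) \<le> M * norm (w $ None + cps_eval \<phi> (without_z w))"
        using \<open>M > 0\<close> by simp
    qed
  qed
  then show ?thesis ..
qed

text \<open>
  For real \<open>x\<close>, apply the bound at \<open>x + \<i> s (1, \<dots>, 1)\<close> and \<open>z = -Re \<phi>(x) + \<i> s\<close>, and let \<open>s\<close> tend to \<open>0\<close> from
  above; then \<open>z + \<phi>\<close> tends to \<open>\<i> Im \<phi>(x)\<close>.
\<close>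

lemma real_bound_from_half_space_bound:
  fixes \<phi> r :: "'d::finite conv_ps"
  assumes \<phi>0: "cps_coeff \<phi> 0 = 0"
    and half: "\<forall>\<^sub>F x in nhds 0. (\<forall>j. Im (x $ j) \<ge> 0) \<longrightarrow> Im (cps_eval \<phi> x) \<ge> 0"
    and M: "M > 0"
    and bound: "\<forall>\<^sub>F w in nhds 0. (\<forall>i. Im (w $ i) > 0) \<longrightarrow>
      norm (cps_eval r (without_z w)) \<le> M * norm (w $ None + cps_eval \<phi> (without_z w))"
  shows "\<forall>\<^sub>F x in nhds 0. norm (cps_eval r (cvec x)) \<le> M * Im (cps_eval \<phi> (cvec x))"
proof -
  obtain \<delta>1 where \<delta>1: "\<delta>1 > 0" "\<And>w. (\<forall>i. norm (w $ i) < \<delta>1) \<Longrightarrow> (\<forall>i. Im (w $ i) > 0) \<Longrightarrow>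
      norm (cps_eval r (without_z w)) \<le> M * norm (w $ None + cps_eval \<phi> (without_z w))"
    using bound unfolding eventually_nhds_0_polydisc by blast
  obtain K \<delta>2 where K: "K > 0" "\<delta>2 > 0" and lip:
    "\<forall>w v. (\<forall>i. norm (w $ i) \<le> \<delta>2) \<longrightarrow> (\<forall>i. norm (v $ i) \<le> \<delta>2) \<longrightarrow>
      norm (cps_eval r w - cps_eval r v) \<le> K * (\<Sum>i\<in>UNIV. norm (w $ i - v $ i))"
    using cps_eval_lipschitz_near_0[of r] by blast
  obtain L \<delta>3 where L: "L > 0" "\<delta>3 > 0" and lip\<phi>:
    "\<forall>w v. (\<forall>i. norm (w $ i) \<le> \<delta>3) \<longrightarrow> (\<forall>i. norm (v $ i) \<le> \<delta>3) \<longrightarrow>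
      norm (cps_eval \<phi> w - cps_eval \<phi> v) \<le> L * (\<Sum>i\<in>UNIV. norm (w $ i - v $ i))"
    using cps_eval_lipschitz_near_0[of \<phi>] by blast
  define \<delta> where "\<delta> = min (min \<delta>1 \<delta>2) \<delta>3 / 2"
  have \<delta>: "\<delta> > 0" "2 * \<delta> \<le> \<delta>1" "2 * \<delta> \<le> \<delta>2" "2 * \<delta> \<le> \<delta>3"
    using \<delta>1 K L by (auto simp: \<delta>_def)
  define d where "d = real CARD('d)"
  have "\<forall>\<^sub>F x in nhds (0 :: real ^ 'd). \<forall>j. norm (x $ j) < \<delta>"
    unfolding eventually_nhds_0_polydisc using \<delta>(1) by blast
  then show ?thesis
    using eventually_cvec[OF half] eventually_cvec[OF eventually_norm_cps_eval_less[OF \<phi>0 \<delta>(1)]]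
  proof eventually_elim
    case (elim x)
    let ?\<phi>x = "cps_eval \<phi> (cvec x)"
    have B0: "Im ?\<phi>x \<ge> 0" using elim(2) by simp
    have "M * Im ?\<phi>x - norm (cps_eval r (cvec x)) \<ge> 0"
    proof (rule nonneg_if_bounded_below_by_small[OF \<delta>(1)])
      fix s :: real assume s: "0 < s" "s < \<delta>"
      define y where "y = (\<chi> j. complex_of_real (x $ j) + \<i> * of_real s)"
      define z where "z = - of_real (Re ?\<phi>x) + \<i> * of_real s"
      have y: "norm (y $ j) < 2 * \<delta>" for j
      proof -
        have "norm (y $ j) \<le> \<bar>x $ j\<bar> + s"
          using norm_triangle_ineq[of "of_real (x $ j)" "\<i> * of_real s :: complex"] s
          by (simp add: y_def norm_mult)
        moreover have "\<bar>x $ j\<bar> < \<delta>" using elim(1) by simp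
        ultimately show ?thesis using s by linarith
      qed
      have z: "norm z < 2 * \<delta>"
      proof -
        have "norm z \<le> \<bar>Re ?\<phi>x\<bar> + s"
          using norm_triangle_ineq[of "- of_real (Re ?\<phi>x)" "\<i> * of_real s :: complex"] s
          by (simp add: z_def norm_mult)
        then show ?thesis using elim(3) abs_Re_le_cmod[of ?\<phi>x] s by linarith
      qed
      have xs: "norm (cvec x $ j) < 2 * \<delta>" for j
        using elim(1)[rule_format, of j] \<delta>(1) by simp
      have dist: "(\<Sum>j\<in>UNIV. norm (y $ j - cvec x $ j)) = d * s"
        using s by (simp add: y_def norm_mult d_def)
      have 1: "norm (cps_eval r y - cps_eval r (cvec x)) \<le> K * (d * s)"
        unfolding dist[symmetric] using less_le_trans[OF y \<delta>(3)] less_le_trans[OF xs \<delta>(3)]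
        by (intro lip[rule_format]) (simp_all only: less_imp_le)
      have 2: "norm (cps_eval \<phi> y - ?\<phi>x) \<le> L * (d * s)"
        unfolding dist[symmetric] using less_le_trans[OF y \<delta>(4)] less_le_trans[OF xs \<delta>(4)]
        by (intro lip\<phi>[rule_format]) (simp_all only: less_imp_le)
      have 3: "norm (cps_eval r y) \<le> M * norm (z + cps_eval \<phi> y)"
        using \<delta>1(2)[of "with_z y z"] less_le_trans[OF y \<delta>(2)] less_le_trans[OF z \<delta>(2)] s
        by (simp add: all_option y_def z_def)
      have "z + cps_eval \<phi> y = \<i> * of_real (Im ?\<phi>x + s) + (cps_eval \<phi> y - ?\<phi>x)"
        by (simp add: z_def complex_eq_iff)
      then have "norm (z + cps_eval \<phi> y) \<le> norm (\<i> * of_real (Im ?\<phi>x + s)) + norm (cps_eval \<phi> y - ?\<phi>x)"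
        by (simp only: norm_triangle_ineq)
      also have "norm (\<i> * of_real (Im ?\<phi>x + s)) = Im ?\<phi>x + s"
        using B0 s by (simp only: norm_mult norm_ii norm_of_real mult_1_left abs_of_nonneg)
      finally have "norm (z + cps_eval \<phi> y) \<le> Im ?\<phi>x + s + L * (d * s)"
        using 2 by linarith
      then have "M * norm (z + cps_eval \<phi> y) \<le> M * (Im ?\<phi>x + s + L * (d * s))"
        using M by (intro mult_left_mono) auto
      then have "norm (cps_eval r (cvec x)) \<le> M * (Im ?\<phi>x + s + L * (d * s)) + K * (d * s)"
        using 1 3 norm_triangle_ineq3[of "cps_eval r y" "cps_eval r (cvec x)"] by linarith
      then show "M * Im ?\<phi>x - norm (cps_eval r (cvec x)) \<ge> - (M + M * L * d + K * d) * s"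
        by (simp add: algebra_simps)
    qed
    then show ?case by simp
  qed
qed

section \<open>The ideal of admissible numerators\<close>

lemma admissible_numerators_iff:
  fixes p :: "(complex, 'n::finite) mpoly"
  assumes stable: "\<forall>w. (\<forall>i. Im (w $ i) > 0) \<longrightarrow> mpoly_eval p w \<noteq> 0"
  shows "q \<in> admissible_numerators p \<longleftrightarrow>
    (\<exists>M. \<forall>\<^sub>F w in nhds 0. (\<forall>i. Im (w $ i) > 0) \<longrightarrow> norm (cps_eval q w) \<le> M * norm (mpoly_eval p w))"
proof -
  have "norm (cps_eval q w / mpoly_eval p w) \<le> M \<longleftrightarrow> norm (cps_eval q w) \<le> M * norm (mpoly_eval p w)"
    if "\<forall>i. Im (w $ i) > 0" for w M
    using spec[OF stable, of w] that by (simp add: norm_divide pos_divide_le_eq)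
  then show ?thesis
    unfolding admissible_numerators_def bounded_iff eventually_nhds_0_polydisc by fastforce
qed

lemma subspace_admissible_numerators:
  fixes p :: "(complex, 'n::finite) mpoly"
  assumes stable: "\<forall>w. (\<forall>i. Im (w $ i) > 0) \<longrightarrow> mpoly_eval p w \<noteq> 0"
  shows "module.subspace (*) (admissible_numerators p)"
  unfolding module.subspace_def[OF module_times]
proof (intro conjI ballI allI)
  note iff = admissible_numerators_iff[OF stable]
  show "0 \<in> admissible_numerators p"
    unfolding iff by (intro exI[of _ 0]) (simp add: cps_eval_def zero_conv_ps.rep_eq)
  show "x + y \<in> admissible_numerators p" if xy: "x \<in> admissible_numerators p" "y \<in> admissible_numerators p" for x y
  proof -
    obtain M N where
      M: "\<forall>\<^sub>F w in nhds 0. (\<forall>i. Im (w $ i) > 0) \<longrightarrow> norm (cps_eval x w) \<le> M * norm (mpoly_eval p w)" and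
      N: "\<forall>\<^sub>F w in nhds 0. (\<forall>i. Im (w $ i) > 0) \<longrightarrow> norm (cps_eval y w) \<le> N * norm (mpoly_eval p w)"
      using xy unfolding iff by blast
    from M N eventually_cps_eval_plus[of x y]
    have "\<forall>\<^sub>F w in nhds 0. (\<forall>i. Im (w $ i) > 0) \<longrightarrow> norm (cps_eval (x + y) w) \<le> (M + N) * norm (mpoly_eval p w)"
    proof eventually_elim
      case (elim w)
      then show ?case using norm_triangle_ineq[of "cps_eval x w" "cps_eval y w"]
        by (auto simp: distrib_right)
    qed
    then show ?thesis unfolding iff by blast
  qed
  show "c * x \<in> admissible_numerators p" if x: "x \<in> admissible_numerators p" for c x
  proof -
    obtain M where
      M: "\<forall>\<^sub>F w in nhds 0. (\<forall>i. Im (w $ i) > 0) \<longrightarrow> norm (cps_eval x w) \<le> M * norm (mpoly_eval p w)"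
      using x unfolding iff by blast
    define N where "N = norm (cps_coeff c 0) + 1"
    have "\<forall>\<^sub>F w in nhds 0. norm (cps_eval c w) < N"
      using order_tendstoD(2)[OF tendsto_norm[OF cps_eval_tendsto_0[of c]], of N] by (simp add: N_def)
    from M this eventually_cps_eval_times[of c x]
    have "\<forall>\<^sub>F w in nhds 0. (\<forall>i. Im (w $ i) > 0) \<longrightarrow> norm (cps_eval (c * x) w) \<le> (N * M) * norm (mpoly_eval p w)"
    proof eventually_elim
      case (elim w)
      show ?case
      proof
        assume "\<forall>i. Im (w $ i) > 0"
        then have "norm (cps_eval c w) * norm (cps_eval x w) \<le> N * (M * norm (mpoly_eval p w))"
          using elim by (intro mult_mono) (auto simp: N_def)
        then show "norm (cps_eval (c * x) w) \<le> (N * M) * norm (mpoly_eval p w)"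
          using elim(3) by (simp add: norm_mult mult.assoc)
      qed
    qed
    then show ?thesis unfolding iff by blast
  qed
qed

theorem theorem1p10:
  fixes p :: "(complex, 'd::finite option) mpoly"
  assumes "\<And>w. (\<And>i. Im (w $ i) > 0) \<Longrightarrow> mpoly_eval p w \<noteq> 0"
    and "mpoly_eval p 0 = 0"
    and "deriv (\<lambda>t. mpoly_eval p (axis None t)) 0 \<noteq> 0"
    and "\<forall>\<^sub>F w in nhds (0 :: real ^ 'd option). mpoly_eval p (cvec w) = 0 \<longrightarrow> w = 0"
  shows "\<exists>(g :: (real, 'd) mpoly) (H :: (real, 'd) mpoly).
    admissible_numerators p =
      ideal_gen (insert (cps_z + cps_incl (cps_of_mpoly (Poly_Mapping.map complex_of_real H)))
                        (cps_incl ` IC g))"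
proof -
  have stable: "\<forall>w. (\<forall>i. Im (w $ i) > 0) \<longrightarrow> mpoly_eval p w \<noteq> 0"
    using assms(1) by blast
  note isolated = assms(4)
  obtain \<phi> :: "'d conv_ps" and C where \<phi>0: "cps_coeff \<phi> 0 = 0" and C: "C > 0" and
    cmp1: "\<forall>\<^sub>F w in nhds 0. norm (mpoly_eval p w) \<le> C * norm (w $ None + cps_eval \<phi> (without_z w))" and
    cmp2: "\<forall>\<^sub>F w in nhds 0. norm (w $ None + cps_eval \<phi> (without_z w)) \<le> C * norm (mpoly_eval p w)"
    using implicit_function_comparison[OF assms(2,3)] by blast
  note half = implicit_function_half_space[OF stable \<phi>0 cmp1]
  note grad = implicit_function_gradient_positive[OF \<phi>0 half implicit_function_isolated[OF isolated \<phi>0 cmp1]]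
  obtain \<kappa> where \<kappa>: "\<kappa> > 0" and lower: "\<forall>\<^sub>F x in nhds 0. (\<forall>j. Im (x $ j) \<ge> 0) \<longrightarrow>
    Im (cps_eval \<phi> (cvec (\<chi> j. Re (x $ j)))) + \<kappa> * (\<Sum>j\<in>UNIV. Im (x $ j)) \<le> Im (cps_eval \<phi> x)"
    using Im_lower_bound_half_space[OF grad] by blast
  obtain c N where "c > 0" "\<forall>\<^sub>F x in nhds 0. c * norm x ^ N \<le> Im (cps_eval \<phi> (cvec x))"
    using implicit_function_lojasiewicz[OF assms(2) isolated \<phi>0 C cmp1 half] by blast
  from polynomial_approximation[OF this] obtain g H :: "(real, 'd) mpoly" where
    H0: "Poly_Mapping.lookup H 0 = Re (cps_coeff \<phi> 0)" and
    approx: "\<forall>\<^sub>F x in nhds 0. norm (cps_eval \<phi> (cvec x) - (of_real (mpoly_eval H x) + \<i> * of_real (mpoly_eval g x)))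
      \<le> Im (cps_eval \<phi> (cvec x)) / 2"
    by blast
  define h where "h = cps_of_mpoly (Poly_Mapping.map complex_of_real H)"
  have coeff_h: "cps_coeff h m = of_real (Poly_Mapping.lookup H m)" for m
    by (simp add: h_def cps_of_mpoly.rep_eq map.rep_eq when_def)
  have eval_h: "cps_eval h (cvec x) = of_real (mpoly_eval H x)" for x
    unfolding h_def cps_eval_of_mpoly mpoly_eval_def of_real_sum
    by (rule sum.mono_neutral_cong_left)
      (auto simp: in_keys_iff map.rep_eq when_def monom_eval_def)
  have g_approx: "\<forall>\<^sub>F x in nhds 0. \<bar>Im (cps_eval \<phi> (cvec x)) - mpoly_eval g x\<bar> \<le> Im (cps_eval \<phi> (cvec x)) / 2"
    using approx
  proof eventually_elim
    case (elim x)
    then show ?case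
      using abs_Im_le_cmod[of "cps_eval \<phi> (cvec x) - (of_real (mpoly_eval H x) + \<i> * of_real (mpoly_eval g x))"]
      by simp
  qed
  note iff = admissible_numerators_iff[OF stable]
  let ?gen = "insert (cps_z + cps_incl h) (cps_incl ` IC g)"
  have bound_imp: "q \<in> admissible_numerators p"
    if "\<forall>\<^sub>F w in nhds 0. (\<forall>i. Im (w $ i) > 0) \<longrightarrow> norm (cps_eval q w) \<le> M * norm (w $ None + cps_eval \<phi> (without_z w))"
    for q M
  proof -
    have "\<forall>\<^sub>F w in nhds 0. (\<forall>i. Im (w $ i) > 0) \<longrightarrow> norm (cps_eval q w) \<le> (max M 0 * C) * norm (mpoly_eval p w)"
      using that cmp2
    proof eventually_elim
      case (elim w)
      have "M * norm (w $ None + cps_eval \<phi> (without_z w)) \<le> max M 0 * norm (w $ None + cps_eval \<phi> (without_z w))"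
        by (intro mult_right_mono) auto
      also have "\<dots> \<le> max M 0 * (C * norm (mpoly_eval p w))"
        using elim(2) by (intro mult_left_mono) auto
      finally show ?case using elim(1) by (auto simp: mult.assoc)
    qed
    then show ?thesis unfolding iff by blast
  qed
  have incl_mem: "cps_incl r \<in> admissible_numerators p" if r: "r \<in> IC g" for r
  proof -
    obtain D where D: "D > 0" "\<forall>\<^sub>F x in nhds 0. norm (cps_eval r (cvec x)) \<le> D * mpoly_eval g x"
      using r unfolding IC_def by blast
    from D(2) g_approx have "\<forall>\<^sub>F x in nhds 0. norm (cps_eval r (cvec x)) \<le> (2 * D) * Im (cps_eval \<phi> (cvec x))"
    proof eventually_elim
      case (elim x)
      have "mpoly_eval g x \<le> 2 * Im (cps_eval \<phi> (cvec x))" using elim(2) by linarith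
      then have "D * mpoly_eval g x \<le> D * (2 * Im (cps_eval \<phi> (cvec x)))"
        using D(1) by (intro mult_left_mono) auto
      then show ?case using elim(1) by simp
    qed
    from half_space_bound_from_real_bound[OF \<kappa> lower half this]
    show ?thesis using bound_imp[of "cps_incl r"] by (auto simp: cps_eval_incl_without_z)
  qed
  have z_mem: "cps_z + cps_incl h \<in> admissible_numerators p"
  proof -
    let ?r = "h - \<phi>"
    have "\<forall>\<^sub>F x in nhds 0. norm (cps_eval ?r (cvec x)) \<le> 2 * Im (cps_eval \<phi> (cvec x))"
      using approx g_approx eventually_cvec[OF eventually_cps_eval_minus[of h \<phi>]]
    proof eventually_elim
      case (elim x)
      have "cps_eval ?r (cvec x) =
          - (cps_eval \<phi> (cvec x) - (of_real (mpoly_eval H x) + \<i> * of_real (mpoly_eval g x))) - \<i> * of_real (mpoly_eval g x)"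
        by (simp add: elim(3) eval_h)
      then have "norm (cps_eval ?r (cvec x)) \<le>
          norm (cps_eval \<phi> (cvec x) - (of_real (mpoly_eval H x) + \<i> * of_real (mpoly_eval g x))) + \<bar>mpoly_eval g x\<bar>"
        using norm_triangle_ineq4[of "- (cps_eval \<phi> (cvec x) - (of_real (mpoly_eval H x) + \<i> * of_real (mpoly_eval g x)))"
            "\<i> * of_real (mpoly_eval g x)"]
        by (simp only: norm_minus_cancel norm_mult norm_ii norm_of_real mult_1_left)
      then show ?case using elim(1,2) by linarith
    qed
    from half_space_bound_from_real_bound[OF \<kappa> lower half this] obtain M where
      M: "\<forall>\<^sub>F w in nhds 0. (\<forall>i. Im (w $ i) > 0) \<longrightarrow>
        norm (cps_eval ?r (without_z w)) \<le> M * norm (w $ None + cps_eval \<phi> (without_z w))"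
      by blast
    from M eventually_without_z[OF eventually_cps_eval_minus[of h \<phi>]] eventually_cps_eval_plus[of cps_z "cps_incl h"]
    have "\<forall>\<^sub>F w in nhds 0. (\<forall>i. Im (w $ i) > 0) \<longrightarrow>
        norm (cps_eval (cps_z + cps_incl h) w) \<le> (1 + M) * norm (w $ None + cps_eval \<phi> (without_z w))"
    proof eventually_elim
      case (elim w)
      have "cps_eval (cps_z + cps_incl h) w = (w $ None + cps_eval \<phi> (without_z w)) + cps_eval ?r (without_z w)"
        by (simp add: elim cps_eval_z cps_eval_incl_without_z)
      then show ?case
        using elim(1) norm_triangle_ineq[of "w $ None + cps_eval \<phi> (without_z w)" "cps_eval ?r (without_z w)"]
        by (auto simp: distrib_right)
    qed
    then show ?thesis by (rule bound_imp)
  qed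
  have "ideal_gen ?gen \<subseteq> admissible_numerators p"
    unfolding ideal_gen_def
    by (rule module.span_minimal[OF module_times _ subspace_admissible_numerators[OF stable]])
      (use z_mem incl_mem in auto)
  moreover have "admissible_numerators p \<subseteq> ideal_gen ?gen"
  proof
    fix q assume q: "q \<in> admissible_numerators p"
    have 0: "cps_coeff (cps_z + cps_incl h) 0 = 0"
      using \<phi>0 by (simp add: plus_conv_ps.rep_eq cps_coeff_z cps_incl.rep_eq axis_eq_0_iff
          coeff_h H0 zero_vec_def[symmetric])
    have 1: "cps_coeff (cps_z + cps_incl h) (axis None 1) \<noteq> 0"
      by (simp add: plus_conv_ps.rep_eq cps_coeff_z cps_incl.rep_eq)
    obtain a r where ar: "q = a * (cps_z + cps_incl h) + cps_incl r"
      using division_regular_order_one[OF 0 1] by blast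
    \<comment> \<open>The remainder is admissible because \<open>q\<close> and \<open>z + H\<close> are.\<close>
    have "cps_incl r = q + (- a) * (cps_z + cps_incl h)" by (simp add: ar)
    also have "\<dots> \<in> admissible_numerators p"
      using subspace_admissible_numerators[OF stable] q z_mem
      unfolding module.subspace_def[OF module_times] by blast
    finally obtain M where
      M: "\<forall>\<^sub>F w in nhds 0. (\<forall>i. Im (w $ i) > 0) \<longrightarrow> norm (cps_eval (cps_incl r) w) \<le> M * norm (mpoly_eval p w)"
      unfolding iff by blast
    define M' where "M' = (\<bar>M\<bar> + 1) * C"
    have M': "M' > 0" using C by (auto simp: M'_def intro: mult_pos_pos)
    from M cmp1 have "\<forall>\<^sub>F w in nhds 0. (\<forall>i. Im (w $ i) > 0) \<longrightarrow>
        norm (cps_eval r (without_z w)) \<le> M' * norm (w $ None + cps_eval \<phi> (without_z w))"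
    proof eventually_elim
      case (elim w)
      have "M * norm (mpoly_eval p w) \<le> (\<bar>M\<bar> + 1) * norm (mpoly_eval p w)"
        by (intro mult_right_mono) auto
      also have "\<dots> \<le> (\<bar>M\<bar> + 1) * (C * norm (w $ None + cps_eval \<phi> (without_z w)))"
        using elim(2) by (intro mult_left_mono) auto
      finally show ?case using elim(1) by (auto simp: cps_eval_incl_without_z M'_def mult.assoc)
    qed
    from real_bound_from_half_space_bound[OF \<phi>0 half M' this] g_approx
    have "\<forall>\<^sub>F x in nhds 0. norm (cps_eval r (cvec x)) \<le> (2 * M') * mpoly_eval g x"
    proof eventually_elim
      case (elim x)
      have "Im (cps_eval \<phi> (cvec x)) \<le> 2 * mpoly_eval g x" using elim(2) by linarith
      then have "M' * Im (cps_eval \<phi> (cvec x)) \<le> M' * (2 * mpoly_eval g x)"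
        using M' by (intro mult_left_mono) auto
      then show ?case using elim(1) by simp
    qed
    moreover have "2 * M' > 0" using M' by simp
    ultimately have "r \<in> IC g" unfolding IC_def by blast
    then show "q \<in> ideal_gen ?gen"
      unfolding ar ideal_gen_def
      by (intro module.span_add[OF module_times] module.span_scale[OF module_times] module.span_base[OF module_times]) auto
  qed
  ultimately have "admissible_numerators p = ideal_gen ?gen" by (rule equalityI[rotated])
  then show ?thesis unfolding h_def by blast
qed


end
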